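(* Let $D<-4$ be the discriminant of an imaginary quadratic field with $D\equiv1\pmod4$ and $3\nmid D$. Let $N=|D|$, $\chi=\chi_D$, $h=h(D)$, and for $0\le k\le5$ let $$E_k(12)=\sum_{\frac{kN}{12}<x<\frac{(k+1)N}{12}}\chi(x),\qquad E_0=E_0(12).$$ Then: - if $N\equiv23\pmod{24}$: $E_1(12)=h-E_0$, $E_2(12)=0$, $E_3(12)=0$, $E_4(12)=h-E_0$, $E_5(12)=-h+E_0$; - if $N\equiv11\pmod{24}$: $E_1(12)=h-E_0$, $E_2(12)=-h$, $E_3(12)=h$, $E_4(12)=h-E_0$, $E_5(12)=h+E_0$; - if $N\equiv7\pmod{24}$: $E_1(12)=h-E_0$, $E_2(12)=0$, $E_3(12)=h$, $E_4(12)=-E_0$, $E_5(12)=-h+E_0$; - if $N\equiv19\pmod{24}$: $E_1(12)=-h-E_0$, $E_2(12)=h$, $E_3(12)=2h$, $E_4(12)=2h-E_0$, $E_5(12)=-h+E_0$.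
   Context: Here $D\equiv 1\pmod 4$ is a negative square-free integer, the discriminant of $K=\mathbb{Q}(\sqrt D)$; $h(D)$ is the order of the ideal class group of $K$; and $\chi_D(x)=\left(\frac{x}{N}\right)$ is the Jacobi symbol (equal to $0$ when $\gcd(x,N)>1$). Sums are over integers $x$ with $1\le x\le N$ and $\gcd(x,N)=1$ in the indicated open intervals. *)

theory Defs
  imports
    "HOL-Computational_Algebra.Computational_Algebra"
    "HOL-Number_Theory.Number_Theory"
    "HOL-Algebra.Ideal_Product"
    "HOL-Algebra.Coset"
begin

section \<open>Quadratic fields and the ideal class group\<close>

definition quadratic_field :: "int \<Rightarrow> complex set" where
  "quadratic_field D = {of_rat a + of_rat b * csqrt (of_int D) | a b. True}"

definition integers_of :: "complex set \<Rightarrow> complex set" where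
  "integers_of K = {z \<in> K. algebraic_int z}"

definition complex_ring :: "complex set \<Rightarrow> complex ring" where
  "complex_ring S = \<lparr>carrier = S, mult = (*), one = 1, zero = 0, add = (+)\<rparr>"

text \<open>
  A fractional ideal is a nonzero subset of the form \<open>d\<^sup>-\<^sup>1 J\<close> of the field, where \<open>J\<close> is an ideal
  of the ring of integers and \<open>d\<close> is a nonzero algebraic integer of the field.
\<close>

definition fractional_ideals :: "complex set \<Rightarrow> complex set set" where
  "fractional_ideals K =
     {I. I \<subseteq> K \<and> I \<noteq> {0} \<and>
         (\<exists>d \<in> integers_of K. d \<noteq> 0 \<and> ideal ((\<lambda>x. d * x) ` I) (complex_ring (integers_of K)))}"

definition principal_fractional_ideals :: "complex set \<Rightarrow> complex set set" where
  "principal_fractional_ideals K = {(\<lambda>x. a * x) ` integers_of K | a. a \<in> K \<and> a \<noteq> 0}"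

text \<open>
  \<^const>\<open>ideal_prod\<close> only uses the multiplication and addition of its ring argument, so it is also
  the product of fractional ideals, namely the set of finite sums of products.
\<close>

definition fractional_ideal_group :: "complex set \<Rightarrow> complex set monoid" where
  "fractional_ideal_group K =
     \<lparr>carrier = fractional_ideals K, mult = ideal_prod (complex_ring K), one = integers_of K\<rparr>"

definition ideal_class_group :: "complex set \<Rightarrow> complex set set monoid" where
  "ideal_class_group K = fractional_ideal_group K Mod principal_fractional_ideals K"

definition class_number :: "int \<Rightarrow> nat" where
  "class_number D = Coset.order (ideal_class_group (quadratic_field D))"


section \<open>Jacobi symbol and short character sums\<close>

text \<open>
  The Jacobi symbol \<open>(a/n)\<close> for odd \<open>n > 0\<close>. It vanishes when \<open>a\<close> and \<open>n\<close> are not coprime, since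
  \<^const>\<open>Legendre\<close> is \<open>0\<close> at multiples of the prime.
\<close>

definition Jacobi :: "int \<Rightarrow> int \<Rightarrow> int" where
  "Jacobi a n = (\<Prod>p\<in>#prime_factorization n. Legendre a p)"

definition quadratic_char :: "int \<Rightarrow> int \<Rightarrow> int" where
  "quadratic_char D x = Jacobi x \<bar>D\<bar>"

definition interval_char_sum :: "int \<Rightarrow> nat \<Rightarrow> nat \<Rightarrow> int" where
  "interval_char_sum D m k =
     (\<Sum>x \<in> {x. 1 \<le> x \<and> x \<le> \<bar>D\<bar> \<and> coprime x \<bar>D\<bar> \<and>
              real k * real_of_int \<bar>D\<bar> / real m < real_of_int x \<and>
              real_of_int x < real (k + 1) * real_of_int \<bar>D\<bar> / real m}. quadratic_char D x)"

end

theory Submission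
  imports Defs "HOL-Analysis.Analysis"
begin

text \<open>
  Write \<open>N = \<bar>D\<bar>\<close>. All five identities of a residue class are linear consequences of the class
  number formula \<open>h = - (\<Sum>\<^bsub>0 < x < N\<^esub> x \<chi>(x)) / N\<close>. Indeed, for \<open>m\<close> coprime to \<open>N\<close>,
  multiplication by \<open>m\<close> permutes the residues modulo \<open>N\<close>, and comparing \<open>m x\<close> with its residue
  \<open>m x - N \<lfloor>m x / N\<rfloor>\<close> gives \<open>\<Sum> \<chi>(x) \<lfloor>m x / N\<rfloor> = - (m - \<chi>(m)) h\<close> (lemma \<open>floor_moment\<close>). The floor is
  constant on the intervals \<open>(k N / m, (k + 1) N / m)\<close>, so \<open>m = 2, 3, 4, 6, 12\<close> yield five independent
  equations for the six sums over twelfths below \<open>N / 2\<close>; they leave \<open>E\<^sub>0\<close> free, and their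
  right-hand sides are multiples of \<open>h\<close> given by \<open>\<chi>(2)\<close> and \<open>\<chi>(3)\<close>, which are read off from \<open>N\<close>
  modulo \<open>8\<close> and \<open>3\<close>.

  The class number formula is obtained by comparing constant terms in the expansion at \<open>t \<rightarrow> 0\<close> of
  \<open>F(t) = \<Sum>\<^sub>J exp (- t norm(J))\<close>, summed over the nonzero ideals \<open>J\<close> of the ring of integers.

  On the one hand, the ideals in one ideal class are the \<open>\<alpha> L\<close>, where \<open>L\<close> is a fixed ideal of the
  class, \<open>\<alpha> \<noteq> 0\<close> runs through the inverse ideal, a lattice of rank two, and \<open>\<alpha>\<close> is determined up to
  sign because the units are \<open>\<plusminus>1\<close>. The norm of \<open>\<alpha> L\<close> is the value of a positive definite binary
  quadratic form at the coordinates of \<open>\<alpha>\<close>. Hence \<open>h + 2 F(t)\<close> is the sum of \<open>h\<close> theta series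
  (lemma \<open>class_theta\<close>), the summand \<open>h\<close> accounting for the origins of the lattices. A
  theta series is \<open>C / t + o(1)\<close>: it has no constant term. This is expressed by \<open>\<theta>(t) - 4 \<theta>(4 t) \<rightarrow> 0\<close>
  (theorem \<open>lattice_theta_constant_term\<close>), which eliminates \<open>C\<close>; since \<open>\<theta>(4 t)\<close> is the part of
  \<open>\<theta>(t)\<close> over the even lattice points, the difference is a combination of alternating Gaussian
  sums, and these tend to \<open>0\<close>.

  On the other hand, there are \<open>\<Sum>\<^bsub>d dvd n\<^esub> \<chi>(d)\<close> ideals of norm \<open>n\<close>
  (theorem \<open>card_ideal_triples_of_norm\<close>), because both sides are multiplicative in \<open>n\<close> and agree at prime
  powers by Hensel's lemma and quadratic reciprocity. So \<open>F(t) = \<Sum>\<^sub>d \<chi>(d) / (exp (d t) - 1)\<close>, and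
  \<open>F(t) - 4 F(4 t)\<close> is a sum of \<open>\<chi>(d)\<close> against a bounded convex weight with value \<open>3/2\<close> at \<open>0\<close>. Summation
  by parts shows that it tends to \<open>3/2\<close> times the mean over a period of the partial sums of \<open>\<chi>\<close>,
  which is \<open>- (\<Sum> x \<chi>(x)) / N\<close> (theorem \<open>ideal_series_constant_term\<close>). Comparing the two limits gives
  \<open>- 3 h + 3 \<cdot> (mean) = 0\<close> (theorem \<open>class_number_formula\<close>).

  The class group enters only through its cardinality: multiplying a fractional ideal by the principal
  ideals gives its homothety class, so \<open>h\<close> is the number of homothety classes
  (lemma \<open>class_number_eq_card\<close>), and these are represented by explicit lattices with basis \<open>a, b + \<omega>\<close>,
  where \<open>\<omega> = (1 + \<surd>D) / 2\<close>.
\<close>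

section \<open>The quadratic character\<close>

lemma Legendre_values: "Legendre a p \<in> {-1, 0, 1}"
  by (simp add: Legendre_def)

lemma odd_prime_int_gt_2: "prime p \<Longrightarrow> odd p \<Longrightarrow> 2 < p" for p :: int
  using prime_ge_2_int[of p] by (cases "p = 2") auto

lemma Legendre_cong: "[a = b] (mod p) \<Longrightarrow> Legendre a p = Legendre b p"
proof -
  assume ab: "[a = b] (mod p)"
  then have "[a = c] (mod p) \<longleftrightarrow> [b = c] (mod p)" "[c = a] (mod p) \<longleftrightarrow> [c = b] (mod p)" for c :: int
    using cong_trans[of a b p c] cong_trans[of b a p c] cong_trans[of c a p b] cong_trans[of c b p a]
      cong_sym[of a b p] by blast+
  then show ?thesis by (simp add: Legendre_def QuadRes_def)
qed

lemma cong_sign_imp_eq: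
  fixes a b p :: int
  assumes "[a = b] (mod p)" "a \<in> {-1, 0, 1}" "b \<in> {-1, 0, 1}" "2 < p"
  shows "a = b"
proof (rule ccontr)
  assume "a \<noteq> b"
  moreover have "p dvd a - b" using assms(1) by (simp add: cong_iff_dvd_diff)
  ultimately have "\<bar>p\<bar> \<le> \<bar>a - b\<bar>" using dvd_imp_le_int by auto
  then show False using assms by auto
qed

lemma euler_criterion_int:
  assumes "prime p" "odd (p::int)"
  shows "[Legendre a p = a ^ nat ((p - 1) div 2)] (mod p)"
proof -
  have p: "2 < p" "prime (nat p)" "int (nat p) = p"
    using assms odd_prime_int_gt_2[of p] by auto
  then have "(nat p - 1) div 2 = nat ((p - 1) div 2)" by fastforce
  then show ?thesis using euler_criterion[of "nat p" a] p by (metis nat_less_iff nat_numeral zless_nat_conj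
     of_nat_less_iff of_nat_numeral)
qed

lemma Legendre_mult:
  assumes "prime p" "odd (p::int)"
  shows "Legendre (a * b) p = Legendre a p * Legendre b p"
proof (rule cong_sign_imp_eq)
  have "[Legendre (a * b) p = (a * b) ^ nat ((p - 1) div 2)] (mod p)"
    using euler_criterion_int assms by blast
  also have "(a * b) ^ nat ((p - 1) div 2) = a ^ nat ((p - 1) div 2) * b ^ nat ((p - 1) div 2)"
    by (simp add: power_mult_distrib)
  also have "[\<dots> = Legendre a p * Legendre b p] (mod p)"
    using euler_criterion_int[OF assms] by (intro cong_mult) (auto intro: cong_sym)
  finally show "[Legendre (a * b) p = Legendre a p * Legendre b p] (mod p)" .
  show "Legendre a p * Legendre b p \<in> {-1, 0, 1}"
    using Legendre_values[of a p] Legendre_values[of b p] by auto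
qed (use assms odd_prime_int_gt_2 Legendre_values in auto)

lemma Legendre_eq_0_iff: "Legendre a p = 0 \<longleftrightarrow> p dvd a"
  by (auto simp: Legendre_def cong_0_iff)

lemma Legendre_one: "prime p \<Longrightarrow> odd (p::int) \<Longrightarrow> Legendre 1 p = 1"
  unfolding Legendre_def QuadRes_def using odd_prime_int_gt_2[of p]
  by (auto simp: cong_0_iff intro!: exI[of _ 1] dest: zdvd_imp_le)

lemma odd_nonneg_int_mod_4: "odd (n::int) \<Longrightarrow> n mod 4 = 1 \<or> n mod 4 = 3"
  by presburger

lemma neg_one_power_half:
  assumes "odd (p::int)" "0 < p"
  shows "(-1::int) ^ nat ((p - 1) div 2) = (if p mod 4 = 1 then 1 else -1)"
proof -
  have "even (nat ((p - 1) div 2)) \<longleftrightarrow> p mod 4 = 1"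
    using assms by (simp add: even_nat_iff) presburger
  then show ?thesis by (simp add: minus_one_power_iff)
qed

lemma Legendre_minus_one:
  assumes "prime p" "odd (p::int)"
  shows "Legendre (-1) p = (if p mod 4 = 1 then 1 else -1)"
proof (rule cong_sign_imp_eq)
  show "[Legendre (-1) p = (if p mod 4 = 1 then 1 else -1)] (mod p)"
    using euler_criterion_int[OF assms, of "-1"] neg_one_power_half[of p] assms
      odd_prime_int_gt_2[of p] by simp
qed (use assms odd_prime_int_gt_2 Legendre_values in auto)

lemma Legendre_two:
  assumes "prime p" "odd (p::int)"
  shows "Legendre 2 p = (if p mod 8 = 1 \<or> p mod 8 = 7 then 1 else -1)"
proof -
  define q where "q = nat p"
  have p: "2 < p" "p = int q" "prime q" "2 < q"
    using assms odd_prime_int_gt_2[of p] by (auto simp: q_def)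
  interpret GAUSS q 2
  proof
    show "[2 \<noteq> 0] (mod int q)" using p by (auto simp: cong_0_iff dest: zdvd_imp_le)
  qed (use p in auto)
  have "E = (\<lambda>x. 2 * x) ` {(p - 1) div 4 <.. (p - 1) div 2}"
  proof -
    have "C = (\<lambda>x. x * 2) ` A"
      unfolding C_def B_def image_image A_def using p(2) assms(2)
      by (intro image_cong refl mod_pos_pos_trivial) auto
    then have "E = (\<lambda>x. x * 2) ` A \<inter> {(p - 1) div 2 <..}"
      unfolding E_def p(2) by simp
    also have "\<dots> = (\<lambda>x. 2 * x) ` {(p - 1) div 4 <.. (p - 1) div 2}"
      unfolding A_def p(2)[symmetric] using p(1) assms(2) by (auto simp: image_iff)
    finally show ?thesis .
  qed
  then have "card E = card {(p - 1) div 4 <.. (p - 1) div 2}"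
    by (simp add: card_image inj_on_def)
  then have "card E = nat ((p - 1) div 2 - (p - 1) div 4)" by simp
  moreover have "even (nat ((p - 1) div 2 - (p - 1) div 4)) \<longleftrightarrow> p mod 8 = 1 \<or> p mod 8 = 7"
  proof -
    have "(p - 1) div 2 - (p - 1) div 4 \<ge> 0" using p(1) by linarith
    moreover have "even ((p - 1) div 2 - (p - 1) div 4) \<longleftrightarrow> p mod 8 = 1 \<or> p mod 8 = 7"
    proof -
      obtain k r where kr: "p = 8 * k + r" "r = 1 \<or> r = 3 \<or> r = 5 \<or> r = 7"
      proof
        show "p = 8 * (p div 8) + p mod 8" by simp
        show "p mod 8 = 1 \<or> p mod 8 = 3 \<or> p mod 8 = 5 \<or> p mod 8 = 7"
          using assms(2) by presburger
      qed
      from kr(2) show ?thesis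
      proof (elim disjE)
        assume "r = 1"
        then have "(p - 1) div 2 = 4 * k" "(p - 1) div 4 = 2 * k" "p mod 8 = 1" using kr(1) by presburger+
        then show ?thesis by simp
      next
        assume "r = 3"
        then have "(p - 1) div 2 = 4 * k + 1" "(p - 1) div 4 = 2 * k" "p mod 8 = 3" using kr(1) by presburger+
        then show ?thesis by simp
      next
        assume "r = 5"
        then have "(p - 1) div 2 = 4 * k + 2" "(p - 1) div 4 = 2 * k + 1" "p mod 8 = 5" using kr(1) by presburger+
        then show ?thesis by simp
      next
        assume "r = 7"
        then have "(p - 1) div 2 = 4 * k + 3" "(p - 1) div 4 = 2 * k + 1" "p mod 8 = 7" using kr(1) by presburger+
        then show ?thesis by simp
      qed
    qed
    ultimately show ?thesis by (simp add: even_nat_iff)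
  qed
  ultimately show ?thesis using gauss_lemma p(2) by (simp add: minus_one_power_iff)
qed

lemma Legendre_reciprocity:
  assumes "prime p" "odd (p::int)" "prime q" "odd q" "p \<noteq> q"
  shows "Legendre p q * Legendre q p = (if p mod 4 = 3 \<and> q mod 4 = 3 then -1 else 1)"
proof -
  have pq: "2 < p" "2 < q" using assms odd_prime_int_gt_2 by auto
  have "Legendre p q * Legendre q p = (-1::int) ^ nat ((p - 1) div 2 * ((q - 1) div 2))"
    using assms pq by (intro Quadratic_Reciprocity_int) auto
  moreover have "even (nat ((p - 1) div 2 * ((q - 1) div 2))) \<longleftrightarrow> \<not> (p mod 4 = 3 \<and> q mod 4 = 3)"
  proof -
    have "(p - 1) div 2 * ((q - 1) div 2) \<ge> 0" using pq by simp
    moreover have "even ((p - 1) div 2 * ((q - 1) div 2)) \<longleftrightarrow> even ((p - 1) div 2) \<or> even ((q - 1) div 2)"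
      by simp
    moreover have "even ((p - 1) div 2) \<longleftrightarrow> p mod 4 \<noteq> 3" "even ((q - 1) div 2) \<longleftrightarrow> q mod 4 \<noteq> 3"
      using assms(2) assms(4) by presburger+
    ultimately show ?thesis by (simp add: even_nat_iff)
  qed
  ultimately show ?thesis by (simp add: minus_one_power_iff)
qed

lemma prime_factors_odd:
  assumes "odd (n::int)" "q \<in># prime_factorization n"
  shows "prime q" "odd q" "q dvd n"
proof -
  show "prime q" "q dvd n" using assms by (auto dest: in_prime_factors_imp_prime)
  then show "odd q" using assms(1) dvd_trans by blast
qed

lemma Jacobi_mult:
  assumes "odd n"
  shows "Jacobi (a * b) n = Jacobi a n * Jacobi b n"
proof -
  have "Jacobi (a * b) n = (\<Prod>p\<in>#prime_factorization n. Legendre a p * Legendre b p)"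
    unfolding Jacobi_def
    by (intro arg_cong[where f = prod_mset] image_mset_cong Legendre_mult prime_factors_odd[OF assms])
  then show ?thesis by (simp add: Jacobi_def prod_mset.distrib)
qed

lemma Jacobi_cong:
  assumes "[a = b] (mod n)"
  shows "Jacobi a n = Jacobi b n"
  unfolding Jacobi_def
proof (intro arg_cong[where f = prod_mset] image_mset_cong Legendre_cong)
  fix p assume "p \<in># prime_factorization n"
  then have "p dvd n" by (rule in_prime_factors_imp_dvd)
  then show "[a = b] (mod p)" using assms by (rule cong_dvd_modulus[rotated])
qed

lemma Jacobi_one_right: "Jacobi a 1 = 1"
  by (simp add: Jacobi_def)

lemma Jacobi_prime_mult_right:
  "prime p \<Longrightarrow> n \<noteq> 0 \<Longrightarrow> Jacobi a (p * n) = Legendre a p * Jacobi a n"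
  by (simp add: Jacobi_def prime_factorization_times_prime)

lemma odd_pos_int_induct [consumes 2, case_names one prime_mult]:
  fixes n :: int
  assumes "odd n" "0 < n" and one: "P 1"
    and step: "\<And>p n. prime p \<Longrightarrow> odd p \<Longrightarrow> odd n \<Longrightarrow> 0 < n \<Longrightarrow> P n \<Longrightarrow> P (p * n)"
  shows "P n"
proof -
  have "odd n \<and> 0 < n \<longrightarrow> P n"
  proof (induction n rule: prime_divisors_induct)
    case (unit x)
    then show ?case using one by auto
  next
    case (factor p x)
    then show ?case using step[of p x] by (auto simp: zero_less_mult_iff dest: prime_gt_0_int)
  qed auto
  then show ?thesis using assms by blast
qed

lemma Jacobi_one: "odd n \<Longrightarrow> 0 < n \<Longrightarrow> Jacobi 1 n = 1"
  by (induction n rule: odd_pos_int_induct)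
     (auto simp: Jacobi_one_right Jacobi_prime_mult_right Legendre_one)

lemma Jacobi_values: "Jacobi a n \<in> {-1, 0, 1}"
proof -
  have "(\<Prod>p\<in>#M. Legendre a p) \<in> {-1, 0, 1}" for M
  proof (induction M)
    case (add p M)
    then show ?case using Legendre_values[of a p] by auto
  qed auto
  then show ?thesis by (simp add: Jacobi_def)
qed

lemma Jacobi_eq_0_iff:
  assumes "n \<noteq> 0"
  shows "Jacobi a n = 0 \<longleftrightarrow> \<not> coprime a n"
proof -
  have "Jacobi a n = 0 \<longleftrightarrow> (\<exists>p. p \<in># prime_factorization n \<and> p dvd a)"
    unfolding Jacobi_def by (auto simp: prod_mset_zero_iff image_iff Legendre_eq_0_iff)
  also have "\<dots> \<longleftrightarrow> (\<exists>p. prime p \<and> p dvd a \<and> p dvd n)"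
    using assms by (auto simp: prime_factors_dvd)
  also have "\<dots> \<longleftrightarrow> \<not> coprime a n"
  proof
    assume "\<exists>p. prime p \<and> p dvd a \<and> p dvd n"
    then show "\<not> coprime a n" using coprime_common_divisor not_prime_unit by blast
  next
    assume "\<not> coprime a n"
    then have "\<not> is_unit (gcd a n)" by (simp add: coprime_iff_gcd_eq_1)
    then obtain p where "prime p" "p dvd gcd a n"
      using assms prime_divisor_exists[of "gcd a n"] by auto
    then show "\<exists>p. prime p \<and> p dvd a \<and> p dvd n" by auto
  qed
  finally show ?thesis .
qed

text \<open>
  The supplementary laws and the reciprocity law extend from primes to odd moduli because both sides
  are multiplicative in the modulus.
\<close>

lemma Jacobi_minus_one:
  assumes "odd n" "0 < n"
  shows "Jacobi (-1) n = (if n mod 4 = 1 then 1 else -1)"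
  using assms
proof (induction n rule: odd_pos_int_induct)
  case (prime_mult p n)
  have m: "p mod 4 = 1 \<or> p mod 4 = 3" "n mod 4 = 1 \<or> n mod 4 = 3"
    using prime_mult(2,3) odd_nonneg_int_mod_4 by blast+
  have "(p * n) mod 4 = ((p mod 4) * (n mod 4)) mod 4"
    by (simp add: mod_mult_eq)
  then have "(p * n) mod 4 = (if p mod 4 = n mod 4 then 1 else 3)"
    using m by auto
  then show ?case
    using m prime_mult Legendre_minus_one[of p] by (auto simp: Jacobi_prime_mult_right)
qed (simp add: Jacobi_one_right)

lemma Jacobi_two:
  assumes "odd n" "0 < n"
  shows "Jacobi 2 n = (if n mod 8 = 1 \<or> n mod 8 = 7 then 1 else -1)"
  using assms
proof (induction n rule: odd_pos_int_induct)
  case (prime_mult p n)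
  have m: "n mod 8 = 1 \<or> n mod 8 = 3 \<or> n mod 8 = 5 \<or> n mod 8 = 7" if "odd n" for n :: int
    using that by presburger
  have "(p * n) mod 8 = ((p mod 8) * (n mod 8)) mod 8"
    by (simp add: mod_mult_eq)
  then have "(p * n) mod 8 = 1 \<or> (p * n) mod 8 = 7 \<longleftrightarrow>
      (p mod 8 = 1 \<or> p mod 8 = 7) = (n mod 8 = 1 \<or> n mod 8 = 7)"
    using m[OF prime_mult(2)] m[OF prime_mult(3)] by (elim disjE) simp_all
  moreover have "Jacobi 2 (p * n) = Legendre 2 p * Jacobi 2 n"
    using prime_mult by (simp add: Jacobi_prime_mult_right)
  ultimately show ?case
    unfolding prime_mult.IH Legendre_two[OF prime_mult(1,2)] by simp
qed (simp add: Jacobi_one_right)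

lemma Jacobi_reciprocity:
  assumes "odd n" "0 < n" and p: "prime p" "odd p" and "\<not> p dvd n"
  shows "Jacobi p n * Legendre n p = (if p mod 4 = 3 \<and> n mod 4 = 3 then -1 else 1)"
  using assms(1,2,5)
proof (induction n rule: odd_pos_int_induct)
  case one
  then show ?case using p by (simp add: Legendre_one Jacobi_one_right)
next
  case (prime_mult q n)
  have m: "p mod 4 = 1 \<or> p mod 4 = 3" "q mod 4 = 1 \<or> q mod 4 = 3" "n mod 4 = 1 \<or> n mod 4 = 3"
    using prime_mult(2,3) p(2) odd_nonneg_int_mod_4 by blast+
  have "(q * n) mod 4 = ((q mod 4) * (n mod 4)) mod 4"
    by (simp add: mod_mult_eq)
  then have mm: "(q * n) mod 4 = (if q mod 4 = n mod 4 then 1 else 3)"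
    using m by auto
  have "p \<noteq> q" "\<not> p dvd n" using prime_mult.prems by auto
  have "Jacobi p (q * n) * Legendre (q * n) p
    = (Legendre p q * Legendre q p) * (Jacobi p n * Legendre n p)"
    using Legendre_mult[OF p] prime_mult(1,4) by (simp add: Jacobi_prime_mult_right)
  also have "\<dots> = (if p mod 4 = 3 \<and> q mod 4 = 3 then -1 else 1) *
      (if p mod 4 = 3 \<and> n mod 4 = 3 then -1 else 1)"
    using Legendre_reciprocity[OF p prime_mult(1,2)] prime_mult.IH \<open>p \<noteq> q\<close> \<open>\<not> p dvd n\<close> by simp
  also have "\<dots> = (if p mod 4 = 3 \<and> (q * n) mod 4 = 3 then -1 else 1)"
    using m mm by auto
  finally show ?case .
qed

locale odd_imaginary_discriminant =
  fixes D :: int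
  assumes D_less: "D < -4" and D_squarefree: "squarefree D" and D_mod_4: "[D = 1] (mod 4)"
begin

definition N :: int where "N = - D"

abbreviation chi :: "int \<Rightarrow> int" where "chi \<equiv> quadratic_char D"

lemma N_gt: "N > 4" and N_odd: "odd N" and N_mod_4: "N mod 4 = 3" and abs_D: "\<bar>D\<bar> = N"
proof -
  have "D mod 4 = 1" using D_mod_4 by (simp add: Cong.cong_def)
  then show "odd N" "N mod 4 = 3" unfolding N_def by presburger+
  show "N > 4" "\<bar>D\<bar> = N" using D_less by (simp_all add: N_def)
qed

lemma chi_eq: "chi x = Jacobi x N"
  by (simp add: quadratic_char_def abs_D)

lemma chi_mult: "chi (a * b) = chi a * chi b"
  by (simp add: chi_eq Jacobi_mult N_odd)

lemma chi_cong: "[a = b] (mod N) \<Longrightarrow> chi a = chi b"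
  by (simp add: chi_eq Jacobi_cong)

lemma chi_values: "chi a \<in> {-1, 0, 1}"
  by (simp add: chi_eq Jacobi_values del: insert_iff)

lemma chi_one: "chi 1 = 1"
  using N_gt by (simp add: chi_eq Jacobi_one N_odd)

lemma chi_eq_0_iff: "chi a = 0 \<longleftrightarrow> \<not> coprime a N"
  using N_gt by (simp add: chi_eq Jacobi_eq_0_iff)

lemma chi_minus: "chi (- a) = - chi a"
proof -
  have "chi (-1) = -1" using N_gt N_odd N_mod_4 by (simp add: chi_eq Jacobi_minus_one)
  then show ?thesis using chi_mult[of "-1" a] by simp
qed

lemma chi_two: "chi 2 = (if N mod 8 = 7 then 1 else -1)"
  using N_gt N_odd N_mod_4 by (simp add: chi_eq Jacobi_two) presburger

text \<open>
  Reciprocity turns \<open>(p/N)\<close> into \<open>(N/p)\<close>; as \<open>N\<close> is \<open>3\<close> modulo \<open>4\<close>, its sign is \<open>(-1/p)\<close>, which is absorbed by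
  passing from \<open>N\<close> to \<open>D = - N\<close>. So \<open>\<chi>\<close> describes how primes split.
\<close>

lemma chi_odd_prime:
  assumes "prime p" "odd p"
  shows "chi p = Legendre D p"
proof (cases "p dvd N")
  case True
  then have "chi p = 0" using assms by (auto simp: chi_eq_0_iff)
     (metis coprime_absorb_left not_prime_unit)
  then show ?thesis using True by (simp add: Legendre_eq_0_iff N_def)
next
  case False
  have "chi p * Legendre N p = (if p mod 4 = 3 then -1 else 1)"
    using Jacobi_reciprocity[of N p] assms False N_gt N_odd N_mod_4 by (simp add: chi_eq)
  moreover have "Legendre D p = Legendre (-1) p * Legendre N p"
    using Legendre_mult[OF assms, of "-1" N] by (simp add: N_def)
  moreover have "Legendre N p \<in> {-1, 0, 1}" "Legendre N p \<noteq> 0"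
    using Legendre_values False by (simp_all only: Legendre_eq_0_iff not_False_eq_True)
  ultimately show ?thesis using Legendre_minus_one[OF assms] odd_nonneg_int_mod_4[OF assms(2)]
    by auto
qed

end


section \<open>The number of ideals of given norm\<close>

definition dirichlet_conv :: "(nat \<Rightarrow> int) \<Rightarrow> (nat \<Rightarrow> int) \<Rightarrow> nat \<Rightarrow> int" where
  "dirichlet_conv f g n = (\<Sum>d | d dvd n. f d * g (n div d))"

definition coprime_multiplicative :: "(nat \<Rightarrow> int) \<Rightarrow> bool" where
  "coprime_multiplicative f \<longleftrightarrow> f 1 = 1 \<and> (\<forall>a b. a > 0 \<longrightarrow> b > 0 \<longrightarrow> coprime a b \<longrightarrow> f (a * b) = f a * f b)"

lemma coprime_multiplicativeD:
  "coprime_multiplicative f \<Longrightarrow> a > 0 \<Longrightarrow> b > 0 \<Longrightarrow> coprime a b \<Longrightarrow> f (a * b) = f a * f b"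
  by (simp add: coprime_multiplicative_def)

text \<open>
  A divisor of a product of coprime numbers factors uniquely into divisors of the factors, which
  are recovered as greatest common divisors.
\<close>

lemma dirichlet_conv_multiplicative:
  assumes f: "coprime_multiplicative f" and g: "coprime_multiplicative g"
  shows "coprime_multiplicative (dirichlet_conv f g)"
  unfolding coprime_multiplicative_def
proof (intro conjI allI impI)
  show "dirichlet_conv f g 1 = 1"
    using f g by (simp add: dirichlet_conv_def coprime_multiplicative_def)
  fix a b :: nat assume ab: "a > 0" "b > 0" "coprime a b"
  have "(\<Sum>d | d dvd a. f d * g (a div d)) * (\<Sum>d | d dvd b. f d * g (b div d))
    = (\<Sum>(d, e)\<in>{d. d dvd a} \<times> {e. e dvd b}. (f d * g (a div d)) * (f e * g (b div e)))"
    by (simp add: sum_product sum.cartesian_product)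
  also have "\<dots> = (\<Sum>n | n dvd a * b. f n * g (a * b div n))"
  proof (rule sum.reindex_bij_witness[where j = "\<lambda>(d, e). d * e" and i = "\<lambda>n. (gcd n a, gcd n b)"];
         clarsimp?)
    fix d e assume de: "d dvd a" "e dvd b"
    obtain k l where kl: "a = d * k" "b = e * l" using de by (elim dvdE)
    have pos: "d > 0" "e > 0" "k > 0" "l > 0" using ab kl by auto
    have c: "coprime d e" "coprime k l" "coprime a e" "coprime b d"
      using ab(3) unfolding kl by (simp_all add: coprime_commute)
    show "gcd (d * e) a = d \<and> gcd (d * e) b = e"
      using gcd_mult_left_right_cancel[OF c(3), of d] gcd_mult_left_left_cancel[OF c(4), of e] de
      by (simp add: gcd_nat.absorb1)
    show "d * e dvd a * b" using de by (rule mult_dvd_mono)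
    have "f (d * e) = f d * f e" using pos c by (intro coprime_multiplicativeD[OF f])
    moreover have "a * b div (d * e) = k * l" "a div d = k" "b div e = l"
      using pos kl by (simp_all add: div_mult_div_if_dvd)
    moreover have "g (k * l) = g k * g l" using pos c by (intro coprime_multiplicativeD[OF g])
    ultimately show "f (d * e) * g (a * b div (d * e)) = f d * g (a div d) * (f e * g (b div e))"
      by simp
  next
    fix n assume n: "n dvd a * b"
    show "gcd n a * gcd n b = n"
    proof (rule dvd_antisym)
      have "coprime (gcd n a) (gcd n b)" using ab(3) by (meson coprime_divisors gcd_dvd2)
      then show "gcd n a * gcd n b dvd n" by (intro divides_mult) auto
      obtain d e where "n = d * e" "d dvd a" "e dvd b" using division_decomp[OF n] by blast
      then show "n dvd gcd n a * gcd n b" by (metis dvd_triv_left dvd_triv_right gcd_greatest mult_dvd_mono)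
    qed
  qed
  finally show "dirichlet_conv f g (a * b) = dirichlet_conv f g a * dirichlet_conv f g b"
    by (simp add: dirichlet_conv_def)
qed

lemma coprime_multiplicative_eqI:
  assumes f: "coprime_multiplicative f" and g: "coprime_multiplicative g"
    and eq: "\<And>p k. prime p \<Longrightarrow> f (p ^ k) = g (p ^ k)" and "n > 0"
  shows "f n = g n"
  using \<open>n > 0\<close>
proof (induction n rule: less_induct)
  case (less n)
  show ?case
  proof (cases "n = 1")
    case True
    then show ?thesis using f g by (simp add: coprime_multiplicative_def)
  next
    case False
    then obtain p where p: "prime p" "p dvd n" using prime_factor_nat by blast
    then obtain m where m: "n = p ^ multiplicity p n * m" "\<not> p dvd m"
      using multiplicity_decompose'[of n p] less.prems by (metis less_numeral_extra(3) not_prime_unit)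
    define k where "k = multiplicity p n"
    have "k > 0" using p less.prems by (simp add: k_def prime_multiplicity_gt_zero_iff)
    then have "p ^ k > 1" using p prime_gt_1_nat one_less_power by blast
    have n: "n = p ^ k * m" using m k_def by simp
    have "m > 0" using n less.prems by (cases m) auto
    have "m < n" using n \<open>p ^ k > 1\<close> \<open>m > 0\<close> by simp
    then have IH: "f m = g m" using less.IH \<open>m > 0\<close> by blast
    have cop: "coprime (p ^ k) m" using p m by (simp add: prime_imp_coprime coprime_power_left_iff)
    have pos: "p ^ k > 0" using \<open>p ^ k > 1\<close> by linarith
    have "f (p ^ k * m) = f (p ^ k) * f m"
      by (rule coprime_multiplicativeD[OF f pos \<open>m > 0\<close> cop])
    moreover have "g (p ^ k * m) = g (p ^ k) * g m"
      by (rule coprime_multiplicativeD[OF g pos \<open>m > 0\<close> cop])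
    ultimately have "f (p ^ k * m) = g (p ^ k * m)" using IH eq[OF p(1), of k] by simp
    then show ?thesis using n by simp
  qed
qed

lemma dirichlet_conv_prime_power:
  assumes "prime p"
  shows "dirichlet_conv f g (p ^ k) = (\<Sum>i\<le>k. f (p ^ i) * g (p ^ (k - i)))"
proof -
  have "{d. d dvd p ^ k} = (\<lambda>i. p ^ i) ` {..k}"
    using divides_primepow_nat[OF assms] by auto
  moreover have "inj_on (\<lambda>i. p ^ i) {..k}"
    using prime_gt_1_nat[OF assms] by (auto simp: inj_on_def)
  ultimately have "dirichlet_conv f g (p ^ k) = (\<Sum>i\<le>k. f (p ^ i) * g (p ^ k div p ^ i))"
    by (simp add: dirichlet_conv_def sum.reindex)
  also have "\<dots> = (\<Sum>i\<le>k. f (p ^ i) * g (p ^ (k - i)))"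
    using prime_gt_0_nat[OF assms] by (intro sum.cong refl) (simp add: power_diff)
  finally show ?thesis .
qed

definition square_indicator :: "nat \<Rightarrow> int" where
  "square_indicator n = of_bool (is_nth_power 2 n)"

lemma square_indicator_multiplicative: "coprime_multiplicative square_indicator"
  unfolding coprime_multiplicative_def square_indicator_def
  using is_nth_power_mult_coprime_nat_iff[of _ _ 2]
  by (auto simp: of_bool_def)

lemma square_indicator_prime_power: "prime p \<Longrightarrow> square_indicator (p ^ k) = of_bool (even k)"
  by (simp add: square_indicator_def is_nth_power_prime_power_nat_iff)

context odd_imaginary_discriminant
begin

text \<open>
  The norm of \<open>x + \<omega>\<close> for \<open>\<omega> = (1 + \<surd>D) / 2\<close>. An ideal with basis \<open>a, b + \<omega>\<close> exists precisely when
  \<open>a\<close> divides the norm of \<open>b + \<omega>\<close>.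
\<close>

definition nrm :: "int \<Rightarrow> int" where
  "nrm x = x\<^sup>2 + x + (N + 1) div 4"

definition nrm_roots :: "nat \<Rightarrow> int set" where
  "nrm_roots a = {b. 0 \<le> b \<and> b < int a \<and> int a dvd nrm b}"

definition rho :: "nat \<Rightarrow> int" where
  "rho a = int (card (nrm_roots a))"

lemma four_c: "4 * ((N + 1) div 4) = N + 1"
  using N_mod_4 by presburger

lemma four_nrm: "4 * nrm x = (2 * x + 1)\<^sup>2 + N"
  using four_c by (simp add: nrm_def power2_eq_square algebra_simps)

lemma nrm_add: "nrm (x + y) = nrm x + y * (2 * x + 1) + y\<^sup>2"
  by (simp add: nrm_def power2_eq_square algebra_simps)

lemma dvd_nrm_add: "m dvd y \<Longrightarrow> m dvd nrm (x + y) \<longleftrightarrow> m dvd nrm x"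
  by (simp add: nrm_add power2_eq_square dvd_add_left_iff add.assoc)

lemma dvd_nrm_cong: "m dvd x - y \<Longrightarrow> m dvd nrm x \<longleftrightarrow> m dvd nrm y"
  using dvd_nrm_add[of m "x - y" y] by simp

lemma dvd_nrm_mod: "m dvd nrm (x mod m) \<longleftrightarrow> m dvd nrm x"
  by (rule dvd_nrm_cong) (simp add: mod_eq_dvd_iff[symmetric])

lemma finite_nrm_roots: "finite (nrm_roots a)"
  by (rule finite_subset[of _ "{0..<int a}"]) (auto simp: nrm_roots_def)

lemma rho_multiplicative: "coprime_multiplicative rho"
  unfolding coprime_multiplicative_def
proof (intro conjI allI impI)
  have "nrm_roots 1 = {0}" by (auto simp: nrm_roots_def)
  then show "rho 1 = 1" by (simp add: rho_def)
  fix a b :: nat assume ab: "a > 0" "b > 0" "coprime a b"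
  then have cop: "coprime (int a) (int b)" by simp
  have "bij_betw (\<lambda>x. (x mod int a, x mod int b)) (nrm_roots (a * b)) (nrm_roots a \<times> nrm_roots b)"
    unfolding bij_betw_def
  proof (intro conjI)
    show "inj_on (\<lambda>x. (x mod int a, x mod int b)) (nrm_roots (a * b))"
    proof (rule inj_onI, clarify)
      fix x y assume xy: "x \<in> nrm_roots (a * b)" "y \<in> nrm_roots (a * b)"
        "x mod int a = y mod int a" "x mod int b = y mod int b"
      then have "int a dvd x - y" "int b dvd x - y" by (simp_all add: mod_eq_dvd_iff)
      then have "int a * int b dvd x - y" using cop divides_mult by blast
      then have "x mod (int a * int b) = y mod (int a * int b)" by (simp add: mod_eq_dvd_iff)
      then show "x = y" using xy by (simp add: nrm_roots_def)
    qed
    show "(\<lambda>x. (x mod int a, x mod int b)) ` nrm_roots (a * b) = nrm_roots a \<times> nrm_roots b"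
    proof (intro equalityI subsetI)
      fix z assume "z \<in> (\<lambda>x. (x mod int a, x mod int b)) ` nrm_roots (a * b)"
      then obtain x where x: "z = (x mod int a, x mod int b)" "int (a * b) dvd nrm x"
        by (auto simp: nrm_roots_def)
      then have "int a dvd nrm x" "int b dvd nrm x" by (auto elim: dvd_mult_left dvd_mult_right)
      then show "z \<in> nrm_roots a \<times> nrm_roots b"
        using x ab by (auto simp: nrm_roots_def dvd_nrm_mod)
    next
      fix z assume "z \<in> nrm_roots a \<times> nrm_roots b"
      then obtain u v where z: "z = (u, v)" and u: "u \<in> nrm_roots a" and v: "v \<in> nrm_roots b" by auto
      obtain x where x: "[x = u] (mod int a)" "[x = v] (mod int b)"
        using binary_chinese_remainder_int[OF cop] by blast
      define y where "y = x mod (int a * int b)"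
      have y: "y mod int a = u" "y mod int b = v" "0 \<le> y" "y < int a * int b"
        using x u v ab by (auto simp: y_def mod_mod_cancel Cong.cong_def nrm_roots_def)
      have "int a dvd nrm y" "int b dvd nrm y"
        using u v dvd_nrm_mod[of "int a" y] dvd_nrm_mod[of "int b" y] y by (auto simp: nrm_roots_def)
      then have "int a * int b dvd nrm y" using cop divides_mult by blast
      then show "z \<in> (\<lambda>x. (x mod int a, x mod int b)) ` nrm_roots (a * b)"
        using y z by (auto simp: nrm_roots_def intro!: image_eqI[of _ _ y])
    qed
  qed
  then have "card (nrm_roots (a * b)) = card (nrm_roots a) * card (nrm_roots b)"
    by (simp add: bij_betw_same_card card_cartesian_product)
  then show "rho (a * b) = rho a * rho b" by (simp add: rho_def)
qed

lemma nrm_derivative_coprime: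
  assumes "prime p" "\<not> p dvd N" "p dvd nrm x"
  shows "coprime p (2 * x + 1)"
proof -
  have "\<not> p dvd 2 * x + 1"
  proof
    assume "p dvd 2 * x + 1"
    then have "p dvd (2 * x + 1)\<^sup>2" by (simp add: power2_eq_square)
    moreover have "N = 4 * nrm x - (2 * x + 1)\<^sup>2" by (simp add: four_nrm)
    ultimately show False using assms by (simp add: dvd_diff)
  qed
  then show ?thesis using assms(1) prime_imp_coprime by blast
qed

text \<open>
  Hensel lifting: by \<open>4 N(x + \<omega>) = (2 x + 1)\<^sup>2 + N\<close> the derivative \<open>2 x + 1\<close> is a unit at every root
  when \<open>p\<close> does not divide \<open>N\<close>. This covers \<open>p = 2\<close>.
\<close>

lemma rho_prime_power_Suc:
  assumes p: "prime p" "\<not> int p dvd N" and k: "k \<ge> 1"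
  shows "rho (p ^ Suc k) = rho (p ^ k)"
proof -
  define P q where "P = int p" and "q = P ^ k"
  have P: "prime P" "P > 0" "\<not> P dvd N" using p prime_gt_0_nat by (auto simp: P_def)
  have q: "q > 0" "int (p ^ k) = q" "int (p ^ Suc k) = q * P" "P dvd q"
    using P k by (auto simp: q_def P_def mult.commute dvd_power)
  have root_lift: "q * P dvd nrm (x + q * s) \<longleftrightarrow> P dvd nrm x div q + s * (2 * x + 1)"
    if "q dvd nrm x" for x s
  proof -
    have "nrm (x + q * s) = q * (nrm x div q + s * (2 * x + 1)) + q * q * s\<^sup>2"
      using that by (simp add: nrm_add power2_eq_square algebra_simps)
    moreover have "q * P dvd q * q * s\<^sup>2" using q(4) by (simp add: mult.assoc dvd_mult2)
    ultimately have "q * P dvd nrm (x + q * s) \<longleftrightarrow> q * P dvd q * (nrm x div q + s * (2 * x + 1))"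
      by (simp add: dvd_add_left_iff)
    then show ?thesis using q(1) by simp
  qed
  have "bij_betw (\<lambda>x. x mod q) (nrm_roots (p ^ Suc k)) (nrm_roots (p ^ k))"
    unfolding bij_betw_def
  proof (intro conjI)
    show "inj_on (\<lambda>x. x mod q) (nrm_roots (p ^ Suc k))"
    proof (rule inj_onI)
      fix x y assume xy: "x \<in> nrm_roots (p ^ Suc k)" "y \<in> nrm_roots (p ^ Suc k)" "x mod q = y mod q"
      then have "q dvd y - x" by (metis mod_eq_dvd_iff)
      then obtain s where s: "y = x + q * s" by (metis add.commute diff_add_cancel dvd_def)
      have d: "q * P dvd nrm x" "q * P dvd nrm (x + q * s)" using xy q s by (auto simp: nrm_roots_def)
      have dq: "q dvd nrm x" using d(1) by (rule dvd_mult_left)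
      have "P dvd nrm x" using d(1) by (rule dvd_mult_right)
      then have cop: "coprime P (2 * x + 1)" using nrm_derivative_coprime P by blast
      have "P dvd nrm x div q + s * (2 * x + 1)" "P dvd nrm x div q"
        using root_lift[OF dq, of s] root_lift[OF dq, of 0] d by auto
      then have "P dvd s * (2 * x + 1)" by (simp add: dvd_add_right_iff)
      then have "P dvd s" using cop by (simp add: coprime_dvd_mult_left_iff)
      then have "q * P dvd y - x" using s by simp
      then have "x mod (q * P) = y mod (q * P)" by (metis mod_eq_dvd_iff)
      moreover have "x mod (q * P) = x" "y mod (q * P) = y"
        using xy(1,2) q(3) by (auto simp: nrm_roots_def)
      ultimately show "x = y" by simp
    qed
    show "(\<lambda>x. x mod q) ` nrm_roots (p ^ Suc k) = nrm_roots (p ^ k)"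
    proof (intro equalityI subsetI)
      fix z assume "z \<in> (\<lambda>x. x mod q) ` nrm_roots (p ^ Suc k)"
      then obtain x where x: "z = x mod q" "q * P dvd nrm x" using q by (auto simp: nrm_roots_def)
      then have "q dvd nrm x" by (auto elim: dvd_mult_left)
      then show "z \<in> nrm_roots (p ^ k)" using x q by (simp add: nrm_roots_def dvd_nrm_mod)
    next
      fix x assume x: "x \<in> nrm_roots (p ^ k)"
      then have dq: "q dvd nrm x" and xq: "0 \<le> x" "x < q" using q by (auto simp: nrm_roots_def)
      then have "P dvd nrm x" using q(4) dvd_trans by blast
      then have "coprime (2 * x + 1) P" using nrm_derivative_coprime P coprime_commute by blast
      then obtain u where u: "[(2 * x + 1) * u = 1] (mod P)" using cong_solve_coprime_int by blast
      define s where "s = - u * (nrm x div q)"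
      have "nrm x div q + s * (2 * x + 1) = - (nrm x div q) * ((2 * x + 1) * u - 1)"
        by (simp add: s_def algebra_simps)
      moreover have "P dvd (2 * x + 1) * u - 1" using u by (simp add: cong_iff_dvd_diff)
      ultimately have "P dvd nrm x div q + s * (2 * x + 1)" by simp
      then have "q * P dvd nrm (x + q * s)" using root_lift[OF dq] by blast
      then have "(x + q * s) mod (q * P) \<in> nrm_roots (p ^ Suc k)"
        using dvd_nrm_mod[of "q * P" "x + q * s"] q(1,3) P(2) pos_mod_bound[of "q * P"]
          pos_mod_sign[of "q * P"] by (simp add: nrm_roots_def del: of_nat_power power_Suc)
      moreover have "(x + q * s) mod (q * P) mod q = x" using xq by (simp add: mod_mod_cancel)
      ultimately show "x \<in> (\<lambda>x. x mod q) ` nrm_roots (p ^ Suc k)" by (metis image_eqI)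
    qed
  qed
  then show ?thesis by (simp add: rho_def bij_betw_same_card)
qed

lemma rho_odd_prime:
  assumes p: "prime p" "odd p"
  shows "rho p = 1 + chi (int p)"
proof -
  define P where "P = int p"
  have P: "prime P" "odd P" "P > 2" using p odd_prime_int_gt_2[of P] by (auto simp: P_def)
  have dvd4: "P dvd nrm b \<longleftrightarrow> P dvd (2 * b + 1)\<^sup>2 - D" for b
  proof -
    have "coprime P (2 ^ 2)" using P(2) by (subst coprime_power_right_iff) simp
    then have "P dvd nrm b \<longleftrightarrow> P dvd 4 * nrm b" using coprime_dvd_mult_right_iff[of P 4 "nrm b"] by simp
    then show ?thesis by (simp add: four_nrm N_def)
  qed
  show ?thesis
  proof (cases "QuadRes P D")
    case False
    have "nrm_roots p = {}"
      using False by (auto simp: nrm_roots_def P_def[symmetric] dvd4 QuadRes_def cong_iff_dvd_diff)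
    moreover have "\<not> P dvd D"
      using False unfolding QuadRes_def by (auto simp: cong_iff_dvd_diff dest: spec[of _ 0])
    ultimately show ?thesis
      using False chi_odd_prime[OF P(1,2)] by (simp add: rho_def Legendre_def cong_0_iff P_def)
  next
    case True
    then obtain y where y: "P dvd y\<^sup>2 - D" by (auto simp: QuadRes_def cong_iff_dvd_diff)
    \<comment> \<open>\<open>(P + 1) / 2\<close> inverts \<open>2\<close> modulo \<open>P\<close>, so \<open>r z\<close> solves \<open>2 b + 1 = z\<close>.\<close>
    define r where "r = (\<lambda>y. (y - 1) * ((P + 1) div 2) mod P)"
    have r: "P dvd 2 * b + 1 - z \<longleftrightarrow> b mod P = r z" for b z
    proof -
      have h: "2 * ((P + 1) div 2) = P + 1" using P(2) by (elim oddE) simp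
      have "coprime P 2" using P by simp
      have "b mod P = r z \<longleftrightarrow> P dvd b - (z - 1) * ((P + 1) div 2)"
        by (simp add: r_def mod_eq_dvd_iff)
      also have "\<dots> \<longleftrightarrow> P dvd 2 * (b - (z - 1) * ((P + 1) div 2))"
        using \<open>coprime P 2\<close> by (simp only: coprime_dvd_mult_right_iff)
      also have "2 * (b - (z - 1) * ((P + 1) div 2)) = 2 * b - (z - 1) * (2 * ((P + 1) div 2))"
        by (simp only: algebra_simps)
      also have "\<dots> = (2 * b + 1 - z) + P * (1 - z)" unfolding h by (simp add: algebra_simps)
      also have "P dvd \<dots> \<longleftrightarrow> P dvd 2 * b + 1 - z" by (rule dvd_add_left_iff) simp
      finally show ?thesis by blast
    qed
    have "P dvd nrm b \<longleftrightarrow> b mod P = r y \<or> b mod P = r (- y)" for b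
    proof -
      have "(2 * b + 1)\<^sup>2 - D = (2 * b + 1 - y) * (2 * b + 1 - (- y)) + (y\<^sup>2 - D)"
        by (simp add: power2_eq_square algebra_simps)
      then have "P dvd nrm b \<longleftrightarrow> P dvd (2 * b + 1 - y) * (2 * b + 1 - (- y))"
        unfolding dvd4 using y by (simp only: dvd_add_left_iff)
      then show ?thesis using P(1) r by (simp only: prime_dvd_mult_iff)
    qed
    then have "nrm_roots p = {b. 0 \<le> b \<and> b < P \<and> (b mod P = r y \<or> b mod P = r (- y))}"
      by (simp only: nrm_roots_def P_def[symmetric])
    also have "\<dots> = {b. 0 \<le> b \<and> b < P \<and> (b = r y \<or> b = r (- y))}"
      by (intro Collect_cong conj_cong refl) simp
    finally have roots: "nrm_roots p = {b. 0 \<le> b \<and> b < P \<and> (b = r y \<or> b = r (- y))}" .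
    have rr: "0 \<le> r z" "r z < P" for z
      using P(3) by (simp_all add: r_def)
    have roots: "nrm_roots p = {r y, r (- y)}"
      unfolding roots using rr[of y] rr[of "- y"] by blast
    have "r y = r (- y) \<longleftrightarrow> P dvd D"
    proof -
      have "r y mod P = r y" using rr by simp
      then have "P dvd 2 * r y + 1 - y" "r y = r (- y) \<longleftrightarrow> P dvd 2 * r y + 1 - (- y)"
        unfolding r by simp_all
      moreover have "2 * r y + 1 - (- y) = (2 * r y + 1 - y) + 2 * y" by simp
      ultimately have "r y = r (- y) \<longleftrightarrow> P dvd 2 * y"
        by (simp only: dvd_add_right_iff)
      also have "\<dots> \<longleftrightarrow> P dvd y" using P by (simp add: coprime_dvd_mult_right_iff)
      also have "\<dots> \<longleftrightarrow> P dvd y\<^sup>2" using P by (simp add: prime_dvd_power_iff)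
      also have "\<dots> \<longleftrightarrow> P dvd D" using y by (metis diff_add_cancel dvd_add_right_iff)
      finally show ?thesis .
    qed
    then have "card (nrm_roots p) = (if P dvd D then 1 else 2)" unfolding roots by auto
    then show ?thesis
      using True chi_odd_prime[OF P(1,2)] by (simp add: rho_def Legendre_def cong_0_iff P_def)
  qed
qed

lemma rho_two: "rho 2 = 1 + chi 2"
proof -
  define c where "c = (N + 1) div 4"
  have "even (nrm 0) \<longleftrightarrow> even c" "even (nrm 1) \<longleftrightarrow> even c"
    unfolding nrm_def c_def[symmetric] by simp_all
  moreover have "nrm_roots 2 = {b \<in> {0, 1}. even (nrm b)}"
    unfolding nrm_roots_def by auto
  ultimately have "card (nrm_roots 2) = (if even c then 2 else 0)"
    by (cases "even c") (auto simp: Collect_conv_if conj_disj_distribR Collect_disj_eq)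
  moreover have "even c \<longleftrightarrow> N mod 8 = 7" unfolding c_def using N_mod_4 by presburger
  ultimately show ?thesis by (simp add: rho_def chi_two)
qed

lemma rho_prime: "prime p \<Longrightarrow> rho p = 1 + chi (int p)"
  using rho_odd_prime[of p] rho_two prime_odd_nat[of p] prime_ge_2_nat[of p] by (cases "p = 2") auto

text \<open>
  If \<open>p\<close> divides \<open>N\<close>, a root modulo \<open>p\<^sup>2\<close> makes \<open>p\<close> divide \<open>2 x + 1\<close>, hence \<open>p\<^sup>2\<close> divide \<open>N\<close>.
\<close>

lemma rho_ramified_prime_power:
  assumes p: "prime p" "int p dvd N" and k: "k \<ge> 2"
  shows "rho (p ^ k) = 0"
proof -
  define P where "P = int p"
  have P: "prime P" "P dvd N" using p by (auto simp: P_def)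
  have "\<not> int (p ^ k) dvd nrm b" for b
  proof
    assume "int (p ^ k) dvd nrm b"
    then have "P\<^sup>2 dvd nrm b" using k by (metis P_def le_imp_power_dvd dvd_trans of_nat_power)
    then have *: "P\<^sup>2 dvd (2 * b + 1)\<^sup>2 + N" by (metis dvd_mult four_nrm)
    have "P dvd P\<^sup>2" by (simp add: power2_eq_square)
    then have "P dvd (2 * b + 1)\<^sup>2" using * P(2) by (meson dvd_add_left_iff dvd_trans)
    then have "P dvd 2 * b + 1" using P(1) prime_dvd_power by blast
    then have "P\<^sup>2 dvd (2 * b + 1)\<^sup>2" by (rule dvd_power_same)
    then have "P\<^sup>2 dvd N" using * by (simp add: dvd_add_right_iff)
    then have "P\<^sup>2 dvd D" by (simp add: N_def)
    then have "P dvd 1" using D_squarefree squarefreeD by blast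
    then show False using P(1) not_prime_unit by blast
  qed
  then show ?thesis by (simp add: rho_def nrm_roots_def)
qed

lemma rho_prime_power:
  assumes "prime p"
  shows "rho (p ^ Suc (Suc k)) = (if int p dvd N then 0 else 1 + chi (int p))"
proof (cases "int p dvd N")
  case True
  then show ?thesis using rho_ramified_prime_power[of p "Suc (Suc k)"] assms by simp
next
  case False
  have *: "rho (p ^ Suc j) = 1 + chi (int p)" for j
  proof (induction j)
    case 0
    then show ?case using rho_prime[OF assms] by simp
  next
    case (Suc j)
    then show ?case using rho_prime_power_Suc[OF assms False, of "Suc j"] by simp
  qed
  show ?thesis unfolding * using False by simp
qed

lemma chi_prime:
  assumes "prime p"
  shows "chi (int p) = 0 \<and> int p dvd N \<or> (chi (int p) = 1 \<or> chi (int p) = -1) \<and> \<not> int p dvd N"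
proof -
  have "chi (int p) = 0 \<longleftrightarrow> int p dvd N"
  proof -
    have "prime (int p)" using assms by simp
    then show ?thesis using chi_eq_0_iff[of "int p"] prime_imp_coprime[of "int p" N]
      coprime_absorb_left[of "int p" N] not_prime_unit[of "int p"] by auto
  qed
  then show ?thesis using chi_values[of "int p"] by auto
qed

text \<open>
  Both sides are multiplicative, so it suffices to compare them at prime powers, where they satisfy
  the same two-step recursion in the exponent.
\<close>

lemma rho_square_conv:
  assumes "n > 0"
  shows "dirichlet_conv square_indicator rho n = (\<Sum>d | d dvd n. chi (int d))"
proof -
  have chi_copr: "coprime_multiplicative (\<lambda>d. chi (int d))"
    using chi_one by (simp add: coprime_multiplicative_def chi_mult)
  have one_mult: "coprime_multiplicative (\<lambda>d. 1)"
    by (simp add: coprime_multiplicative_def)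
  have "dirichlet_conv square_indicator rho n = dirichlet_conv (\<lambda>d. chi (int d)) (\<lambda>d. 1) n"
  proof (rule coprime_multiplicative_eqI[OF _ _ _ assms])
    show "coprime_multiplicative (dirichlet_conv square_indicator rho)"
      by (intro dirichlet_conv_multiplicative square_indicator_multiplicative rho_multiplicative)
    show "coprime_multiplicative (dirichlet_conv (\<lambda>d. chi (int d)) (\<lambda>d. 1))"
      by (intro dirichlet_conv_multiplicative chi_copr one_mult)
    fix p k :: nat assume p: "prime p"
    have chi_pow: "chi (int (p ^ i)) = chi (int p) ^ i" for i
      by (induction i) (simp_all add: chi_one chi_mult)
    have "(\<Sum>i\<le>k. of_bool (even i) * rho (p ^ (k - i))) = (\<Sum>i\<le>k. chi (int p) ^ i)"
    proof (induction k rule: induct_nat_012)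
      case 0
      then show ?case using rho_multiplicative by (simp add: coprime_multiplicative_def)
    next
      case 1
      then show ?case using rho_prime[OF p] by simp
    next
      case (ge2 k)
      have "(\<Sum>i\<le>Suc (Suc k). of_bool (even i) * rho (p ^ (Suc (Suc k) - i)))
        = rho (p ^ Suc (Suc k)) + (\<Sum>i\<le>k. of_bool (even i) * rho (p ^ (k - i)))"
        by (simp add: sum.atMost_Suc_shift del: sum.atMost_Suc power_Suc)
      also have "\<dots> = rho (p ^ Suc (Suc k)) + (\<Sum>i\<le>k. chi (int p) ^ i)"
        using ge2 by simp
      also have "rho (p ^ Suc (Suc k)) = chi (int p) ^ Suc k + chi (int p) ^ Suc (Suc k)"
        unfolding rho_prime_power[OF p] using chi_prime[OF p]
        by (cases "even k") auto
      finally show ?case by simp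
    qed
    then show "dirichlet_conv square_indicator rho (p ^ k) =
        dirichlet_conv (\<lambda>d. chi (int d)) (\<lambda>d. 1) (p ^ k)"
      by (simp add: dirichlet_conv_prime_power[OF p] square_indicator_prime_power[OF p] chi_pow
          del: of_nat_power)
  qed
  then show ?thesis by (simp add: dirichlet_conv_def)
qed

text \<open>
  A triple \<open>(m, a, b)\<close> encodes the ideal \<open>m (a \<int> + (b + \<omega>) \<int>)\<close>, whose norm is \<open>m\<^sup>2 a\<close>. Every nonzero ideal has
  exactly one such encoding, by \<open>module_is_triple_ideal\<close> and \<open>triple_ideal_inj\<close> below.
\<close>

definition ideal_triples :: "(nat \<times> nat \<times> int) set" where
  "ideal_triples = {(m, a, b). 0 < m \<and> 0 < a \<and> b \<in> nrm_roots a}"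

fun triple_norm :: "nat \<times> nat \<times> int \<Rightarrow> nat" where
  "triple_norm (m, a, b) = m\<^sup>2 * a"

theorem card_ideal_triples_of_norm:
  assumes "n > 0"
  shows "finite {T \<in> ideal_triples. triple_norm T = n}"
    and "int (card {T \<in> ideal_triples. triple_norm T = n}) = (\<Sum>d | d dvd n. chi (int d))"
proof -
  define M where "M = {m. m\<^sup>2 dvd n}"
  have "M \<subseteq> {..n}"
  proof
    fix m assume "m \<in> M"
    then have "m\<^sup>2 \<le> n" using assms by (auto simp: M_def dest: dvd_imp_le)
    then show "m \<in> {..n}" using self_le_power[of m 2] by (cases "m = 0") auto
  qed
  then have finM: "finite M" using finite_subset by blast
  have Mpos: "m > 0" if "m \<in> M" for m using that assms by (auto simp: M_def intro: Nat.gr0I)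
  have eq: "{T \<in> ideal_triples. triple_norm T = n} =
      (\<lambda>(m, b). (m, n div m\<^sup>2, b)) ` (SIGMA m:M. nrm_roots (n div m\<^sup>2))"
  proof (intro equalityI subsetI)
    fix T assume "T \<in> {T \<in> ideal_triples. triple_norm T = n}"
    then obtain m a b where T: "T = (m, a, b)" "0 < m" "0 < a" "b \<in> nrm_roots a" "m\<^sup>2 * a = n"
      by (auto simp: ideal_triples_def)
    then have "n div m\<^sup>2 = a" "m \<in> M" by (auto simp: M_def)
    then show "T \<in> (\<lambda>(m, b). (m, n div m\<^sup>2, b)) ` (SIGMA m:M. nrm_roots (n div m\<^sup>2))"
      using T by (auto intro!: image_eqI[of _ _ "(m, b)"])
  next
    fix T assume "T \<in> (\<lambda>(m, b). (m, n div m\<^sup>2, b)) ` (SIGMA m:M. nrm_roots (n div m\<^sup>2))"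
    then show "T \<in> {T \<in> ideal_triples. triple_norm T = n}"
      using Mpos assms by (auto simp: ideal_triples_def M_def dvd_div_eq_0_iff intro!: Nat.gr0I)
  qed
  show "finite {T \<in> ideal_triples. triple_norm T = n}"
    unfolding eq using finM finite_nrm_roots by blast
  have "card {T \<in> ideal_triples. triple_norm T = n} = card (SIGMA m:M. nrm_roots (n div m\<^sup>2))"
    unfolding eq by (intro card_image) (auto simp: inj_on_def)
  also have "\<dots> = (\<Sum>m\<in>M. card (nrm_roots (n div m\<^sup>2)))"
    using finM finite_nrm_roots by simp
  finally have "int (card {T \<in> ideal_triples. triple_norm T = n}) = (\<Sum>m\<in>M. rho (n div m\<^sup>2))"
    by (simp add: rho_def)
  also have "\<dots> = (\<Sum>d\<in>(\<lambda>m. m\<^sup>2) ` M. rho (n div d))"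
    by (subst sum.reindex) (auto simp: inj_on_def)
  also have "\<dots> = (\<Sum>d | d dvd n. square_indicator d * rho (n div d))"
    using assms by (intro sum.mono_neutral_cong_left)
      (auto simp: square_indicator_def is_nth_power_def M_def)
  also have "\<dots> = (\<Sum>d | d dvd n. chi (int d))"
    using rho_square_conv[OF assms] by (simp add: dirichlet_conv_def)
  finally show "int (card {T \<in> ideal_triples. triple_norm T = n}) = (\<Sum>d | d dvd n. chi (int d))" .
qed

end


section \<open>Theta series of binary quadratic forms at the origin\<close>

definition qform :: "real \<Rightarrow> real \<Rightarrow> real \<Rightarrow> real \<Rightarrow> real \<Rightarrow> real" where
  "qform A B C x y = A * x\<^sup>2 + B * x * y + C * y\<^sup>2"

definition lattice_theta :: "real \<Rightarrow> real \<Rightarrow> real \<Rightarrow> real \<Rightarrow> real" where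
  "lattice_theta A B C t = infsum (\<lambda>(x, y). exp (- t * qform A B C (of_int x) (of_int y))) (UNIV :: (int \<times> int) set)"

definition parity_sign :: "int \<Rightarrow> real" where
  "parity_sign x = (if even x then 1 else -1)"

lemma abs_parity_sign [simp]: "\<bar>parity_sign x\<bar> = 1"
  by (simp add: parity_sign_def)

lemma has_sum_diff:
  fixes f g :: "'a \<Rightarrow> real"
  assumes "(f has_sum a) X" "(g has_sum b) X"
  shows "((\<lambda>x. f x - g x) has_sum (a - b)) X"
  using has_sum_add[OF assms(1) has_sum_uminusI[OF assms(2)]] by simp

lemma int_two_sided_geometric:
  fixes a :: real
  assumes "0 \<le> a" "a < 1"
  shows "(\<lambda>x::int. a ^ nat \<bar>x\<bar>) summable_on UNIV" "infsum (\<lambda>x::int. a ^ nat \<bar>x\<bar>) UNIV \<le> 2 / (1 - a)"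
proof -
  have geo: "((\<lambda>n. a ^ n) has_sum (1 / (1 - a))) UNIV"
    using assms geometric_sums[of a] by (intro sums_nonneg_imp_has_sum) auto
  have pos: "((\<lambda>x. a ^ nat \<bar>x\<bar>) has_sum (1 / (1 - a))) (range int)"
    using geo by (subst has_sum_reindex) (auto simp: o_def)
  have "((\<lambda>n. a * a ^ n) has_sum (a * (1 / (1 - a)))) UNIV"
    by (intro has_sum_cmult_right geo)
  then have neg: "((\<lambda>x. a ^ nat \<bar>x\<bar>) has_sum (a * (1 / (1 - a)))) (range (\<lambda>n. - int (Suc n)))"
    by (subst has_sum_reindex) (auto simp: o_def inj_on_def nat_add_distrib)
  have disj: "range int \<inter> range (\<lambda>n. - int (Suc n)) = {}" by auto
  have un: "range int \<union> range (\<lambda>n. - int (Suc n)) = UNIV"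
  proof (intro equalityI subsetI UnCI)
    fix x :: int assume "x \<notin> range (\<lambda>n. - int (Suc n))"
    then show "x \<in> range int" by (metis int_cases rangeI)
  qed auto
  have "((\<lambda>x::int. a ^ nat \<bar>x\<bar>) has_sum (1 / (1 - a) + a * (1 / (1 - a)))) UNIV"
    using has_sum_Un_disjoint[OF pos neg disj] by (simp only: un)
  moreover have "1 / (1 - a) + a * (1 / (1 - a)) \<le> 2 / (1 - a)"
    using assms divide_right_mono[of "1 + a" 2 "1 - a"] by (simp add: add_divide_distrib)
  ultimately show "(\<lambda>x::int. a ^ nat \<bar>x\<bar>) summable_on UNIV"
    "infsum (\<lambda>x::int. a ^ nat \<bar>x\<bar>) UNIV \<le> 2 / (1 - a)"
    by (auto simp: has_sum_iff)
qed

lemma exp_abs_lattice: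
  fixes \<rho> :: real
  assumes "\<rho> > 0"
  shows "(\<lambda>(x, y). exp (- 2 * \<rho> * (\<bar>of_int x\<bar> + \<bar>of_int y\<bar>))) summable_on (UNIV :: (int \<times> int) set)" (is ?S)
    and "\<rho> \<le> 1 / 2 \<Longrightarrow> infsum (\<lambda>(x, y). exp (- 2 * \<rho> * (\<bar>of_int x\<bar> + \<bar>of_int y\<bar>))) (UNIV :: (int \<times> int) set) \<le> 4 / \<rho>\<^sup>2"
proof -
  define a where "a = exp (- 2 * \<rho>)"
  have a: "0 \<le> a" "a < 1" using assms by (simp_all add: a_def)
  have apow: "exp (- 2 * \<rho> * \<bar>of_int x\<bar>) = a ^ nat \<bar>x\<bar>" for x :: int
    unfolding a_def exp_of_nat_mult[symmetric] by simp
  have eq: "(\<lambda>(x, y). exp (- 2 * \<rho> * (\<bar>of_int x\<bar> + \<bar>of_int y\<bar>)))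
      = (\<lambda>(x::int, y::int). a ^ nat \<bar>x\<bar> * a ^ nat \<bar>y\<bar>)"
    by (auto simp: fun_eq_iff apow[symmetric] exp_add[symmetric] algebra_simps)
  have s: "(\<lambda>(x, y). a ^ nat \<bar>x\<bar> * a ^ nat \<bar>y\<bar>) summable_on (UNIV \<times> (UNIV :: int set))"
  proof (rule summable_on_SigmaI)
    have sum: "((\<lambda>y::int. a ^ nat \<bar>y\<bar>) has_sum infsum (\<lambda>y::int. a ^ nat \<bar>y\<bar>) UNIV) UNIV"
      using int_two_sided_geometric(1)[OF a] by simp
    show "((\<lambda>y. case (x, y) of (x, y) \<Rightarrow> a ^ nat \<bar>x\<bar> * a ^ nat \<bar>y\<bar>) has_sum
        (a ^ nat \<bar>x\<bar> * infsum (\<lambda>y::int. a ^ nat \<bar>y\<bar>) UNIV)) UNIV" for x :: int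
      using has_sum_cmult_right[OF sum] by simp
    show "(\<lambda>x::int. a ^ nat \<bar>x\<bar> * infsum (\<lambda>y::int. a ^ nat \<bar>y\<bar>) UNIV) summable_on UNIV"
      by (intro summable_on_cmult_left int_two_sided_geometric(1)[OF a])
  qed (use a in auto)
  then show ?S unfolding eq by simp
  assume \<rho>: "\<rho> \<le> 1 / 2"
  have "infsum (\<lambda>(x, y). a ^ nat \<bar>x\<bar> * a ^ nat \<bar>y\<bar>) (UNIV \<times> (UNIV :: int set))
    = infsum (\<lambda>x. infsum (\<lambda>y. a ^ nat \<bar>x\<bar> * a ^ nat \<bar>y\<bar>) UNIV) UNIV"
    by (subst infsum_Sigma'_banach[symmetric]) (use s in auto)
  also have "\<dots> = infsum (\<lambda>x::int. a ^ nat \<bar>x\<bar>) UNIV * infsum (\<lambda>x::int. a ^ nat \<bar>x\<bar>) UNIV"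
    by (simp add: infsum_cmult_right' infsum_cmult_left')
  also have "\<dots> \<le> 2 / \<rho> * (2 / \<rho>)"
  proof -
    have "exp (- 2 * \<rho>) \<le> 1 - \<rho>"
    proof -
      have "1 + 2 * \<rho> \<le> exp (2 * \<rho>)" by (rule exp_ge_add_one_self)
      then have "exp (- 2 * \<rho>) \<le> 1 / (1 + 2 * \<rho>)"
        using assms by (simp add: exp_minus field_simps)
      also have "\<dots> \<le> 1 - \<rho>"
      proof -
        have "0 \<le> \<rho> * (1 - 2 * \<rho>)" using assms \<rho> by simp
        then have "1 \<le> (1 - \<rho>) * (1 + 2 * \<rho>)" by (simp add: algebra_simps)
        then show ?thesis using assms by (simp add: divide_le_eq)
      qed
      finally show ?thesis .
    qed
    then have "2 / (1 - a) \<le> 2 / \<rho>" using assms a by (intro divide_left_mono) (auto simp: a_def)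
    then have le: "infsum (\<lambda>x::int. a ^ nat \<bar>x\<bar>) UNIV \<le> 2 / \<rho>"
      using int_two_sided_geometric(2)[OF a] by linarith
    have "0 \<le> infsum (\<lambda>x::int. a ^ nat \<bar>x\<bar>) UNIV" using a by (intro infsum_nonneg) auto
    then show ?thesis using le assms by (intro mult_mono) auto
  qed
  also have "\<dots> = 4 / \<rho>\<^sup>2" by (simp add: power2_eq_square)
  finally show "infsum (\<lambda>(x, y). exp (- 2 * \<rho> * (\<bar>of_int x\<bar> + \<bar>of_int y\<bar>))) (UNIV :: (int \<times> int) set) \<le> 4 / \<rho>\<^sup>2"
    unfolding eq by simp
qed

locale positive_form =
  fixes A B C :: real
  assumes A_pos: "A > 0" and disc_pos: "4 * A * C - B\<^sup>2 > 0"
begin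

lemma C_pos: "C > 0"
proof -
  have "0 < 4 * A * C" using disc_pos zero_le_power2[of B] by linarith
  then show ?thesis using A_pos by (simp add: zero_less_mult_iff)
qed

definition ellipticity :: real where
  "ellipticity = (4 * A * C - B\<^sup>2) / (4 * (A + C))"

lemma ellipticity_pos: "ellipticity > 0"
  using disc_pos A_pos C_pos by (simp add: ellipticity_def)

text \<open>The smaller eigenvalue of a positive definite matrix is at least determinant over trace.\<close>

lemma qform_ge: "ellipticity * (x\<^sup>2 + y\<^sup>2) \<le> qform A B C x y"
proof -
  define d where "d = 4 * A * C - B\<^sup>2"
  have s: "A + C > 0" using A_pos C_pos by simp
  have "4 * (A + C) * qform A B C x y - d * (x\<^sup>2 + y\<^sup>2) = (2 * A * x + B * y)\<^sup>2 + (B * x + 2 * C * y)\<^sup>2"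
    by (simp add: d_def qform_def power2_eq_square algebra_simps)
  then have "d * (x\<^sup>2 + y\<^sup>2) \<le> 4 * (A + C) * qform A B C x y"
    by (metis diff_ge_0_iff_ge sum_power2_ge_zero)
  then have "d / (4 * (A + C)) * (x\<^sup>2 + y\<^sup>2) \<le> qform A B C x y"
    using s by (simp add: field_simps)
  then show ?thesis by (simp add: ellipticity_def d_def)
qed

lemma qform_nonneg: "qform A B C x y \<ge> 0"
  using qform_ge[of x y] ellipticity_pos by (smt (verit) mult_nonneg_nonneg sum_power2_ge_zero)

text \<open>
  The bound \<open>2 z - 1 \<le> z\<^sup>2\<close> replaces the Gaussian by a product of exponentials, whose sum over the
  lattice is geometric.
\<close>

lemma exp_qform_le:
  assumes "t > 0"
  shows "exp (- t * qform A B C x y) \<le> exp 2 * exp (- 2 * sqrt (t * ellipticity) * (\<bar>x\<bar> + \<bar>y\<bar>))"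
proof -
  define \<rho> where "\<rho> = sqrt (t * ellipticity)"
  have \<rho>: "\<rho>\<^sup>2 = t * ellipticity" using assms ellipticity_pos by (simp add: \<rho>_def)
  have "2 * \<rho> * \<bar>z\<bar> - 1 \<le> \<rho>\<^sup>2 * z\<^sup>2" for z
  proof -
    have "0 \<le> (\<rho> * \<bar>z\<bar> - 1)\<^sup>2" by simp
    then show ?thesis by (simp add: power2_diff power_mult_distrib)
  qed
  from this[of x] this[of y] have "2 * \<rho> * (\<bar>x\<bar> + \<bar>y\<bar>) - 2 \<le> \<rho>\<^sup>2 * (x\<^sup>2 + y\<^sup>2)"
    by (simp add: algebra_simps)
  also have "\<dots> \<le> t * qform A B C x y"
    unfolding \<rho> using mult_left_mono[OF qform_ge[of x y], of t] assms by (simp add: mult.assoc)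
  finally show ?thesis unfolding \<rho>_def[symmetric] exp_add[symmetric] by simp
qed

lemma lattice_theta_summable:
  assumes "t > 0"
  shows "(\<lambda>(x, y). exp (- t * qform A B C (of_int x) (of_int y))) summable_on (UNIV :: (int \<times> int) set)"
proof (rule summable_on_comparison_test)
  have "sqrt (t * ellipticity) > 0" using assms ellipticity_pos by simp
  then show "(\<lambda>v. exp 2 * (case v of (x, y) \<Rightarrow> exp (- 2 * sqrt (t * ellipticity) * (\<bar>of_int x\<bar> + \<bar>of_int y\<bar>))))
      summable_on (UNIV :: (int \<times> int) set)"
    by (intro summable_on_cmult_right exp_abs_lattice)
qed (use exp_qform_le[OF assms] in auto)

end

lemma third_difference_mvt:
  fixes g :: "real \<Rightarrow> real"
  assumes "\<And>u. (g has_real_derivative g1 u) (at u)" "\<And>u. (g1 has_real_derivative g2 u) (at u)"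
    and "\<And>u. (g2 has_real_derivative g3 u) (at u)"
  shows "\<exists>\<xi>. x \<le> \<xi> \<and> \<xi> \<le> x + 3 \<and> g (x + 3) - 3 * g (x + 2) + 3 * g (x + 1) - g x = g3 \<xi>"
proof -
  have d: "((\<lambda>u. g (u + c)) has_real_derivative g1 (u + c)) (at u)"
    "((\<lambda>u. g1 (u + c)) has_real_derivative g2 (u + c)) (at u)" for u c
    using assms(1,2)[of "u + c"] by (simp_all add: DERIV_shift)
  have "\<exists>\<xi>. x < \<xi> \<and> \<xi> < x + 1 \<and> (g (x + 1 + 2) - 2 * g (x + 1 + 1) + g (x + 1)) - (g (x + 2) - 2 * g (x + 1) + g x)
      = ((x + 1) - x) * (g1 (\<xi> + 2) - 2 * g1 (\<xi> + 1) + g1 \<xi>)"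
    by (rule MVT2) (auto intro!: derivative_eq_intros d assms)
  then obtain \<xi> where \<xi>: "x < \<xi>" "\<xi> < x + 1" "(g (x + 1 + 2) - 2 * g (x + 1 + 1) + g (x + 1)) - (g (x + 2) - 2 * g (x + 1) + g x)
      = g1 (\<xi> + 2) - 2 * g1 (\<xi> + 1) + g1 \<xi>" by auto
  have "\<exists>\<zeta>. \<xi> < \<zeta> \<and> \<zeta> < \<xi> + 1 \<and> (g1 (\<xi> + 1 + 1) - g1 (\<xi> + 1)) - (g1 (\<xi> + 1) - g1 \<xi>)
      = ((\<xi> + 1) - \<xi>) * (g2 (\<zeta> + 1) - g2 \<zeta>)"
    by (rule MVT2) (auto intro!: derivative_eq_intros d assms)
  then obtain \<zeta> where \<zeta>: "\<xi> < \<zeta>" "\<zeta> < \<xi> + 1" "(g1 (\<xi> + 1 + 1) - g1 (\<xi> + 1)) - (g1 (\<xi> + 1) - g1 \<xi>)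
      = g2 (\<zeta> + 1) - g2 \<zeta>" by auto
  have "\<exists>\<theta>. \<zeta> < \<theta> \<and> \<theta> < \<zeta> + 1 \<and> g2 (\<zeta> + 1) - g2 \<zeta> = ((\<zeta> + 1) - \<zeta>) * g3 \<theta>"
    by (rule MVT2) (auto intro!: assms)
  then obtain \<theta> where \<theta>: "\<zeta> < \<theta>" "\<theta> < \<zeta> + 1" "g2 (\<zeta> + 1) - g2 \<zeta> = g3 \<theta>" by auto
  have e: "x + 1 + 2 = x + 3" "x + 1 + 1 = x + 2" "\<xi> + 1 + 1 = \<xi> + 2" by simp_all
  show ?thesis
  proof (intro exI[of _ \<theta>] conjI)
    show "g (x + 3) - 3 * g (x + 2) + 3 * g (x + 1) - g x = g3 \<theta>"
      using \<xi>(3) \<zeta>(3) \<theta>(3) unfolding e by linarith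
  qed (use \<xi> \<zeta> \<theta> in linarith)+
qed

context positive_form
begin

text \<open>
  Each derivative of \<open>exp (- t q)\<close> in \<open>x\<close> brings down a factor \<open>t (2 A x + B y)\<close>, which is
  \<open>O (sqrt (t A) sqrt (t q))\<close> because the form is positive definite, or differentiates such a factor.
  Powers of \<open>t q\<close> are paid for with half of the exponent.
\<close>

lemma third_difference_bound:
  assumes t: "t > 0"
  shows "\<exists>\<xi>. x \<le> \<xi> \<and> \<xi> \<le> x + 3 \<and>
    \<bar>exp (- t * qform A B C (x + 3) y) - 3 * exp (- t * qform A B C (x + 2) y)
      + 3 * exp (- t * qform A B C (x + 1) y) - exp (- t * qform A B C x y)\<bar>
    \<le> 96 * (sqrt (t * A)) ^ 3 * exp (- (t / 2) * qform A B C \<xi> y)"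
proof -
  define L where "L = (\<lambda>u. 2 * A * u + B * y)"
  define g where "g = (\<lambda>u. exp (- t * qform A B C u y))"
  define g1 where "g1 = (\<lambda>u. - t * L u * g u)"
  define g2 where "g2 = (\<lambda>u. (t\<^sup>2 * (L u)\<^sup>2 - 2 * t * A) * g u)"
  define g3 where "g3 = (\<lambda>u. (- (t ^ 3 * (L u) ^ 3) + 6 * t\<^sup>2 * A * L u) * g u)"
  have dL: "(L has_real_derivative 2 * A) (at u)" for u
    unfolding L_def by (auto intro!: derivative_eq_intros)
  have d1: "(g has_real_derivative g1 u) (at u)" for u
    unfolding g_def g1_def L_def qform_def
    by (auto intro!: derivative_eq_intros simp: algebra_simps)
  have d2: "(g1 has_real_derivative g2 u) (at u)" for u
    unfolding g1_def by (rule derivative_eq_intros refl dL d1)+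
      (simp add: g1_def g2_def power2_eq_square algebra_simps)
  have d3: "(g2 has_real_derivative g3 u) (at u)" for u
    unfolding g2_def by (rule derivative_eq_intros refl dL d1)+
      (simp add: g1_def g3_def power2_eq_square power3_eq_cube algebra_simps)
  obtain \<xi> where \<xi>: "x \<le> \<xi>" "\<xi> \<le> x + 3" "g (x + 3) - 3 * g (x + 2) + 3 * g (x + 1) - g x = g3 \<xi>"
    using third_difference_mvt[OF d1 d2 d3, of x] by blast
  define q where "q = t * qform A B C \<xi> y"
  define w where "w = sqrt q"
  define s where "s = sqrt (t * A)"
  have q: "q \<ge> 0" "w \<ge> 0" "w\<^sup>2 = q" and s: "s \<ge> 0" "s\<^sup>2 = t * A"
    using t A_pos qform_nonneg by (simp_all add: q_def w_def s_def)
  have "(t * L \<xi>)\<^sup>2 \<le> (2 * s * w)\<^sup>2"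
  proof -
    have "(L \<xi>)\<^sup>2 = 4 * A * qform A B C \<xi> y - (4 * A * C - B\<^sup>2) * y\<^sup>2"
      by (simp add: L_def qform_def power2_eq_square algebra_simps)
    then have "(L \<xi>)\<^sup>2 \<le> 4 * A * qform A B C \<xi> y" using disc_pos by simp
    then have "t\<^sup>2 * (L \<xi>)\<^sup>2 \<le> t\<^sup>2 * (4 * A * qform A B C \<xi> y)" by (intro mult_left_mono) auto
    also have "\<dots> = (2 * s * w)\<^sup>2"
      unfolding power_mult_distrib q s q_def by (simp add: power2_eq_square)
    finally show ?thesis by (simp add: power_mult_distrib)
  qed
  then have tL: "\<bar>t * L \<xi>\<bar> \<le> 2 * s * w" using q s by (metis abs_le_square_iff abs_of_nonneg mult_nonneg_nonneg zero_le_numeral)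
  have "\<bar>- (t ^ 3 * (L \<xi>) ^ 3) + 6 * t\<^sup>2 * A * L \<xi>\<bar> \<le> \<bar>t * L \<xi>\<bar> ^ 3 + 6 * s\<^sup>2 * \<bar>t * L \<xi>\<bar>"
  proof -
    have "- (t ^ 3 * (L \<xi>) ^ 3) + 6 * t\<^sup>2 * A * L \<xi> = - ((t * L \<xi>) ^ 3) + 6 * s\<^sup>2 * (t * L \<xi>)"
      unfolding s by (simp add: power2_eq_square power3_eq_cube)
    also have "\<bar>\<dots>\<bar> \<le> \<bar>t * L \<xi>\<bar> ^ 3 + 6 * s\<^sup>2 * \<bar>t * L \<xi>\<bar>"
      by (rule order.trans[OF abs_triangle_ineq]) (simp add: power_abs abs_mult)
    finally show ?thesis .
  qed
  also have "\<dots> \<le> (2 * s * w) ^ 3 + 6 * s\<^sup>2 * (2 * s * w)"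
    using tL by (intro add_mono power_mono mult_left_mono) auto
  also have "\<dots> = s ^ 3 * (8 * (w\<^sup>2 * w) + 12 * w)"
    by (simp add: power2_eq_square power3_eq_cube algebra_simps)
  also have "\<dots> \<le> s ^ 3 * (96 * exp (q / 2))"
  proof (intro mult_left_mono)
    have "2 * w \<le> 1 + q" using zero_le_power2[of "w - 1"] q by (simp add: power2_diff)
    then have "8 * (q * w) + 12 * w \<le> 4 * (q * (1 + q)) + 6 * (1 + q)"
      using mult_left_mono[of "2 * w" "1 + q" q] q by simp
    \<comment> \<open>\<open>4 q (1 + q) + 6 (1 + q) \<le> 6 (1 + q)\<^sup>2\<close> and \<open>1 + q \<le> 4 (1 + q / 4)\<close>; the quarter leaves room for the
      exponent \<open>q / 2\<close>.\<close>
    also have "\<dots> \<le> 96 * (1 + q / 4)\<^sup>2"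
    proof -
      have "0 \<le> q * q" using q by simp
      then show ?thesis using q by (simp add: power2_eq_square algebra_simps)
    qed
    also have "\<dots> \<le> 96 * (exp (q / 4))\<^sup>2"
      using q exp_ge_add_one_self[of "q / 4"] by (intro mult_left_mono power_mono) auto
    also have "(exp (q / 4))\<^sup>2 = exp (q / 2)" by (simp add: power2_eq_square exp_add[symmetric])
    finally show "8 * (w\<^sup>2 * w) + 12 * w \<le> 96 * exp (q / 2)" using q by simp
  qed (use s in simp)
  finally have "\<bar>g3 \<xi>\<bar> \<le> s ^ 3 * (96 * exp (q / 2)) * g \<xi>"
    unfolding g3_def abs_mult by (simp add: g_def mult_right_mono)
  also have "\<dots> = 96 * s ^ 3 * exp (- (t / 2) * qform A B C \<xi> y)"
    by (simp add: g_def q_def exp_add[symmetric])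
  finally show ?thesis using \<xi> unfolding g_def s_def by auto
qed

text \<open>
  An alternating sum is multiplied by \<open>8\<close>, up to sign, when the function is replaced by its third
  difference. For a Gaussian of width \<open>1 / sqrt t\<close> this difference
  is \<open>O (t sqrt t)\<close>, while only about \<open>1 / t\<close> lattice points contribute.
\<close>

lemma alternating_theta_tendsto_0:
  "((\<lambda>t. infsum (\<lambda>(x, y). parity_sign x * exp (- t * qform A B C (of_int x) (of_int y))) (UNIV :: (int \<times> int) set))
    \<longlongrightarrow> 0) (at_right 0)"
proof -
  define f where "f = (\<lambda>t (v :: int \<times> int). parity_sign (fst v) * exp (- t * qform A B C (of_int (fst v)) (of_int (snd v))))"
  define K where "K = 12 * (sqrt A) ^ 3 * exp 2 * exp 6 * (8 / ellipticity)"
  have bound: "\<bar>infsum (f t) UNIV\<bar> \<le> K * sqrt t"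
    if t: "t > 0" "t * ellipticity \<le> 1 / 2" for t
  proof -
    define \<rho> where "\<rho> = sqrt (t / 2 * ellipticity)"
    have \<rho>: "\<rho> > 0" "\<rho>\<^sup>2 = t / 2 * ellipticity" "\<rho> \<le> 1 / 2"
    proof -
      show "\<rho> > 0" "\<rho>\<^sup>2 = t / 2 * ellipticity" using t ellipticity_pos by (simp_all add: \<rho>_def)
      have "\<rho> \<le> sqrt (1 / 4)" unfolding \<rho>_def using t by (intro real_sqrt_le_mono) simp
      also have "sqrt (1 / 4) = (1 / 2 :: real)" by (simp add: real_sqrt_divide)
      finally show "\<rho> \<le> 1 / 2" .
    qed
    define S where "S = infsum (f t) UNIV"
    have summ: "f t summable_on UNIV"
    proof -
      have "(\<lambda>v. norm (f t v)) summable_on UNIV"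
        using lattice_theta_summable[OF t(1)]
        by (simp add: f_def abs_mult case_prod_beta')
      then show ?thesis by (rule abs_summable_summable)
    qed
    then have f: "(f t has_sum S) UNIV" by (simp add: S_def)
    have shift: "((\<lambda>v. f t (fst v + j, snd v)) has_sum S) UNIV" for j
    proof -
      have "bij (\<lambda>v :: int \<times> int. (fst v + j, snd v))"
        by (rule o_bij[of "\<lambda>v. (fst v - j, snd v)"]) (auto simp: fun_eq_iff)
      then show ?thesis using has_sum_reindex_bij_betw[of "\<lambda>v. (fst v + j, snd v)" UNIV UNIV "f t" S] f
        by simp
    qed
    \<comment> \<open>The sign of \<open>f\<close> alternates along the first coordinate, so this is a signed third difference.\<close>
    define \<Delta> where "\<Delta> = (\<lambda>v. f t v - 3 * - f t (fst v + 1, snd v) + 3 * f t (fst v + 2, snd v) - - f t (fst v + 3, snd v))"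
    have "(\<Delta> has_sum (S - 3 * - S + 3 * S - - S)) UNIV"
      unfolding \<Delta>_def using shift f
      by (intro has_sum_diff has_sum_add has_sum_cmult_right has_sum_uminusI shift f)
    then have \<Delta>: "(\<Delta> has_sum (8 * S)) UNIV" by simp
    define E where "E = (\<lambda>(x :: int, y :: int). exp (- 2 * \<rho> * (\<bar>of_int x\<bar> + \<bar>of_int y\<bar>)))"
    define M where "M = 96 * (sqrt (t * A)) ^ 3 * exp 2 * exp 6"
    have "\<bar>\<Delta> v\<bar> \<le> M * E v" for v
    proof -
      obtain x y :: int where v: "v = (x, y)" by force
      obtain \<xi> where \<xi>: "of_int x \<le> \<xi>" "\<xi> \<le> of_int x + 3"
        "\<bar>exp (- t * qform A B C (of_int x + 3) (of_int y)) - 3 * exp (- t * qform A B C (of_int x + 2) (of_int y))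
      + 3 * exp (- t * qform A B C (of_int x + 1) (of_int y)) - exp (- t * qform A B C (of_int x) (of_int y))\<bar>
        \<le> 96 * (sqrt (t * A)) ^ 3 * exp (- (t / 2) * qform A B C \<xi> (of_int y))"
        using third_difference_bound[OF t(1)] by blast
      have "\<bar>\<Delta> v\<bar> = \<bar>exp (- t * qform A B C (of_int x + 3) (of_int y)) - 3 * exp (- t * qform A B C (of_int x + 2) (of_int y))
      + 3 * exp (- t * qform A B C (of_int x + 1) (of_int y)) - exp (- t * qform A B C (of_int x) (of_int y))\<bar>"
        unfolding \<Delta>_def v f_def parity_sign_def by (cases "even x") (simp_all add: abs_if)
      also have "\<dots> \<le> 96 * (sqrt (t * A)) ^ 3 * exp (- (t / 2) * qform A B C \<xi> (of_int y))" by (rule \<xi>)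
      also have "\<dots> \<le> 96 * (sqrt (t * A)) ^ 3 * (exp 2 * exp (- 2 * \<rho> * (\<bar>\<xi>\<bar> + \<bar>of_int y\<bar>)))"
        using exp_qform_le[of "t / 2" \<xi> "of_int y"] t A_pos unfolding \<rho>_def by (intro mult_left_mono) auto
      \<comment> \<open>The factor \<open>exp 6\<close> pays for moving from \<open>\<xi>\<close> back to \<open>x\<close>: \<open>\<bar>x\<bar> \<le> \<bar>\<xi>\<bar> + 3\<close> and \<open>2 \<rho> \<le> 1\<close>.\<close>
      also have "\<dots> \<le> 96 * (sqrt (t * A)) ^ 3 * (exp 2 * (exp 6 * E v))"
      proof -
        have "\<bar>of_int x\<bar> \<le> \<bar>\<xi>\<bar> + 3" using \<xi> by linarith
        then have "2 * \<rho> * \<bar>of_int x\<bar> \<le> 2 * \<rho> * (\<bar>\<xi>\<bar> + 3)" using \<rho> by (intro mult_left_mono) auto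
        also have "\<dots> \<le> 2 * \<rho> * \<bar>\<xi>\<bar> + 6" using \<rho> by (simp add: algebra_simps)
        finally have "- 2 * \<rho> * (\<bar>\<xi>\<bar> + \<bar>of_int y\<bar>) \<le> 6 + - 2 * \<rho> * (\<bar>of_int x\<bar> + \<bar>of_int y\<bar>)"
          by (simp add: algebra_simps)
        then have "exp (- 2 * \<rho> * (\<bar>\<xi>\<bar> + \<bar>of_int y\<bar>)) \<le> exp 6 * E v"
          unfolding E_def v by (simp add: exp_add[symmetric])
        then show ?thesis using t A_pos by (intro mult_left_mono) auto
      qed
      finally show ?thesis by (simp add: M_def mult.assoc)
    qed
    moreover have ME: "((\<lambda>v. M * E v) has_sum (M * infsum E UNIV)) UNIV"
      using exp_abs_lattice(1)[OF \<rho>(1)] unfolding E_def by (intro has_sum_cmult_right has_sum_infsum)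
    ultimately have "\<bar>8 * S\<bar> \<le> M * infsum E UNIV"
      using norm_infsum_le[OF \<Delta> ME] by simp
    also have "\<dots> \<le> M * (4 / \<rho>\<^sup>2)"
      using exp_abs_lattice(2)[OF \<rho>(1,3)] t A_pos unfolding E_def
      by (intro mult_left_mono) (auto simp: M_def)
    also have "\<dots> = 8 * (K * sqrt t)"
    proof -
      have a1: "(sqrt (t * A)) ^ 3 = t * sqrt t * (sqrt A) ^ 3"
        using t by (simp add: real_sqrt_mult power_mult_distrib) (simp add: power3_eq_cube)
      have a2: "4 / \<rho>\<^sup>2 = 8 / (t * ellipticity)" unfolding \<rho> by simp
      show ?thesis
        unfolding M_def K_def a1 a2 using t ellipticity_pos by (simp add: field_simps)
    qed
    finally show ?thesis by (simp add: S_def)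
  qed
  have "((\<lambda>t. infsum (f t) UNIV) \<longlongrightarrow> 0) (at_right 0)"
  proof (rule Lim_null_comparison)
    have "\<forall>\<^sub>F t in at_right 0. t \<in> {0<..<1 / (2 * ellipticity)}"
      using ellipticity_pos by (intro eventually_at_right_real) simp
    then show "\<forall>\<^sub>F t in at_right 0. norm (infsum (f t) UNIV) \<le> K * sqrt t"
    proof eventually_elim
      case (elim t)
      then have "t * ellipticity \<le> 1 / 2" using ellipticity_pos by (simp add: field_simps)
      then show ?case using bound[of t] elim by simp
    qed
    have "((\<lambda>t. K * sqrt t) \<longlongrightarrow> K * sqrt 0) (at_right 0)"
      by (intro tendsto_intros)
    then show "((\<lambda>t. K * sqrt t) \<longlongrightarrow> 0) (at_right 0)" by simp
  qed
  then show ?thesis by (simp add: f_def case_prod_beta')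
qed

lemma infsum_weighted_reindex:
  fixes f c :: "'a \<Rightarrow> real"
  assumes "\<And>v. g (h v) = v" "\<And>v. c v \<noteq> 0 \<Longrightarrow> h (g v) = v" "\<And>v. c (h v) * f (h v) = w v"
  shows "infsum w UNIV = infsum (\<lambda>v. c v * f v) UNIV"
proof -
  have "inj h" using assms(1) by (rule inj_on_inverseI)
  then have "infsum (\<lambda>v. c (h v) * f (h v)) UNIV = infsum (\<lambda>v. c v * f v) (range h)"
    by (simp add: infsum_reindex o_def)
  also have "\<dots> = infsum (\<lambda>v. c v * f v) UNIV"
    using assms(2) by (intro infsum_cong_neutral) (auto simp: image_iff, metis)
  finally show ?thesis by (simp add: assms(3))
qed

text \<open>
  With \<open>S\<^sub>i\<^sub>j\<close> the part of the theta sum over points with parities \<open>i, j\<close>, the sum at \<open>4 t\<close>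
  is \<open>S\<^sub>0\<^sub>0\<close> at \<open>t\<close>, and \<open>S\<^sub>0\<^sub>0 - S\<^sub>i\<^sub>j\<close> is an alternating sum for each of the
  three pairs \<open>(i, j) \<noteq> (0, 0)\<close>. The combination kills a term \<open>C / t\<close> and multiplies constant terms by
  \<open>-3\<close>, so the limit says that the expansion of the theta series at \<open>0\<close> has constant term \<open>0\<close>.
\<close>

theorem lattice_theta_constant_term:
  "((\<lambda>t. lattice_theta A B C t - 4 * lattice_theta A B C (4 * t)) \<longlongrightarrow> 0) (at_right 0)"
proof -
  interpret f1: positive_form A "2 * B" "4 * C"
    using A_pos disc_pos by unfold_locales (simp_all add: power2_eq_square)
  interpret f2: positive_form C "2 * B" "4 * A"
    using C_pos disc_pos by unfold_locales (simp_all add: power2_eq_square algebra_simps)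
  interpret f3: positive_form "A + B + C" "4 * A + 2 * B" "4 * A"
  proof
    show "0 < A + B + C"
      using qform_ge[of 1 1] ellipticity_pos by (simp add: qform_def)
    show "0 < 4 * (A + B + C) * (4 * A) - (4 * A + 2 * B)\<^sup>2"
      using disc_pos by (simp add: power2_eq_square algebra_simps)
  qed
  define f where "f = (\<lambda>t (v :: int \<times> int). exp (- t * qform A B C (of_int (fst v)) (of_int (snd v))))"
  define alt where "alt = (\<lambda>A B C t. infsum (\<lambda>(x, y). parity_sign x * exp (- t * qform A B C (of_int x) (of_int y))) (UNIV :: (int \<times> int) set))"
  define c1 c2 c3 c0 :: "int \<times> int \<Rightarrow> real" where
    "c1 = (\<lambda>v. of_bool (even (snd v)) * parity_sign (fst v))" and
    "c2 = (\<lambda>v. of_bool (even (fst v)) * parity_sign (snd v))" and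
    "c3 = (\<lambda>v. of_bool (even (fst v + snd v)) * parity_sign (snd v))" and
    "c0 = (\<lambda>v. of_bool (even (fst v) \<and> even (snd v)))"
  have *: "lattice_theta A B C t - 4 * lattice_theta A B C (4 * t) =
     - (alt A (2 * B) (4 * C) t + alt C (2 * B) (4 * A) t + alt (A + B + C) (4 * A + 2 * B) (4 * A) t)"
    if t: "t > 0" for t
  proof -
    have sf: "f t summable_on UNIV"
      using lattice_theta_summable[OF t] by (simp add: f_def case_prod_beta')
    have sc: "(\<lambda>v. c v * f t v) summable_on UNIV" if "\<And>v. \<bar>c v\<bar> \<le> 1" for c
    proof (rule abs_summable_summable, rule summable_on_comparison_test[OF sf])
      show "norm (c v * f t v) \<le> f t v" for v
        using mult_right_mono[OF that[of v], of "f t v"] by (simp add: abs_mult f_def)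
    qed auto
    have c: "\<bar>c0 v\<bar> \<le> 1" "\<bar>c1 v\<bar> \<le> 1" "\<bar>c2 v\<bar> \<le> 1" "\<bar>c3 v\<bar> \<le> 1" for v
      by (auto simp: c0_def c1_def c2_def c3_def parity_sign_def)
    note defs = lattice_theta_def alt_def case_prod_beta' qform_def f_def c0_def c1_def c2_def c3_def
    have e0: "lattice_theta A B C (4 * t) = infsum (\<lambda>v. c0 v * f t v) UNIV"
      unfolding lattice_theta_def case_prod_beta'
      by (rule infsum_weighted_reindex[where h = "\<lambda>v. (2 * fst v, 2 * snd v)" and g = "\<lambda>v. (fst v div 2, snd v div 2)"])
         (auto simp: defs power2_eq_square algebra_simps)
    have e1: "alt A (2 * B) (4 * C) t = infsum (\<lambda>v. c1 v * f t v) UNIV"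
      unfolding alt_def case_prod_beta'
      by (rule infsum_weighted_reindex[where h = "\<lambda>v. (fst v, 2 * snd v)" and g = "\<lambda>v. (fst v, snd v div 2)"])
         (auto simp: defs power2_eq_square algebra_simps)
    have e2: "alt C (2 * B) (4 * A) t = infsum (\<lambda>v. c2 v * f t v) UNIV"
      unfolding alt_def case_prod_beta'
      by (rule infsum_weighted_reindex[where h = "\<lambda>v. (2 * snd v, fst v)" and g = "\<lambda>v. (snd v, fst v div 2)"])
         (auto simp: defs power2_eq_square algebra_simps)
    have e3: "alt (A + B + C) (4 * A + 2 * B) (4 * A) t = infsum (\<lambda>v. c3 v * f t v) UNIV"
      unfolding alt_def case_prod_beta'
      by (rule infsum_weighted_reindex[where h = "\<lambda>v. (fst v + 2 * snd v, fst v)" and g = "\<lambda>v. (snd v, (fst v - snd v) div 2)"])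
         (auto simp: defs power2_eq_square algebra_simps)
    have hs: "((\<lambda>v. c v * f t v) has_sum (infsum (\<lambda>v. c v * f t v) UNIV)) UNIV"
      if "\<And>v. \<bar>c v\<bar> \<le> 1" for c using sc[OF that] by simp
    have "((\<lambda>v. f t v - 4 * (c0 v * f t v)) has_sum (infsum (f t) UNIV - 4 * infsum (\<lambda>v. c0 v * f t v) UNIV)) UNIV"
      using sf by (intro has_sum_diff has_sum_cmult_right hs c) simp
    moreover have "((\<lambda>v. - (c1 v * f t v + c2 v * f t v + c3 v * f t v)) has_sum
      - (infsum (\<lambda>v. c1 v * f t v) UNIV + infsum (\<lambda>v. c2 v * f t v) UNIV + infsum (\<lambda>v. c3 v * f t v) UNIV)) UNIV"
      by (intro has_sum_uminusI has_sum_add hs c)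
    moreover have "f t v - 4 * (c0 v * f t v) = - (c1 v * f t v + c2 v * f t v + c3 v * f t v)" for v
      by (cases "even (fst v)"; cases "even (snd v)")
        (auto simp: c0_def c1_def c2_def c3_def parity_sign_def)
    ultimately have "infsum (f t) UNIV - 4 * infsum (\<lambda>v. c0 v * f t v) UNIV =
      - (infsum (\<lambda>v. c1 v * f t v) UNIV + infsum (\<lambda>v. c2 v * f t v) UNIV + infsum (\<lambda>v. c3 v * f t v) UNIV)"
      using has_sum_unique by fastforce
    moreover have "lattice_theta A B C t = infsum (f t) UNIV"
      by (simp add: lattice_theta_def f_def case_prod_beta')
    ultimately show ?thesis by (simp add: e0 e1 e2 e3)
  qed
  have "((\<lambda>t. - (alt A (2 * B) (4 * C) t + alt C (2 * B) (4 * A) t + alt (A + B + C) (4 * A + 2 * B) (4 * A) t))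
     \<longlongrightarrow> - (0 + 0 + 0)) (at_right 0)"
    unfolding alt_def by (intro tendsto_intros f1.alternating_theta_tendsto_0
      f2.alternating_theta_tendsto_0 f3.alternating_theta_tendsto_0)
  moreover have "\<forall>\<^sub>F t in at_right 0. - (alt A (2 * B) (4 * C) t + alt C (2 * B) (4 * A) t + alt (A + B + C) (4 * A + 2 * B) (4 * A) t)
     = lattice_theta A B C t - 4 * lattice_theta A B C (4 * t)"
    using eventually_at_right_less[of "0::real"] by eventually_elim (simp add: *)
  ultimately show ?thesis by (simp add: tendsto_cong)
qed

end


section \<open>The Lambert series of the character\<close>

lemma summation_by_parts:
  fixes a c :: "nat \<Rightarrow> real"
  shows "(\<Sum>k<n. c k * a k) = (\<Sum>j<n. c j) * a n + (\<Sum>k<n. (\<Sum>j\<le>k. c j) * (a k - a (Suc k)))"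
  by (induction n) (simp_all add: algebra_simps lessThan_Suc_atMost flip: lessThan_Suc_atMost)

text \<open>
  Two summations by parts: the first replaces \<open>c\<close> by its partial sums, which fluctuate around \<open>\<mu>\<close>; the
  second bounds the contribution of the fluctuation by the first difference of \<open>a\<close>, because the
  differences of a convex sequence decrease.
\<close>

lemma convex_weighted_sum_approx:
  fixes a c :: "nat \<Rightarrow> real"
  assumes Y: "(\<lambda>k. c k * a k) sums Y"
    and a0: "a \<longlonglongrightarrow> 0"
    and mono: "\<And>k. a (Suc k) \<le> a k"
    and convex: "\<And>k. a (Suc k) - a (Suc (Suc k)) \<le> a k - a (Suc k)"
    and R: "\<And>n. \<bar>\<Sum>k<n. (\<Sum>j\<le>k. c j) - \<mu>\<bar> \<le> M"
  shows "\<bar>Y - \<mu> * a 0\<bar> \<le> M * (a 0 - a 1)"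
proof -
  define S where "S = (\<lambda>k. \<Sum>j\<le>k. c j)"
  define b where "b = (\<lambda>k. a k - a (Suc k))"
  define T where "T = (\<lambda>n. \<Sum>j<n. c j)"
  have M: "M \<ge> 0" using R[of 0] by simp
  have b0: "b k \<ge> 0" and bmono: "b (Suc k) \<le> b k" for k
    using mono convex by (auto simp: b_def)
  have fin: "\<bar>(\<Sum>k<n. c k * a k) - T n * a n - \<mu> * (a 0 - a n)\<bar> \<le> M * b 0" for n
  proof -
    define R where "R = (\<lambda>n. \<Sum>k<n. S k - \<mu>)"
    have RM: "\<bar>R n\<bar> \<le> M" for n using assms(5)[of n] by (simp add: R_def S_def)
    have "(\<Sum>k<n. c k * a k) - T n * a n = (\<Sum>k<n. S k * b k)"
      using summation_by_parts[of c a n] by (simp add: T_def S_def b_def)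
    also have "\<dots> = (\<Sum>k<n. (S k - \<mu>) * b k) + \<mu> * (\<Sum>k<n. b k)"
      by (simp add: algebra_simps sum.distrib sum_subtractf sum_distrib_left)
    also have "(\<Sum>k<n. b k) = a 0 - a n"
      unfolding b_def by (induction n) auto
    finally have "(\<Sum>k<n. c k * a k) - T n * a n - \<mu> * (a 0 - a n) = (\<Sum>k<n. (S k - \<mu>) * b k)"
      by simp
    also have "\<dots> = R n * b n + (\<Sum>k<n. R (Suc k) * (b k - b (Suc k)))"
      using summation_by_parts[of "\<lambda>k. S k - \<mu>" b n] by (simp add: R_def lessThan_Suc_atMost)
    also have "\<bar>\<dots>\<bar> \<le> M * b n + (\<Sum>k<n. M * (b k - b (Suc k)))"
    proof (rule order.trans[OF abs_triangle_ineq], rule add_mono)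
      show "\<bar>R n * b n\<bar> \<le> M * b n" using RM b0 by (simp add: abs_mult mult_right_mono)
      show "\<bar>\<Sum>k<n. R (Suc k) * (b k - b (Suc k))\<bar> \<le> (\<Sum>k<n. M * (b k - b (Suc k)))"
      proof (rule order.trans[OF sum_abs], rule sum_mono)
        fix k
        show "\<bar>R (Suc k) * (b k - b (Suc k))\<bar> \<le> M * (b k - b (Suc k))"
          using RM bmono by (simp add: abs_mult mult_right_mono)
      qed
    qed
    also have "(\<Sum>k<n. M * (b k - b (Suc k))) = M * (b 0 - b n)"
      by (induction n) (auto simp: algebra_simps)
    finally show ?thesis by (simp add: algebra_simps)
  qed
  have Tbound: "\<bar>T n\<bar> \<le> 2 * M + \<bar>\<mu>\<bar>" for n
  proof (cases n)
    case 0
    then show ?thesis using M by (simp add: T_def)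
  next
    case (Suc k)
    have "T n = S k" by (simp add: Suc T_def S_def lessThan_Suc_atMost)
    then have "T n - \<mu> = (\<Sum>i<Suc k. S i - \<mu>) - (\<Sum>i<k. S i - \<mu>)" by simp
    then show ?thesis using R[of "Suc k"] R[of k] unfolding S_def by linarith
  qed
  have "(\<lambda>n. T n * a n) \<longlonglongrightarrow> 0"
  proof (rule Lim_null_comparison)
    show "\<forall>\<^sub>F n in sequentially. norm (T n * a n) \<le> (2 * M + \<bar>\<mu>\<bar>) * \<bar>a n\<bar>"
      using Tbound by (intro always_eventually) (auto simp: abs_mult intro: mult_right_mono)
    show "(\<lambda>n. (2 * M + \<bar>\<mu>\<bar>) * \<bar>a n\<bar>) \<longlonglongrightarrow> 0"
      using tendsto_mult_right_zero[OF tendsto_rabs_zero[OF a0]] by simp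
  qed
  then have "(\<lambda>n. \<bar>(\<Sum>k<n. c k * a k) - T n * a n - \<mu> * (a 0 - a n)\<bar>)
      \<longlonglongrightarrow> \<bar>Y - 0 - \<mu> * (a 0 - 0)\<bar>"
    using Y a0 unfolding sums_def by (intro tendsto_intros)
  then show ?thesis
    using fin by (intro tendsto_upperbound[where F = sequentially]) (auto simp: b_def)
qed

lemma periodic_sum_lessThan:
  fixes c :: "nat \<Rightarrow> real"
  assumes "\<And>n. c (n + p) = c n" "(\<Sum>j<p. c j) = 0"
  shows "(\<Sum>j<n + p. c j) = (\<Sum>j<n. c j)"
  by (induction n) (simp_all add: assms)

lemma periodic_bounded:
  fixes g :: "nat \<Rightarrow> real"
  assumes "\<And>n. g (n + p) = g n" "p > 0"
  obtains M where "\<And>n. \<bar>g n\<bar> \<le> M"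
proof
  have per: "g (n + k * p) = g n" for n k
    by (induction k) (simp_all add: assms(1) add.assoc[symmetric] add.commute[of p])
  fix n
  have "g n = g (n mod p)"
    using per[of "n mod p" "n div p"] by (simp add: mult.commute)
  moreover have "\<bar>g (n mod p)\<bar> \<in> (\<lambda>n. \<bar>g n\<bar>) ` {..<p}" using assms(2) by auto
  ultimately show "\<bar>g n\<bar> \<le> Max ((\<lambda>n. \<bar>g n\<bar>) ` {..<p})" by simp
qed

text \<open>The kernel of the Fermi-Dirac distribution.\<close>

definition fermi :: "real \<Rightarrow> real" where
  "fermi u = 1 / (exp u + 1)"

lemma fermi_convex:
  assumes "u \<ge> 0" "t \<ge> 0"
  shows "fermi (u + t) - fermi (u + 2 * t) \<le> fermi u - fermi (u + t)"
proof -
  define p q where "p = exp u" and "q = exp t"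
  have pq: "p \<ge> 1" "q \<ge> 1" using assms by (simp_all add: p_def q_def)
  have e: "exp (u + t) = p * q" "exp (u + 2 * t) = p * q\<^sup>2"
    by (simp_all add: p_def q_def exp_add power2_eq_square flip: exp_add)
  have pos: "p + 1 > 0" "p * q + 1 > 0" "p * q\<^sup>2 + 1 > 0"
    using pq by (auto intro!: add_pos_pos mult_pos_pos)
  have "0 \<le> p * (q - 1)\<^sup>2 * (p * q - 1)"
    using pq mult_mono[of 1 p 1 q] by simp
  also have "\<dots> = (p * q + 1) * (p * q\<^sup>2 + 1) + (p + 1) * (p * q + 1) - 2 * (p + 1) * (p * q\<^sup>2 + 1)"
    by (simp add: power2_eq_square algebra_simps)
  finally have "0 \<le> ((p * q + 1) * (p * q\<^sup>2 + 1) + (p + 1) * (p * q + 1) - 2 * (p + 1) * (p * q\<^sup>2 + 1))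
      / ((p + 1) * (p * q + 1) * (p * q\<^sup>2 + 1))"
    using pos by (intro divide_nonneg_nonneg) auto
  also have "\<dots> = fermi u - 2 * fermi (u + t) + fermi (u + 2 * t)"
    unfolding fermi_def e p_def[symmetric] using pos
    by (simp add: divide_simps) (simp add: algebra_simps)
  finally show ?thesis by simp
qed

lemma fermi_antimono: "u \<le> v \<Longrightarrow> fermi v \<le> fermi u"
  unfolding fermi_def by (intro divide_left_mono) (auto simp: add_pos_pos)

lemma fermi_bounds: "0 \<le> fermi u" "fermi u \<le> exp (- u)"
proof -
  show "0 \<le> fermi u" by (simp add: fermi_def add_nonneg_nonneg)
  have "1 / (exp u + 1) \<le> 1 / exp u" by (intro divide_left_mono) (auto simp: add_pos_pos)
  then show "fermi u \<le> exp (- u)" by (simp add: fermi_def exp_minus inverse_eq_divide)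
qed

text \<open>
  Subtracting the rescaled Planck kernel removes its pole at \<open>0\<close>; what is left has value \<open>3/2\<close> there.
\<close>

lemma planck_kernel_combination:
  assumes "u > 0"
  shows "1 / (exp u - 1) - 4 * (1 / (exp (4 * u) - 1)) = fermi u + 2 * fermi (2 * u)"
proof -
  define p where "p = exp u"
  have p: "p > 1" using assms by (simp add: p_def)
  have e: "exp (4 * u) = p ^ 4" "exp (2 * u) = p\<^sup>2"
    by (simp_all add: p_def flip: exp_of_nat_mult)
  have "p\<^sup>2 > 1" "p ^ 4 > 1" using p by (simp_all add: one_less_power)
  then have nz: "p - 1 \<noteq> 0" "p + 1 \<noteq> 0" "p\<^sup>2 + 1 \<noteq> 0" "p ^ 4 - 1 \<noteq> 0"
    using p by linarith+
  have f: "p ^ 4 - 1 = (p - 1) * (p + 1) * (p\<^sup>2 + 1)"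
    by (simp add: power2_eq_square power4_eq_xxxx algebra_simps)
  have "1 / (p - 1) - 4 * (1 / (p ^ 4 - 1)) = 1 / (p + 1) + 2 * (1 / (p\<^sup>2 + 1))"
    unfolding f using nz by (simp add: divide_simps) (simp add: power2_eq_square algebra_simps)
  then show ?thesis unfolding fermi_def e p_def[symmetric] .
qed

lemma geometric_has_sum_from_1:
  fixes v :: real
  assumes "v > 0"
  shows "((\<lambda>k. exp (- v * real k)) has_sum (1 / (exp v - 1))) {1..}"
proof -
  define a where "a = exp (- v)"
  have a: "0 < a" "a < 1" using assms by (simp_all add: a_def)
  have "((\<lambda>n. a ^ n) has_sum (1 / (1 - a))) UNIV"
    using a geometric_sums[of a] by (intro sums_nonneg_imp_has_sum) auto
  then have "((\<lambda>n. a * a ^ n) has_sum (a * (1 / (1 - a)))) UNIV" by (rule has_sum_cmult_right)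
  moreover have "a * (1 / (1 - a)) = 1 / (exp v - 1)"
    using a assms by (simp add: a_def exp_minus field_simps)
  moreover have "a * a ^ n = exp (- v * real (Suc n))" for n
  proof -
    have "exp (- v * real (Suc n)) = exp (real (Suc n) * - v)" by (simp add: mult.commute)
    also have "\<dots> = a ^ Suc n" unfolding a_def by (rule exp_of_nat_mult)
    finally show ?thesis by simp
  qed
  ultimately have "((\<lambda>n. exp (- v * real (Suc n))) has_sum (1 / (exp v - 1))) UNIV" by simp
  moreover have "bij_betw Suc UNIV {1..}"
    by (rule bij_betwI[of _ _ _ "\<lambda>n. n - 1"]) auto
  ultimately show ?thesis
    using has_sum_reindex_bij_betw[of Suc UNIV "{1..}" "\<lambda>k. exp (- v * real k)"] by simp
qed

context odd_imaginary_discriminant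
begin

abbreviation ideal_weight :: "real \<Rightarrow> nat \<times> nat \<times> int \<Rightarrow> real" where
  "ideal_weight t T \<equiv> exp (- t * real (triple_norm T))"

definition ideal_series :: "real \<Rightarrow> real" where
  "ideal_series t = infsum (ideal_weight t) ideal_triples"

text \<open>
  The double series of \<open>\<chi>(d) exp (- t d k)\<close> converges absolutely. Collecting the terms with \<open>d k = n\<close>
  gives the sum over ideals, summing over \<open>k\<close> first gives the Lambert series.
\<close>

lemma ideal_series_lambert:
  assumes t: "t > 0"
  shows "ideal_weight t summable_on ideal_triples"
    and "((\<lambda>d. of_int (chi (int d)) * (1 / (exp (t * real d) - 1))) has_sum ideal_series t) {1..}"
proof -
  define P :: "(nat \<times> nat) set" where "P = {1..} \<times> {1..}"
  define g where "g = (\<lambda>(d, k). of_int (chi (int d)) * exp (- t * real (d * k)))"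
  have "(\<lambda>v. norm (g v)) summable_on P"
  proof (rule summable_on_comparison_test)
    show "(\<lambda>v. exp (- (t / 2) * real (fst v)) * exp (- (t / 2) * real (snd v))) summable_on P"
      unfolding P_def
    proof (rule summable_on_SigmaI)
      show "((\<lambda>k. exp (- (t / 2) * real (fst (d, k))) * exp (- (t / 2) * real (snd (d, k)))) has_sum
        (exp (- (t / 2) * real d) * (1 / (exp (t / 2) - 1)))) {1..}" for d :: nat
        unfolding fst_conv snd_conv using t by (intro has_sum_cmult_right geometric_has_sum_from_1) auto
      show "(\<lambda>d. exp (- (t / 2) * real d) * (1 / (exp (t / 2) - 1))) summable_on {1..}"
        using geometric_has_sum_from_1[of "t / 2"] t
        by (intro summable_on_cmult_left) (auto intro: has_sum_imp_summable)
    qed auto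
    fix v assume v: "v \<in> P"
    obtain d k where dk: "v = (d, k)" "d \<ge> 1" "k \<ge> 1" using v by (cases v) (auto simp: P_def)
    have "d * 1 \<le> d * k" "1 * k \<le> d * k" using dk by (intro mult_le_mono order.refl; simp)+
    then have "d + k \<le> 2 * (d * k)" by linarith
    then have "real d + real k \<le> 2 * real (d * k)"
      by (metis of_nat_add of_nat_le_iff of_nat_mult of_nat_numeral)
    then have "(t / 2) * (real d + real k) \<le> (t / 2) * (2 * real (d * k))"
      using t by (intro mult_left_mono) auto
    then have "exp (- t * real (d * k)) \<le> exp (- (t / 2) * real d) * exp (- (t / 2) * real k)"
      by (simp add: exp_add[symmetric] algebra_simps)
    moreover have "\<bar>chi (int d)\<bar> \<le> 1" using chi_values[of "int d"] by auto
    then have "\<bar>real_of_int (chi (int d))\<bar> \<le> 1" by (metis of_int_abs of_int_le_1_iff)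
    ultimately show "norm (g v) \<le> exp (- (t / 2) * real (fst v)) * exp (- (t / 2) * real (snd v))"
      using mult_mono[of "\<bar>real_of_int (chi (int d))\<bar>" 1 "exp (- t * real (d * k))" "exp (- (t / 2) * real d) * exp (- (t / 2) * real k)"]
      by (simp add: g_def dk abs_mult)
  qed auto
  then have "g summable_on P" by (rule abs_summable_summable)
  then obtain S where S: "(g has_sum S) P" using has_sum_infsum by blast
  have byd: "((\<lambda>d. of_int (chi (int d)) * (1 / (exp (t * real d) - 1))) has_sum S) {1..}"
  proof (rule has_sum_SigmaD)
    show "(g has_sum S) ({1..} \<times> {1..})" using S by (simp add: P_def)
    fix d :: nat assume "d \<in> {1..}"
    then have "t * real d > 0" using t by simp
    then have "((\<lambda>k. of_int (chi (int d)) * exp (- (t * real d) * real k)) has_sum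
        (of_int (chi (int d)) * (1 / (exp (t * real d) - 1)))) {1..}"
      by (intro has_sum_cmult_right geometric_has_sum_from_1)
    then show "((\<lambda>k. g (d, k)) has_sum (of_int (chi (int d)) * (1 / (exp (t * real d) - 1)))) {1..}"
      by (simp add: g_def mult.assoc)
  qed
  define Tn where "Tn = (\<lambda>n. {T \<in> ideal_triples. triple_norm T = n})"
  have "((\<lambda>(n, d). of_int (chi (int d)) * exp (- t * real n)) has_sum S) (Sigma {1..} (\<lambda>n. {d. d dvd n}))"
  proof -
    have bij: "bij_betw (\<lambda>(d, k). (d * k, d)) P (Sigma {1..} (\<lambda>n. {d. d dvd n}))"
      by (rule bij_betwI[of _ _ _ "\<lambda>(n, d). (d, n div d)"])
         (auto simp: P_def dvd_div_eq_0_iff Suc_le_eq intro!: Nat.gr0I)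
    show ?thesis
      using S unfolding has_sum_reindex_bij_betw[OF bij, symmetric]
      by (simp add: g_def case_prod_beta')
  qed
  then have sumn: "((\<lambda>n. (\<Sum>d | d dvd n. of_int (chi (int d)) * exp (- t * real n))) has_sum S) {1..}"
    by (rule has_sum_SigmaD) (auto intro!: has_sum_finiteI)
  have cardT: "(\<Sum>d | d dvd n. of_int (chi (int d)) * exp (- t * real n)) =
      real (card (Tn n)) * exp (- t * real n)" if "n \<in> {1..}" for n
  proof -
    have "int (card (Tn n)) = (\<Sum>d | d dvd n. chi (int d))"
      using card_ideal_triples_of_norm(2)[of n] that by (simp add: Tn_def)
    then have "real (card (Tn n)) = (\<Sum>d | d dvd n. of_int (chi (int d)))"
      by (metis of_int_of_nat_eq of_int_sum)
    then show ?thesis by (simp add: sum_distrib_right)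
  qed
  have byn: "((\<lambda>n. real (card (Tn n)) * exp (- t * real n)) has_sum S) {1..}"
    by (rule iffD1[OF has_sum_cong[OF cardT] sumn])
  have fib: "((\<lambda>T. exp (- t * real n)) has_sum (real (card (Tn n)) * exp (- t * real n))) (Tn n)"
    if "n \<in> {1..}" for n
    using card_ideal_triples_of_norm(1)[of n] that by (intro has_sum_finiteI) (auto simp: Tn_def)
  have sumT: "(\<lambda>(n, T). exp (- t * real n)) summable_on (Sigma {1..} Tn)"
    by (rule summable_on_SigmaI[where g = "\<lambda>n. real (card (Tn n)) * exp (- t * real n)"])
       (use fib has_sum_imp_summable[OF byn] in auto)
  have "((\<lambda>(n, T). exp (- t * real n)) has_sum S) (Sigma {1..} Tn)"
    by (rule has_sum_SigmaI[OF _ byn sumT]) (use fib in auto)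
  moreover have bij: "bij_betw (\<lambda>T. (triple_norm T, T)) ideal_triples (Sigma {1..} Tn)"
    by (rule bij_betwI[of _ _ _ snd]) (auto simp: Tn_def ideal_triples_def Suc_le_eq)
  ultimately have *: "(ideal_weight t has_sum S) ideal_triples"
    using has_sum_reindex_bij_betw[OF bij, of "\<lambda>(n, T). exp (- t * real n)" S] by simp
  show "ideal_weight t summable_on ideal_triples"
    using * by (rule has_sum_imp_summable)
  have "ideal_series t = S" unfolding ideal_series_def using * by (rule infsumI)
  then show "((\<lambda>d. of_int (chi (int d)) * (1 / (exp (t * real d) - 1))) has_sum ideal_series t) {1..}"
    using byd by simp
qed

definition fermi_series :: "real \<Rightarrow> real" where
  "fermi_series t = infsum (\<lambda>d. of_int (chi (int d)) * fermi (t * real d)) {1..}"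

lemma fermi_series_has_sum:
  assumes t: "t > 0"
  shows "((\<lambda>d. of_int (chi (int d)) * fermi (t * real d)) has_sum fermi_series t) {1..}"
proof -
  have "(\<lambda>d. norm (of_int (chi (int d)) * fermi (t * real d))) summable_on {1..}"
  proof (rule summable_on_comparison_test)
    show "(\<lambda>d. exp (- t * real d)) summable_on {1..}"
      using geometric_has_sum_from_1[OF t] by (rule has_sum_imp_summable)
    fix d :: nat
    have "\<bar>chi (int d)\<bar> \<le> 1" using chi_values[of "int d"] by auto
    then have "\<bar>real_of_int (chi (int d))\<bar> \<le> 1" by (metis of_int_abs of_int_le_1_iff)
    then show "norm (of_int (chi (int d)) * fermi (t * real d)) \<le> exp (- t * real d)"
      using mult_mono[of "\<bar>real_of_int (chi (int d))\<bar>" 1 "fermi (t * real d)" "exp (- t * real d)"]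
        fermi_bounds[of "t * real d"] by (simp add: abs_mult)
  qed auto
  then have "(\<lambda>d. of_int (chi (int d)) * fermi (t * real d)) summable_on {1..}"
    by (rule abs_summable_summable)
  then show ?thesis by (simp add: fermi_series_def)
qed

lemma ideal_series_combination:
  assumes t: "t > 0"
  shows "ideal_series t - 4 * ideal_series (4 * t) = fermi_series t + 2 * fermi_series (2 * t)"
proof (rule has_sum_unique)
  show "((\<lambda>d. of_int (chi (int d)) * (1 / (exp (t * real d) - 1)) -
      4 * (of_int (chi (int d)) * (1 / (exp (4 * t * real d) - 1)))) has_sum
      (ideal_series t - 4 * ideal_series (4 * t))) {1..}"
    using ideal_series_lambert(2)[of t] ideal_series_lambert(2)[of "4 * t"] t
    by (intro has_sum_diff has_sum_cmult_right) auto
  have sum: "((\<lambda>d. of_int (chi (int d)) * fermi (t * real d) + 2 * (of_int (chi (int d)) * fermi (2 * t * real d)))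
      has_sum (fermi_series t + 2 * fermi_series (2 * t))) {1..}"
    using fermi_series_has_sum[of t] fermi_series_has_sum[of "2 * t"] t
    by (intro has_sum_add has_sum_cmult_right) auto
  have eq: "of_int (chi (int d)) * fermi (t * real d) + 2 * (of_int (chi (int d)) * fermi (2 * t * real d)) =
    of_int (chi (int d)) * (1 / (exp (t * real d) - 1)) - 4 * (of_int (chi (int d)) * (1 / (exp (4 * t * real d) - 1)))"
    if "d \<in> {1..}" for d
  proof -
    have "t * real d > 0" using t that by simp
    from planck_kernel_combination[OF this] show ?thesis
      by (simp add: mult.assoc right_diff_distrib[symmetric] distrib_left[symmetric]
          mult.left_commute[of _ "real_of_int _"] del: times_divide_eq_right)
  qed
  show "((\<lambda>d. of_int (chi (int d)) * (1 / (exp (t * real d) - 1)) -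
      4 * (of_int (chi (int d)) * (1 / (exp (4 * t * real d) - 1)))) has_sum
      (fermi_series t + 2 * fermi_series (2 * t))) {1..}"
    by (rule iffD1[OF has_sum_cong[OF eq] sum])
qed

lemma chi_zero: "chi 0 = 0"
  using N_gt by (simp add: chi_eq_0_iff)

lemma chi_reflect: "chi (N - x) = - chi x"
proof -
  have "chi (N - x) = chi (- x)" by (rule chi_cong) (simp add: cong_iff_dvd_diff)
  then show ?thesis by (simp add: chi_minus)
qed

lemma chi_sum_period: "(\<Sum>j<nat N. of_int (chi (int j)) :: real) = 0"
proof -
  have N: "nat N = Suc (nat N - 1)" using N_gt by simp
  have "(\<Sum>j<nat N. of_int (chi (int j)) :: real) = (\<Sum>j\<in>{1..<nat N}. of_int (chi (int j)))"
    by (intro sum.mono_neutral_right) (auto simp: chi_zero Suc_le_eq)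
  also have "\<dots> = (\<Sum>j\<in>{1..<nat N}. of_int (chi (int (nat N - j))))"
    by (rule sum.reindex_bij_witness[where i = "\<lambda>j. nat N - j" and j = "\<lambda>j. nat N - j"]) auto
  also have "\<dots> = (\<Sum>j\<in>{1..<nat N}. - of_int (chi (int j)))"
    using N_gt chi_reflect by (intro sum.cong) (auto simp: of_nat_diff)
  also have "\<dots> = - (\<Sum>j\<in>{1..<nat N}. of_int (chi (int j)))" by (simp add: sum_negf)
  finally show ?thesis by (simp add: \<open>(\<Sum>j<nat N. of_int (chi (int j)) :: real) = (\<Sum>j\<in>{1..<nat N}. of_int (chi (int j)))\<close>)
qed

text \<open>
  The mean over a period of the partial sums of \<open>\<chi>\<close>, after exchanging the order of summation; it is the
  value at \<open>0\<close> of the \<open>L\<close>-series of \<open>\<chi>\<close>.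
\<close>

definition chi_mean :: real where
  "chi_mean = - (\<Sum>j<nat N. real j * of_int (chi (int j))) / of_int N"

lemma fermi_series_tendsto: "(fermi_series \<longlongrightarrow> chi_mean / 2) (at_right 0)"
proof -
  define p where "p = nat N"
  define c where "c = (\<lambda>j. real_of_int (chi (int j)))"
  define S where "S = (\<lambda>k. \<Sum>j\<le>k. c j)"
  have p: "p > 0" "real p = of_int N" "int p = N" using N_gt by (simp_all add: p_def)
  have cper: "c (n + p) = c n" for n
    unfolding c_def using p by (intro arg_cong[where f = of_int] chi_cong) (simp add: cong_iff_dvd_diff)
  have Sper: "S (n + p) = S n" for n
    using periodic_sum_lessThan[of c p "Suc n"] cper chi_sum_period
    by (simp add: S_def c_def p_def lessThan_Suc_atMost)
  have "(\<Sum>k<n. \<Sum>j\<le>k. c j) = (\<Sum>j<n. (real n - real j) * c j)" for n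
    by (induction n) (simp_all add: algebra_simps sum.distrib sum_subtractf lessThan_Suc_atMost[symmetric])
  then have "(\<Sum>k<p. S k) = (\<Sum>j<p. real p * c j - real j * c j)"
    unfolding S_def by (simp add: left_diff_distrib)
  also have "\<dots> = of_int N * chi_mean"
    using chi_sum_period p N_gt
    by (simp add: sum_subtractf sum_distrib_left[symmetric] c_def p_def chi_mean_def)
  finally have Smean: "(\<Sum>k<p. S k - chi_mean) = 0" using p by (simp add: sum_subtractf)
  have Rper: "(\<Sum>k<n + p. S k - chi_mean) = (\<Sum>k<n. S k - chi_mean)" for n
    using periodic_sum_lessThan[of "\<lambda>k. S k - chi_mean" p n] Sper Smean by simp
  then obtain M where M: "\<And>n. \<bar>\<Sum>k<n. S k - chi_mean\<bar> \<le> M"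
    using periodic_bounded[of "\<lambda>n. \<Sum>k<n. S k - chi_mean" p] p(1) by blast
  have bound: "\<bar>fermi_series t - chi_mean * fermi 0\<bar> \<le> M * (fermi 0 - fermi t)" if t: "t > 0" for t
  proof -
    have "((\<lambda>d. c d * fermi (t * real d)) has_sum fermi_series t) {1..}"
      using fermi_series_has_sum[OF t] by (simp add: c_def)
    also have "?this \<longleftrightarrow> ((\<lambda>d. c d * fermi (t * real d)) has_sum fermi_series t) UNIV"
      by (intro has_sum_cong_neutral) (auto simp: c_def chi_zero not_le)
    finally have sums: "(\<lambda>d. c d * fermi (t * real d)) sums fermi_series t"
      by (rule has_sum_imp_sums)
    have lim: "(\<lambda>d. fermi (t * real d)) \<longlonglongrightarrow> 0"
    proof (rule tendsto_sandwich[OF _ _ tendsto_const])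
      have "(\<lambda>n. (exp (- t)) ^ n) \<longlonglongrightarrow> 0" using t by (intro LIMSEQ_realpow_zero) auto
      then show "(\<lambda>d. exp (- t) ^ d) \<longlonglongrightarrow> 0" .
      show "\<forall>\<^sub>F n in sequentially. fermi (t * real n) \<le> exp (- t) ^ n"
        using fermi_bounds(2) by (intro always_eventually)
          (metis exp_of_nat_mult mult.commute mult_minus_right)
      show "\<forall>\<^sub>F n in sequentially. 0 \<le> fermi (t * real n)"
        using fermi_bounds(1) by (intro always_eventually) auto
    qed
    have "\<bar>fermi_series t - chi_mean * fermi (t * real 0)\<bar> \<le> M * (fermi (t * real 0) - fermi (t * real 1))"
    proof (rule convex_weighted_sum_approx[OF sums lim])
      fix k
      show "fermi (t * real (Suc k)) \<le> fermi (t * real k)"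
        using t by (intro fermi_antimono) auto
      show "fermi (t * real (Suc k)) - fermi (t * real (Suc (Suc k))) \<le> fermi (t * real k) - fermi (t * real (Suc k))"
        using fermi_convex[of "t * real k" t] t by (simp add: algebra_simps)
      show "\<bar>\<Sum>k<n. (\<Sum>j\<le>k. c j) - chi_mean\<bar> \<le> M" for n using M[of n] by (simp add: S_def)
    qed
    then show ?thesis by simp
  qed
  have "((\<lambda>t. fermi_series t - chi_mean * fermi 0) \<longlongrightarrow> 0) (at_right 0)"
  proof (rule Lim_null_comparison)
    show "\<forall>\<^sub>F t in at_right 0. norm (fermi_series t - chi_mean * fermi 0) \<le> M * (fermi 0 - fermi t)"
      using eventually_at_right_less[of "0::real"] by eventually_elim (use bound in simp)
    have "((\<lambda>t. M * (fermi 0 - fermi t)) \<longlongrightarrow> M * (fermi 0 - fermi 0)) (at_right 0)"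
      unfolding fermi_def by (intro tendsto_intros) (auto simp: add_pos_pos)
    then show "((\<lambda>t. M * (fermi 0 - fermi t)) \<longlongrightarrow> 0) (at_right 0)" by simp
  qed
  then have "(fermi_series \<longlongrightarrow> chi_mean * fermi 0) (at_right 0)"
    by (simp add: LIM_zero_iff)
  then show ?thesis by (simp add: fermi_def)
qed

theorem ideal_series_constant_term:
  "((\<lambda>t. ideal_series t - 4 * ideal_series (4 * t)) \<longlongrightarrow> 3 / 2 * chi_mean) (at_right 0)"
proof -
  have "filterlim (\<lambda>t::real. 2 * t) (at_right 0) (at_right 0)"
  unfolding filterlim_at
  proof
    show "((\<lambda>t::real. 2 * t) \<longlongrightarrow> 0) (at_right 0)"
      by (rule tendsto_eq_intros refl)+ simp
    show "\<forall>\<^sub>F t in at_right 0. 2 * t \<in> {0<..} \<and> 2 * t \<noteq> (0::real)"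
      using eventually_at_right_less[of "0::real"] by eventually_elim simp
  qed
  from filterlim_compose[OF fermi_series_tendsto this]
  have "((\<lambda>t. fermi_series t + 2 * fermi_series (2 * t)) \<longlongrightarrow> chi_mean / 2 + 2 * (chi_mean / 2)) (at_right 0)"
    by (intro tendsto_intros fermi_series_tendsto)
  moreover have "\<forall>\<^sub>F t in at_right 0. fermi_series t + 2 * fermi_series (2 * t) = ideal_series t - 4 * ideal_series (4 * t)"
    using eventually_at_right_less[of "0::real"] by eventually_elim (simp add: ideal_series_combination)
  ultimately show ?thesis by (simp add: tendsto_cong)
qed

end


section \<open>The ring of integers\<close>

lemma of_real_of_rat: "of_real (of_rat q) = (of_rat q :: complex)"
  by (cases q) (simp add: of_rat_rat)

lemma poly_of_int_add:
  "poly (map_poly of_int (p + q)) z = poly (map_poly of_int p) z + poly (map_poly of_int q) (z :: complex)"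
proof -
  have "map_poly of_int (p + q) = map_poly of_int p + (map_poly of_int q :: complex poly)"
    by (rule poly_eqI) (simp add: coeff_map_poly)
  then show ?thesis by simp
qed

lemma poly_of_int_mult:
  "poly (map_poly of_int (p * q)) z = poly (map_poly of_int p) z * poly (map_poly of_int q) (z :: complex)"
proof -
  have "map_poly of_int (p * q) = map_poly of_int p * (map_poly of_int q :: complex poly)"
    by (rule poly_eqI) (simp add: coeff_map_poly coeff_mult)
  then show ?thesis by simp
qed

lemma poly_of_int_smult:
  "poly (map_poly of_int (Polynomial.smult c p)) z = of_int c * poly (map_poly of_int p) (z :: complex)"
proof -
  have "map_poly of_int (Polynomial.smult c p) = Polynomial.smult (of_int c) (map_poly of_int p :: complex poly)"
    by (rule poly_eqI) (simp add: coeff_map_poly)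
  then show ?thesis by simp
qed

lemma algebraic_int_quadratic:
  fixes z :: complex
  assumes "z * z - of_int t * z + of_int n = 0"
  shows "algebraic_int z"
  unfolding algebraic_int_altdef_ipoly
proof (intro exI conjI)
  show "lead_coeff [:n, - t, 1:] = 1" by simp
  show "poly (map_poly of_int [:n, - t, 1:]) z = 0"
    using assms by (simp add: map_poly_pCons algebra_simps)
qed

text \<open>
  Gauss's lemma: the primitive integer multiple of the minimal polynomial divides a monic integer
  polynomial, so it is monic itself up to sign.
\<close>

lemma primitive_quadratic_monic:
  fixes z :: complex and q :: "int poly"
  assumes z: "algebraic_int z" "Im z \<noteq> 0"
    and q: "poly (map_poly of_int q) z = 0" "degree q = 2" "Polynomial.content q = 1"
  shows "\<bar>lead_coeff q\<bar> = 1"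
proof -
  obtain p where p: "poly (map_poly of_int p) z = 0" "lead_coeff p = (1 :: int)"
    using z(1) by (auto simp: algebraic_int_altdef_ipoly)
  have "q \<noteq> 0" using q(2) by auto
  obtain g r where gr: "pseudo_divmod p q = (g, r)" by (cases "pseudo_divmod p q")
  define e where "e = lead_coeff q"
  define E where "E = e ^ (Suc (degree p) - degree q)"
  have eq: "Polynomial.smult E p = q * g + r" and r: "r = 0 \<or> degree r < 2"
    using pseudo_divmod[OF \<open>q \<noteq> 0\<close> gr] q(2) by (simp_all add: E_def e_def)
  have "poly (map_poly of_int (Polynomial.smult E p)) z = poly (map_poly of_int (q * g + r)) z"
    unfolding eq ..
  then have rz: "poly (map_poly of_int r) z = 0"
    by (simp add: poly_of_int_add poly_of_int_mult poly_of_int_smult p q)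
  have "r = 0"
  proof (rule ccontr)
    assume "r \<noteq> 0"
    then have "degree r < 2" using r by simp
    then have rc: "r = [:Polynomial.coeff r 0, Polynomial.coeff r 1:]"
      by (intro poly_eqI) (auto simp: coeff_pCons coeff_eq_0 split: nat.splits)
    have "of_int (Polynomial.coeff r 0) + z * of_int (Polynomial.coeff r 1) = 0"
      using rz by (subst (asm) rc) (simp add: map_poly_pCons)
    then have e: "of_int (Polynomial.coeff r 0) + Re z * of_int (Polynomial.coeff r 1) = 0" "Im z * of_int (Polynomial.coeff r 1) = 0"
      by (simp_all add: complex_eq_iff)
    then have "Polynomial.coeff r 1 = 0" using z(2) by simp
    moreover from this have "Polynomial.coeff r 0 = 0" using e(1) by simp
    ultimately show False using rc \<open>r \<noteq> 0\<close> by simp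
  qed
  then have eq: "Polynomial.smult E p = q * g" using eq by simp
  have "Polynomial.content p dvd 1" using content_dvd_coeff[of p "degree p"] p(2) by simp
  then have "Polynomial.content p = 1" by (metis is_unit_normalize normalize_content)
  then have "Polynomial.content (Polynomial.smult E p) = \<bar>E\<bar>" by simp
  then have "Polynomial.content g = \<bar>E\<bar>" unfolding eq content_mult q(3) by simp
  then have "E dvd lead_coeff g" using content_dvd_coeff[of g "degree g"] by simp
  then obtain u where u: "lead_coeff g = E * u" by blast
  have "E \<noteq> 0" using \<open>q \<noteq> 0\<close> by (simp add: E_def e_def)
  have "lead_coeff (Polynomial.smult E p) = lead_coeff q * lead_coeff g"
    unfolding eq by (rule lead_coeff_mult)
  moreover have "lead_coeff (Polynomial.smult E p) = E * lead_coeff p" by (rule lead_coeff_smult)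
  ultimately have "E = e * (E * u)" unfolding p(2) u e_def by (simp only: mult_1_right)
  then have "e * u = 1" using \<open>E \<noteq> 0\<close> by simp
  then have "e dvd 1" by (metis dvd_triv_left)
  then show ?thesis by (simp add: e_def)
qed

text \<open>
  Clearing denominators in the minimal polynomial and dividing by the content gives a primitive
  integer polynomial; as its leading coefficient is \<open>\<plusminus>1\<close>, no denominators were there.
\<close>

lemma algebraic_int_trace_norm_int:
  fixes z :: complex and t n :: rat
  assumes z: "algebraic_int z" "Im z \<noteq> 0" and eq: "z * z - of_rat t * z + of_rat n = 0"
  shows "t \<in> \<int>" "n \<in> \<int>"
proof -
  obtain t1 t2 where t: "t = Rat.Fract t1 t2" "t2 > 0" by (cases t) auto
  obtain n1 n2 where n: "n = Rat.Fract n1 n2" "n2 > 0" by (cases n) auto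
  define m where "m = t2 * n2"
  define Q where "Q = [:n1 * t2, - (t1 * n2), m:]"
  have m: "m > 0" using t n by (simp add: m_def)
  have tm: "of_int m * t = of_int (t1 * n2)" and nm: "of_int m * n = of_int (n1 * t2)"
    using t n by (simp_all add: m_def Fract_of_int_quotient)
  have "Q \<noteq> 0" using m by (simp add: Q_def)
  define q where "q = primitive_part Q"
  define c where "c = Polynomial.content Q"
  have cq: "Polynomial.smult c q = Q" by (simp add: c_def q_def)
  have "c \<noteq> 0" using \<open>Q \<noteq> 0\<close> by (simp add: c_def)
  have co: "c * Polynomial.coeff q 0 = n1 * t2" "c * Polynomial.coeff q 1 = - (t1 * n2)" "c * Polynomial.coeff q 2 = m"
    using cq by (metis Q_def coeff_smult coeff_pCons_0 coeff_pCons_Suc One_nat_def numeral_2_eq_2)+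
  have "poly (map_poly of_int Q) z = of_int (n1 * t2) - of_int (t1 * n2) * z + of_int m * (z * z)"
    unfolding Q_def by (simp add: map_poly_pCons algebra_simps)
  also have "of_int (n1 * t2) = of_int m * (of_rat n :: complex)"
    using nm by (metis of_rat_mult of_rat_of_int_eq)
  also have "of_int (t1 * n2) = of_int m * (of_rat t :: complex)"
    using tm by (metis of_rat_mult of_rat_of_int_eq)
  also have "of_int m * of_rat n - of_int m * of_rat t * z + of_int m * (z * z)
      = of_int m * (z * z - of_rat t * z + of_rat n)"
    by (simp add: algebra_simps)
  finally have "poly (map_poly of_int (Polynomial.smult c q)) z = 0" unfolding cq eq by simp
  then have "poly (map_poly of_int q) z = 0" using \<open>c \<noteq> 0\<close> by (simp add: poly_of_int_smult)
  moreover have dq: "degree q = 2" using m by (simp add: q_def Q_def)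
  moreover have "Polynomial.content q = 1" using \<open>Q \<noteq> 0\<close> by (simp add: q_def)
  ultimately have "\<bar>lead_coeff q\<bar> = 1" using primitive_quadratic_monic z by blast
  then have e: "Polynomial.coeff q 2 = 1 \<or> Polynomial.coeff q 2 = -1" using dq by auto
  then have mc: "m = c \<or> m = - c" using co(3) by auto
  have "of_int m * t = of_int m * of_int (if m = c then - Polynomial.coeff q 1 else Polynomial.coeff q 1)"
    unfolding tm of_int_mult[symmetric] using mc co(2) by (cases "m = c") auto
  then show "t \<in> \<int>" using m by (metis Ints_of_int mult_cancel_left of_int_eq_0_iff less_irrefl)
  have "of_int m * n = of_int m * of_int (if m = c then Polynomial.coeff q 0 else - Polynomial.coeff q 0)"
    unfolding nm of_int_mult[symmetric] using mc co(1) by (cases "m = c") auto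
  then show "n \<in> \<int>" using m by (metis Ints_of_int mult_cancel_left of_int_eq_0_iff less_irrefl)
qed

lemma squarefree_mult_square_int:
  fixes v :: rat
  assumes "squarefree n" "of_int n * v\<^sup>2 \<in> \<int>"
  shows "v \<in> \<int>"
proof -
  obtain x y where xy: "v = Rat.Fract x y" "y > 0" "coprime x y" by (cases v) auto
  obtain k where k: "of_int n * v\<^sup>2 = of_int k" using assms(2) by (auto elim: Ints_cases)
  have "of_int n * (of_int x)\<^sup>2 = (of_int k * (of_int y)\<^sup>2 :: rat)"
    using k xy by (simp add: Fract_of_int_quotient power_divide field_simps)
  then have "n * x\<^sup>2 = k * y\<^sup>2" by (metis of_int_eq_iff of_int_mult of_int_power)
  then have "y\<^sup>2 dvd n * x\<^sup>2" by simp
  moreover have "coprime (y\<^sup>2) (x\<^sup>2)" using xy(3) by (simp add: coprime_commute)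
  ultimately have "y\<^sup>2 dvd n" using coprime_dvd_mult_left_iff by blast
  then have "y dvd 1" using assms(1) squarefreeD by blast
  then have "y = 1" using xy(2) by simp
  then show ?thesis using xy(1) by (simp add: Fract_of_int_quotient)
qed

context odd_imaginary_discriminant
begin

abbreviation K :: "complex set" where "K \<equiv> quadratic_field D"
abbreviation OK :: "complex set" where "OK \<equiv> integers_of K"

text \<open>The norm of \<open>\<omega>\<close>.\<close>

definition c0 :: int where "c0 = (N + 1) div 4"

definition om :: complex where "om = (1 + csqrt (of_int D)) / 2"

lemma N_ge: "N \<ge> 7" using N_gt N_mod_4 by presburger

lemma c0_eq: "4 * c0 = N + 1" by (simp add: c0_def four_c)

lemma nrm_c0: "nrm x = x\<^sup>2 + x + c0" by (simp add: nrm_def c0_def)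

lemma csqrt_D: "csqrt (of_int D) = \<i> * of_real (sqrt (of_int N))"
  using N_gt by (subst csqrt_of_real_nonpos) (auto simp: N_def)

lemma csqrt_D_sq: "csqrt (of_int D) * csqrt (of_int D) = - of_int N"
  by (metis N_def of_int_minus minus_minus power2_csqrt power2_eq_square)

lemma om_eq: "csqrt (of_int D) = 2 * om - 1"
  unfolding om_def by (simp add: field_simps)

lemma om_Im: "Im om > 0"
  using N_gt by (simp add: om_def csqrt_D)

lemma om_sq: "om * om = om - of_int c0"
proof -
  have "(2 * om - 1) * (2 * om - 1) = - of_int N"
    using csqrt_D_sq unfolding om_eq .
  also have "of_int N = 4 * (of_int c0 :: complex) - 1"
    using c0_eq by (metis add_diff_cancel_right' of_int_diff of_int_mult of_int_numeral of_int_1)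
  finally have "4 * (om * om) = 4 * (om - of_int c0)" by (simp add: algebra_simps)
  then show ?thesis by (simp only: mult_cancel_left) simp
qed

lemma cnj_om: "cnj om = 1 - om"
  by (simp add: om_def csqrt_D complex_eq_iff)

lemma of_int_om_eq_iff: "of_int x + of_int y * om = of_int x' + of_int y' * om \<longleftrightarrow> x = x' \<and> y = y'"
proof
  assume eq: "of_int x + of_int y * om = of_int x' + of_int y' * om"
  have "of_int y * Im om = of_int y' * Im om" using arg_cong[OF eq, of Im] by simp
  then have "y = y'" using om_Im by simp
  then show "x = x' \<and> y = y'" using eq by simp
qed auto

lemma K_iff: "z \<in> K \<longleftrightarrow> (\<exists>a b. z = of_rat a + of_rat b * om)"
proof
  assume "z \<in> K"
  then obtain a b where "z = of_rat a + of_rat b * csqrt (of_int D)" by (auto simp: quadratic_field_def)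
  then have "z = of_rat (a - b) + of_rat (2 * b) * om"
    unfolding om_eq by (simp add: of_rat_diff of_rat_mult algebra_simps)
  then show "\<exists>a b. z = of_rat a + of_rat b * om" by blast
next
  assume "\<exists>a b. z = of_rat a + of_rat b * om"
  then obtain a b where "z = of_rat a + of_rat b * om" by blast
  then have "z = of_rat (a + b / 2) + of_rat (b / 2) * csqrt (of_int D)"
    unfolding om_def by (simp add: of_rat_add of_rat_divide algebra_simps add_divide_distrib)
  then show "z \<in> K" unfolding quadratic_field_def by blast
qed

lemma K_of_int [simp]: "of_int x \<in> K"
  unfolding K_iff by (rule exI[of _ "of_int x"], rule exI[of _ 0]) simp

lemma K_mult:
  assumes "x \<in> K" "y \<in> K"
  shows "x * y \<in> K"
proof -
  obtain a b c d where "x = of_rat a + of_rat b * om" "y = of_rat c + of_rat d * om"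
    using assms unfolding K_iff by blast
  then have "x * y = of_rat a * of_rat c + (of_rat a * of_rat d + of_rat b * of_rat c) * om
      + of_rat b * of_rat d * (om * om)"
    by (simp add: algebra_simps)
  also have "\<dots> = of_rat (a * c - b * d * of_int c0) + of_rat (a * d + b * c + b * d) * om"
    unfolding om_sq by (simp add: of_rat_mult of_rat_add of_rat_diff algebra_simps)
  finally show ?thesis unfolding K_iff by blast
qed

lemma K_inverse:
  assumes "x \<in> K"
  shows "inverse x \<in> K"
proof (cases "x = 0")
  case False
  obtain a b where x: "x = of_rat a + of_rat b * om" using assms unfolding K_iff by blast
  define y where "y = of_rat (a + b) - of_rat b * om"
  define n where "n = a * a + a * b + b * b * of_int c0"
  have "x * y = of_rat a * of_rat a + of_rat a * of_rat b + of_rat b * of_rat b * om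
      - of_rat b * of_rat b * (om * om)"
    by (simp add: x y_def of_rat_add algebra_simps)
  also have "\<dots> = of_rat n"
    unfolding om_sq n_def by (simp add: of_rat_add of_rat_mult algebra_simps)
  finally have xy: "x * y = of_rat n" .
  have "y \<noteq> 0"
  proof
    assume "y = 0"
    then have "of_rat (a + b) - of_rat b * om = 0" by (simp add: y_def)
    then have "Im (of_real (of_rat (a + b)) - of_real (of_rat b) * om) = 0"
      by (simp only: of_real_of_rat complex.sel zero_complex.sel)
    then have "of_rat b * Im om = 0" by simp
    then have "b = 0" using om_Im by simp
    then have "a = 0" using \<open>y = 0\<close> by (simp add: y_def)
    then show False using False x \<open>b = 0\<close> by simp
  qed
  then have "n \<noteq> 0" using xy False by (metis mult_eq_0_iff of_rat_0)
  then have "x * (y * of_rat (1 / n)) = 1"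
    using xy by (simp add: mult.assoc[symmetric] of_rat_divide)
  then have "inverse x = y * of_rat (1 / n)" by (rule inverse_unique)
  also have "\<dots> = of_rat ((a + b) / n) + of_rat (- b / n) * om"
    by (simp add: y_def of_rat_divide of_rat_minus algebra_simps diff_divide_distrib)
  finally show ?thesis unfolding K_iff by blast
qed (use K_of_int[of 0] in simp)

lemma K_divide: "x \<in> K \<Longrightarrow> y \<in> K \<Longrightarrow> x / y \<in> K"
  by (simp add: divide_inverse K_mult K_inverse)

text \<open>
  For an algebraic integer \<open>a + b \<surd>D\<close> the trace \<open>u = 2 a\<close> is an integer; as \<open>N\<close> is squarefree,
  integrality of the norm makes \<open>v = 2 b\<close> an integer, and \<open>u\<^sup>2 + N v\<^sup>2\<close> is divisible by \<open>4\<close> only if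
  \<open>u\<close> and \<open>v\<close> have the same parity.
\<close>

lemma integral_basis: "OK = {of_int x + of_int y * om | x y. True}"
proof (intro equalityI subsetI)
  fix z assume "z \<in> {of_int x + of_int y * om | x y. True}"
  then obtain x y where z: "z = of_int x + of_int y * om" by blast
  have "z \<in> K" unfolding K_iff z
    by (rule exI[of _ "of_int x"], rule exI[of _ "of_int y"]) simp
  moreover have "algebraic_int z"
  proof (rule algebraic_int_quadratic[of _ "2 * x + y" "x * x + x * y + y * y * c0"])
    have "z * z - of_int (2 * x + y) * z + of_int (x * x + x * y + y * y * c0)
      = of_int (y * y) * (om * om - (om - of_int c0))"
      by (simp add: z algebra_simps)
    then show "z * z - of_int (2 * x + y) * z + of_int (x * x + x * y + y * y * c0) = 0"
      by (simp add: om_sq)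
  qed
  ultimately show "z \<in> OK" by (simp add: integers_of_def)
next
  fix z assume "z \<in> OK"
  then have zK: "z \<in> K" and za: "algebraic_int z" by (simp_all add: integers_of_def)
  obtain a b where z: "z = of_rat a + of_rat b * csqrt (of_int D)"
    using zK by (auto simp: quadratic_field_def)
  define s where "s = csqrt (of_int D)"
  show "z \<in> {of_int x + of_int y * om | x y. True}"
  proof (cases "b = 0")
    case True
    then have "z = of_rat a" using z by simp
    then have "z \<in> \<int>" using za rational_algebraic_int_is_int by (metis Rats_of_rat)
    then obtain x where "z = of_int x + of_int 0 * om" by (auto elim: Ints_cases)
    then show ?thesis by blast
  next
    case False
    have "Im z = of_rat b * sqrt (of_int N)"
    proof -
      have "z = of_real (of_rat a) + of_real (of_rat b) * (\<i> * of_real (sqrt (of_int N)))"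
        using z by (simp add: csqrt_D of_real_of_rat)
      then show ?thesis by simp
    qed
    then have Im: "Im z \<noteq> 0" using False N_gt by simp
    have "z * z - of_rat (2 * a) * z + of_rat (a\<^sup>2 + of_int N * b\<^sup>2)
      = of_rat b * of_rat b * (s * s + of_int N)"
      unfolding z s_def[symmetric] by (simp add: of_rat_mult of_rat_add of_rat_power power2_eq_square algebra_simps)
    also have "\<dots> = 0" using csqrt_D_sq by (simp add: s_def)
    finally have "z * z - of_rat (2 * a) * z + of_rat (a\<^sup>2 + of_int N * b\<^sup>2) = 0" .
    from algebraic_int_trace_norm_int[OF za Im this]
    obtain u n where u: "2 * a = of_int u" and n: "a\<^sup>2 + of_int N * b\<^sup>2 = of_int n"
      by (auto elim!: Ints_cases)
    have "of_int N * (2 * b)\<^sup>2 = 4 * (a\<^sup>2 + of_int N * b\<^sup>2) - (2 * a)\<^sup>2"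
      by (simp add: power2_eq_square algebra_simps)
    also have "\<dots> = of_int (4 * n - u\<^sup>2)" unfolding n u by simp
    finally have Nb: "of_int N * (2 * b)\<^sup>2 = of_int (4 * n - u\<^sup>2)" .
    then have "of_int N * (2 * b)\<^sup>2 \<in> \<int>" by simp
    then have "2 * b \<in> \<int>"
      by (rule squarefree_mult_square_int[rotated]) (use D_squarefree in \<open>simp add: N_def\<close>)
    then obtain v where v: "2 * b = of_int v" by (auto elim: Ints_cases)
    have Nv: "N * v\<^sup>2 = 4 * n - u\<^sup>2" using Nb unfolding v by (metis of_int_eq_iff of_int_mult of_int_power)
    have "even (u - v)"
    proof -
      have "even (N * v\<^sup>2 + u\<^sup>2)" using Nv by simp
      then show ?thesis using N_odd by simp
    qed
    then obtain k where k: "u - v = 2 * k" by blast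
    have "2 * z = of_rat (2 * a) + of_rat (2 * b) * (2 * om - 1)"
      unfolding z om_eq[symmetric] by (simp add: of_rat_mult algebra_simps)
    also have "\<dots> = of_int u + of_int v * (2 * om - 1)" unfolding u v by simp
    also have "\<dots> = 2 * (of_int k + of_int v * om)"
    proof -
      have "u = v + 2 * k" using k by simp
      then show ?thesis by (simp add: algebra_simps)
    qed
    finally have "z = of_int k + of_int v * om" by (simp only: mult_cancel_left) simp
    then show ?thesis by blast
  qed
qed

lemma OK_iff: "z \<in> OK \<longleftrightarrow> (\<exists>x y. z = of_int x + of_int y * om)"
  unfolding integral_basis by blast

lemma OK_I: "of_int x + of_int y * om \<in> OK"
  unfolding OK_iff by blast

lemma OK_of_int [simp]: "of_int x \<in> OK"
  using OK_I[of x 0] by simp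

lemma OK_0 [simp]: "0 \<in> OK" and OK_1 [simp]: "1 \<in> OK" and OK_om [simp]: "om \<in> OK"
  using OK_I[of 0 0] OK_I[of 1 0] OK_I[of 0 1] by simp_all

lemma OK_add: "x \<in> OK \<Longrightarrow> y \<in> OK \<Longrightarrow> x + y \<in> OK"
proof -
  assume "x \<in> OK" "y \<in> OK"
  then obtain a b c d where "x = of_int a + of_int b * om" "y = of_int c + of_int d * om"
    unfolding OK_iff by blast
  then have "x + y = of_int (a + c) + of_int (b + d) * om" by (simp add: algebra_simps)
  then show ?thesis using OK_I by metis
qed

lemma OK_mult: "x \<in> OK \<Longrightarrow> y \<in> OK \<Longrightarrow> x * y \<in> OK"
proof -
  assume "x \<in> OK" "y \<in> OK"
  then obtain a b c d where xy: "x = of_int a + of_int b * om" "y = of_int c + of_int d * om"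
    unfolding OK_iff by blast
  have "x * y = of_int a * of_int c + of_int (a * d + b * c) * om + of_int (b * d) * (om * om)"
    unfolding xy by (simp add: algebra_simps)
  also have "\<dots> = of_int (a * c - b * d * c0) + of_int (a * d + b * c + b * d) * om"
    unfolding om_sq by (simp add: algebra_simps)
  finally show ?thesis using OK_I by metis
qed

lemma OK_minus: "x \<in> OK \<Longrightarrow> - x \<in> OK"
  using OK_mult[of "-1" x] OK_of_int[of "-1"] by simp

lemma OK_subset_K: "OK \<subseteq> K"
  by (auto simp: integers_of_def)

lemma mult_cnj_om: "(of_int x + of_int y * om) * cnj (of_int x + of_int y * om) = of_int (x\<^sup>2 + x * y + c0 * y\<^sup>2)"
proof -
  have "(of_int x + of_int y * om) * cnj (of_int x + of_int y * om)
    = of_int x * of_int x + of_int x * of_int y + of_int y * of_int y * (om - om * om)"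
    by (simp add: cnj_om algebra_simps)
  then show ?thesis by (simp add: om_sq power2_eq_square algebra_simps)
qed

lemma cnj_OK: "z \<in> OK \<Longrightarrow> cnj z \<in> OK"
proof -
  assume "z \<in> OK"
  then obtain a b where "z = of_int a + of_int b * om" unfolding OK_iff by blast
  then have "cnj z = of_int (a + b) + of_int (- b) * om" by (simp add: cnj_om algebra_simps)
  then show ?thesis using OK_I by metis
qed

text \<open>
  A unit \<open>x + y \<omega>\<close> has norm \<open>1\<close>, that is \<open>(2 x + y)\<^sup>2 + N y\<^sup>2 = 4\<close>, which forces \<open>y = 0\<close> as \<open>N > 4\<close>.
\<close>

lemma units_OK:
  assumes "u \<in> OK" "inverse u \<in> OK" "u \<noteq> 0"
  shows "u = 1 \<or> u = -1"
proof -
  obtain x y where u: "u = of_int x + of_int y * om" using assms(1) unfolding OK_iff by blast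
  obtain x' y' where u': "inverse u = of_int x' + of_int y' * om" using assms(2) unfolding OK_iff by blast
  define n where "n = x\<^sup>2 + x * y + c0 * y\<^sup>2"
  define n' where "n' = x'\<^sup>2 + x' * y' + c0 * y'\<^sup>2"
  have "u * cnj u = of_int n" unfolding u mult_cnj_om n_def by (rule refl)
  moreover have "inverse u * cnj (inverse u) = of_int n'" unfolding u' mult_cnj_om n'_def by (rule refl)
  moreover have "(u * cnj u) * (inverse u * cnj (inverse u)) = 1"
    using assms(3) by (simp add: field_simps)
  ultimately have "of_int (n * n') = (1 :: complex)" by simp
  then have "n * n' = 1" by (metis of_int_eq_1_iff)
  moreover have four: "4 * n = (2 * x + y)\<^sup>2 + N * y\<^sup>2"
  proof -
    have "4 * n = (2 * x + y)\<^sup>2 + (4 * c0 - 1) * y\<^sup>2"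
      by (simp add: n_def power2_eq_square algebra_simps)
    then show ?thesis by (simp add: c0_eq)
  qed
  moreover have "n \<ge> 0"
  proof -
    have "4 * n \<ge> 0" unfolding four using N_ge by simp
    then show ?thesis by simp
  qed
  ultimately have "n = 1" by (simp add: pos_zmult_eq_1_iff_lemma zmult_eq_1_iff)
  have "y = 0"
  proof (rule ccontr)
    assume "y \<noteq> 0"
    then have "1 \<le> y\<^sup>2" by (metis int_one_le_iff_zero_less zero_less_power2)
    then have "N * 1 \<le> N * y\<^sup>2" using N_ge by (intro mult_left_mono) auto
    moreover have "0 \<le> (2 * x + y)\<^sup>2" by simp
    ultimately show False using four \<open>n = 1\<close> N_ge by linarith
  qed
  then have "x\<^sup>2 = 1" using \<open>n = 1\<close> by (simp add: n_def)
  then have "x = 1 \<or> x = -1" by (simp add: power2_eq_1_iff)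
  then show ?thesis using u \<open>y = 0\<close> by auto
qed

end


section \<open>Ideals as lattices\<close>

definition zlat :: "complex \<Rightarrow> complex \<Rightarrow> complex set" where
  "zlat u v = {of_int x * u + of_int y * v | x y. True}"

lemma zlat_mem: "of_int x * u + of_int y * v \<in> zlat u v"
  unfolding zlat_def by blast

lemma zlat_fst: "u \<in> zlat u v" and zlat_snd: "v \<in> zlat u v"
  using zlat_mem[of 1 u 0 v] zlat_mem[of 0 u 1 v] by simp_all

lemma zlat_scale: "(\<lambda>x. c * x) ` zlat u v = zlat (c * u) (c * v)"
proof -
  have "(\<lambda>x. c * x) ` zlat u v = {c * (of_int x * u + of_int y * v) | x y. True}"
    unfolding zlat_def by blast
  also have "\<dots> = zlat (c * u) (c * v)"
    unfolding zlat_def by (simp add: algebra_simps)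
  finally show ?thesis .
qed

lemma zlat_subset:
  assumes "u' \<in> zlat u v" "v' \<in> zlat u v"
  shows "zlat u' v' \<subseteq> zlat u v"
proof
  fix z assume "z \<in> zlat u' v'"
  then obtain x y where z: "z = of_int x * u' + of_int y * v'" by (auto simp: zlat_def)
  obtain a b c d where "u' = of_int a * u + of_int b * v" "v' = of_int c * u + of_int d * v"
    using assms by (auto simp: zlat_def)
  then have "z = of_int (x * a + y * c) * u + of_int (x * b + y * d) * v"
    unfolding z by (simp add: algebra_simps)
  then show "z \<in> zlat u v" using zlat_mem by metis
qed

lemma zlat_shift: "zlat u (v + of_int k * u) = zlat u v"
proof (intro equalityI zlat_subset zlat_fst)
  show "v + of_int k * u \<in> zlat u v" using zlat_mem[of k u 1 v] by (simp add: add.commute)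
  show "v \<in> zlat u (v + of_int k * u)" using zlat_mem[of "- k" u 1 "v + of_int k * u"] by simp
qed

lemma zlat_commute: "zlat u v = zlat v u"
  by (intro equalityI zlat_subset zlat_fst zlat_snd)

lemma zlat_minus: "zlat u (- v) = zlat u v"
proof (intro equalityI zlat_subset zlat_fst)
  show "- v \<in> zlat u v" using zlat_mem[of 0 u "- 1" v] by simp
  show "v \<in> zlat u (- v)" using zlat_mem[of 0 u "- 1" "- v"] by simp
qed

lemma zlat_area_multiple:
  assumes "zlat u' v' \<subseteq> zlat u v"
  shows "\<exists>k :: int. Im (cnj u' * v') = of_int k * Im (cnj u * v)"
proof -
  obtain a b c d where "u' = of_int a * u + of_int b * v" "v' = of_int c * u + of_int d * v"
    using assms zlat_fst[of u' v'] zlat_snd[of v' u'] by (fastforce simp: zlat_def)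
  then have "Im (cnj u' * v') = of_int (a * d - b * c) * Im (cnj u * v)"
    by (simp add: algebra_simps)
  then show ?thesis by blast
qed

text \<open>Two bases of a lattice differ by an integer matrix of determinant \<open>\<plusminus>1\<close>.\<close>

lemma zlat_area_unique:
  assumes "zlat u v = zlat u' v'"
  shows "\<bar>Im (cnj u * v)\<bar> = \<bar>Im (cnj u' * v')\<bar>"
proof -
  obtain k where k: "Im (cnj u' * v') = of_int k * Im (cnj u * v)"
    using zlat_area_multiple[of u' v' u v] assms by auto
  obtain l where l: "Im (cnj u * v) = of_int l * Im (cnj u' * v')"
    using zlat_area_multiple[of u v u' v'] assms by auto
  show ?thesis
  proof (cases "Im (cnj u * v) = 0")
    case False
    have "Im (cnj u * v) * of_int (l * k) = Im (cnj u * v) * 1" using k l by (metis mult.assoc mult.commute mult.right_neutral of_int_mult)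
    then have "real_of_int (l * k) = 1" using False by (simp only: mult_cancel_left) simp
    then have "l * k = 1" by linarith
    then have "\<bar>k\<bar> = 1" by (metis abs_1 abs_mult abs_zmult_eq_1 mult.commute)
    then show ?thesis unfolding k by (simp add: abs_mult) (metis of_int_1 of_int_abs mult_1)
  next
    case True
    then show ?thesis by (simp only: k mult_zero_right)
  qed
qed

lemma int_subgroup_principal:
  fixes S :: "int set"
  assumes "0 \<in> S" "\<And>x y. x \<in> S \<Longrightarrow> y \<in> S \<Longrightarrow> x - y \<in> S" "\<exists>x \<in> S. x \<noteq> 0"
  obtains g where "g > 0" "\<And>x. x \<in> S \<longleftrightarrow> int g dvd x"
proof -
  have neg: "- x \<in> S" if "x \<in> S" for x using assms(2)[OF assms(1) that] by simp
  have add: "x + y \<in> S" if "x \<in> S" "y \<in> S" for x y using assms(2)[OF that(1) neg[OF that(2)]] by simp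
  have natmul: "int n * x \<in> S" if "x \<in> S" for n x
    using that by (induction n) (auto simp: assms(1) algebra_simps add)
  have mul: "k * x \<in> S" if "x \<in> S" for k x
    using natmul[OF that, of "nat k"] natmul[OF neg[OF that], of "nat (- k)"] by (cases "k \<ge> 0") auto
  obtain x where x: "x \<in> S" "x \<noteq> 0" using assms(3) by blast
  then have "\<exists>n. n > 0 \<and> int n \<in> S"
    using neg[of x] by (intro exI[of _ "nat \<bar>x\<bar>"]) (auto simp: abs_if)
  define g where "g = (LEAST n. n > 0 \<and> int n \<in> S)"
  have g: "g > 0" "int g \<in> S" using LeastI_ex[OF \<open>\<exists>n. n > 0 \<and> int n \<in> S\<close>] by (auto simp: g_def)
  have least: "g \<le> n" if "n > 0" "int n \<in> S" for n unfolding g_def using that by (intro Least_le) auto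
  show ?thesis
  proof (rule that[OF g(1)])
    fix x
    show "x \<in> S \<longleftrightarrow> int g dvd x"
    proof
      assume "x \<in> S"
      then have "x - (x div int g) * int g \<in> S" using assms(2) mul[OF g(2)] by blast
      then have m: "x mod int g \<in> S" by (simp add: minus_div_mult_eq_mod)
      have b: "0 \<le> x mod int g" "x mod int g < int g" using g(1) by simp_all
      have "x mod int g = 0"
      proof (rule ccontr)
        assume "x mod int g \<noteq> 0"
        then have "g \<le> nat (x mod int g)" using b m by (intro least) auto
        then show False using b by linarith
      qed
      then show "int g dvd x" by (simp add: dvd_eq_mod_eq_0)
    next
      assume "int g dvd x"
      then show "x \<in> S" using mul[OF g(2)] by (auto simp: dvd_def mult.commute)
    qed
  qed
qed

context odd_imaginary_discriminant
begin

definition is_OK_module :: "complex set \<Rightarrow> bool" where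
  "is_OK_module J \<longleftrightarrow> 0 \<in> J \<and> (\<forall>x\<in>J. \<forall>y\<in>J. x - y \<in> J) \<and> (\<forall>r\<in>OK. \<forall>x\<in>J. r * x \<in> J)"

fun triple_ideal :: "nat \<times> nat \<times> int \<Rightarrow> complex set" where
  "triple_ideal (m, a, b) = zlat (of_nat m * of_nat a) (of_nat m * (of_int b + om))"

lemma is_OK_module_scale:
  assumes "is_OK_module J"
  shows "is_OK_module ((\<lambda>x. c * x) ` J)"
proof -
  have "c * x - c * y = c * (x - y)" "r * (c * x) = c * (r * x)" for x y r :: complex
    by (simp_all add: algebra_simps)
  then show ?thesis
    using assms unfolding is_OK_module_def by (auto intro!: image_eqI)
qed

lemma shifted_om_mult:
  "om * (of_int b + om) = of_int (b + 1) * (of_int b + om) - of_int (nrm b)"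
  by (simp add: nrm_c0 om_sq power2_eq_square algebra_simps)

lemma shifted_om_norm: "cnj (of_int b + om) * (of_int b + om) = of_int (nrm b)"
  using mult_cnj_om[of b 1] by (simp add: nrm_c0 algebra_simps)

lemma triple_ideal_module:
  assumes "(m, a, b) \<in> ideal_triples"
  shows "is_OK_module (triple_ideal (m, a, b))" "triple_ideal (m, a, b) \<subseteq> OK"
    "\<exists>x \<in> triple_ideal (m, a, b). x \<noteq> 0"
proof -
  define u where "u = (of_nat m * of_nat a :: complex)"
  define v where "v = of_nat m * (of_int b + om)"
  have J: "triple_ideal (m, a, b) = zlat u v" by (simp add: u_def v_def)
  obtain k where k: "nrm b = int a * k"
    using assms by (auto simp: ideal_triples_def nrm_roots_def)
  have diff: "x - y \<in> zlat u v" if xy: "x \<in> zlat u v" "y \<in> zlat u v" for x y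
  proof -
    obtain a b c d where "x = of_int a * u + of_int b * v" "y = of_int c * u + of_int d * v"
      using xy by (auto simp: zlat_def)
    then have "x - y = of_int (a - c) * u + of_int (b - d) * v" by (simp add: algebra_simps)
    then show ?thesis using zlat_mem by metis
  qed
  have ou: "om * u = of_int (- b) * u + of_int (int a) * v"
    by (simp add: u_def v_def algebra_simps)
  have ov: "om * v = of_int (- k) * u + of_int (b + 1) * v"
  proof -
    have "om * v = of_nat m * (om * (of_int b + om))" by (simp add: v_def)
    also have "\<dots> = of_int (b + 1) * v - of_nat m * of_int (nrm b)"
      unfolding shifted_om_mult by (simp add: v_def algebra_simps)
    also have "\<dots> = of_int (- k) * u + of_int (b + 1) * v" unfolding k by (simp add: u_def)
    finally show ?thesis .
  qed
  have "r * x \<in> zlat u v" if r: "r \<in> OK" and x: "x \<in> zlat u v" for r x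
  proof -
    obtain p q where rq: "r = of_int p + of_int q * om" using r unfolding OK_iff by blast
    obtain c d where xx: "x = of_int c * u + of_int d * v" using x by (auto simp: zlat_def)
    have "r * x = of_int p * x + of_int q * (of_int c * (om * u) + of_int d * (om * v))"
      unfolding rq xx by (simp add: algebra_simps)
    also have "\<dots> = of_int (p * c + q * (c * - b + d * - k)) * u + of_int (p * d + q * (c * int a + d * (b + 1))) * v"
      unfolding ou ov xx by (simp add: algebra_simps)
    finally show ?thesis using zlat_mem by metis
  qed
  moreover have "0 \<in> zlat u v" using zlat_mem[of 0 u 0 v] by simp
  ultimately show "is_OK_module (triple_ideal (m, a, b))" unfolding J is_OK_module_def using diff by blast
  have "u \<in> OK" "v \<in> OK"
    using OK_of_int[of "int m * int a"] OK_mult[OF OK_of_int[of "int m"] OK_I[of b 1]] by (simp_all add: u_def v_def)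
  then show "triple_ideal (m, a, b) \<subseteq> OK"
    unfolding J zlat_def by (auto intro!: OK_add OK_mult)
  have "u \<noteq> 0" using assms by (simp add: u_def ideal_triples_def)
  then show "\<exists>x \<in> triple_ideal (m, a, b). x \<noteq> 0" unfolding J using zlat_fst by blast
qed

text \<open>
  The Hermite normal form of an ideal: \<open>m\<close> generates the ideal of \<open>\<omega>\<close>-coordinates, \<open>m a\<close> generates
  the intersection with \<open>\<int>\<close>, and closure under multiplication by \<open>\<omega>\<close> forces the divisibilities.
\<close>

lemma module_is_triple_ideal:
  assumes J: "is_OK_module J" "J \<subseteq> OK" and nz: "\<exists>x \<in> J. x \<noteq> 0"
  obtains T where "T \<in> ideal_triples" "J = triple_ideal T"
proof -
  have J0: "0 \<in> J" and Jdiff: "\<And>x y. x \<in> J \<Longrightarrow> y \<in> J \<Longrightarrow> x - y \<in> J"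
    and Jmult: "\<And>r x. r \<in> OK \<Longrightarrow> x \<in> J \<Longrightarrow> r * x \<in> J"
    using J(1) by (auto simp: is_OK_module_def)
  have Jadd: "x + y \<in> J" if "x \<in> J" "y \<in> J" for x y
    using Jdiff[OF that(1) Jdiff[OF J0 that(2)]] by simp
  define S1 where "S1 = {y. \<exists>x. of_int x + of_int y * om \<in> J}"
  define S2 where "S2 = {n. of_int n \<in> J}"
  obtain z where z: "z \<in> J" "z \<noteq> 0" using nz by blast
  have "\<exists>n \<in> S2. n \<noteq> 0"
  proof -
    obtain x y where xy: "z = of_int x + of_int y * om" using z J(2) OK_iff by blast
    have "cnj z * z \<in> J" using z J(2) cnj_OK Jmult by blast
    moreover define n where "n = x\<^sup>2 + x * y + c0 * y\<^sup>2"
    have n: "cnj z * z = of_int n"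
      using mult_cnj_om[of x y] unfolding xy n_def by (simp only: mult.commute)
    moreover have "cnj z * z \<noteq> 0" using z(2) by simp
    ultimately show ?thesis unfolding S2_def n by (intro bexI[of _ n]) auto
  qed
  moreover have "0 \<in> S2" using J0 by (simp add: S2_def)
  moreover have "x - y \<in> S2" if "x \<in> S2" "y \<in> S2" for x y
    using that Jdiff by (simp add: S2_def)
  ultimately obtain n where n: "n > 0" "\<And>x. x \<in> S2 \<longleftrightarrow> int n dvd x"
    using int_subgroup_principal[of S2] by metis
  have S21: "x \<in> S1" if "x \<in> S2" for x
  proof -
    have "om * of_int x \<in> J" using that Jmult by (simp add: S2_def)
    then have "of_int 0 + of_int x * om \<in> J" by (simp add: mult.commute)
    then show ?thesis unfolding S1_def by blast
  qed
  have "\<exists>n \<in> S1. n \<noteq> 0" using \<open>\<exists>n \<in> S2. n \<noteq> 0\<close> S21 by blast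
  moreover have "0 \<in> S1" using S21 \<open>0 \<in> S2\<close> by blast
  moreover have "x - y \<in> S1" if xy: "x \<in> S1" "y \<in> S1" for x y
  proof -
    obtain p q where "of_int p + of_int x * om \<in> J" "of_int q + of_int y * om \<in> J"
      using xy by (auto simp: S1_def)
    then have "(of_int p + of_int x * om) - (of_int q + of_int y * om) \<in> J" by (rule Jdiff)
    moreover have "(of_int p + of_int x * om) - (of_int q + of_int y * om) = of_int (p - q) + of_int (x - y) * om"
      by (simp add: algebra_simps)
    ultimately have "of_int (p - q) + of_int (x - y) * om \<in> J" by (simp only:)
    then show ?thesis unfolding S1_def by blast
  qed
  ultimately obtain m where m: "m > 0" "\<And>x. x \<in> S1 \<longleftrightarrow> int m dvd x"
    using int_subgroup_principal[of S1] by metis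
  have "int n \<in> S2" using n(2) by simp
  then have "int m dvd int n" using S21 m(2) by blast
  then obtain a where a: "n = m * a" by auto
  have "a > 0" using a n(1) by (cases a) auto
  have "int m \<in> S1" using m(2) by simp
  then obtain u where u: "of_int u + of_int (int m) * om \<in> J" by (auto simp: S1_def)
  have "om * (of_int u + of_int (int m) * om) \<in> J" using u Jmult by simp
  moreover have "om * (of_int u + of_int (int m) * om) = of_int (- (int m * c0)) + of_int (u + int m) * om"
  proof -
    have "om * (of_int u + of_int (int m) * om) = of_int u * om + of_int (int m) * (om * om)"
      by (simp add: algebra_simps)
    then show ?thesis unfolding om_sq by (simp add: algebra_simps)
  qed
  ultimately have "of_int (- (int m * c0)) + of_int (u + int m) * om \<in> J" by (simp only:)
  then have "u + int m \<in> S1" unfolding S1_def by blast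
  then have "int m dvd u" unfolding m(2) by simp
  then obtain b0 where b0: "u = int m * b0" by blast
  have vJ: "of_nat m * (of_int b0 + om) \<in> J" using u unfolding b0 by (simp add: algebra_simps)
  have uJ: "of_nat m * of_nat a \<in> J" using \<open>int n \<in> S2\<close> a by (simp add: S2_def)
  define b where "b = b0 mod int a"
  have vJ': "of_nat m * (of_int b + om) \<in> J"
  proof -
    obtain k where k: "b0 = b + int a * k"
      unfolding b_def using mod_mult_div_eq[of b0 "int a"] by metis
    have "of_nat m * (of_int b + om) = of_nat m * (of_int b0 + om) - of_int k * (of_nat m * of_nat a)"
      unfolding k by (simp add: algebra_simps)
    then show ?thesis using vJ Jmult[OF OK_of_int uJ] Jdiff by simp
  qed
  have "int a dvd nrm b0"
  proof -
    have "cnj (of_int b0 + om) \<in> OK" using OK_I[of b0 1] by (intro cnj_OK) simp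
    then have "cnj (of_int b0 + om) * (of_nat m * (of_int b0 + om)) \<in> J" using vJ Jmult by blast
    moreover have "cnj (of_int b0 + om) * (of_nat m * (of_int b0 + om)) = of_int (int m * nrm b0)"
      unfolding mult.left_commute[of "cnj _"] shifted_om_norm by simp
    ultimately have "of_int (int m * nrm b0) \<in> J" by (simp only:)
    then have "int m * nrm b0 \<in> S2" by (simp only: S2_def mem_Collect_eq)
    then have "int m * int a dvd int m * nrm b0" unfolding n(2) a by simp
    then show ?thesis using m(1) by simp
  qed
  then have T: "(m, a, b) \<in> ideal_triples"
    using m(1) \<open>a > 0\<close> by (simp add: ideal_triples_def nrm_roots_def b_def dvd_nrm_mod)
  moreover have "J = triple_ideal (m, a, b)"
  proof (intro equalityI subsetI)
    fix z assume "z \<in> triple_ideal (m, a, b)"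
    then obtain x y where "z = of_int x * (of_nat m * of_nat a) + of_int y * (of_nat m * (of_int b + om))"
      by (auto simp: zlat_def)
    then show "z \<in> J" using Jadd Jmult[OF OK_of_int uJ] Jmult[OF OK_of_int vJ'] by simp
  next
    fix z assume zJ: "z \<in> J"
    then obtain x y where z: "z = of_int x + of_int y * om" using J(2) OK_iff by blast
    have "y \<in> S1" using zJ z by (auto simp: S1_def)
    then obtain k where k: "y = int m * k" unfolding m(2) by blast
    have "z - of_int k * (of_nat m * (of_int b + om)) \<in> J"
      using Jdiff[OF zJ Jmult[OF OK_of_int vJ']] .
    moreover have "z - of_int k * (of_nat m * (of_int b + om)) = of_int (x - k * int m * b)"
      unfolding z k by (simp add: algebra_simps)
    ultimately have "x - k * int m * b \<in> S2" by (simp add: S2_def)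
    then obtain l where l: "x - k * int m * b = int m * int a * l" unfolding n(2) a by auto
    have "z = of_int l * (of_nat m * of_nat a) + of_int k * (of_nat m * (of_int b + om))"
    proof -
      have "x = int m * int a * l + k * int m * b" using l by simp
      then show ?thesis unfolding z k by (simp add: algebra_simps)
    qed
    then show "z \<in> triple_ideal (m, a, b)" by (auto simp: zlat_def)
  qed
  ultimately show ?thesis using that by blast
qed

lemma triple_ideal_mem:
  "of_int X + of_int Y * om \<in> triple_ideal (m, a, b) \<longleftrightarrow>
    (\<exists>x y. X = int m * (int a * x + b * y) \<and> Y = int m * y)"
proof -
  have "of_int x * (of_nat m * of_nat a) + of_int y * (of_nat m * (of_int b + om)) =
      of_int (int m * (int a * x + b * y)) + of_int (int m * y) * om" for x y
    by (simp add: algebra_simps)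
  then show ?thesis
    unfolding triple_ideal.simps zlat_def mem_Collect_eq by (simp only: of_int_om_eq_iff) auto
qed

text \<open>
  The numbers \<open>m\<close>, \<open>m a\<close> and \<open>b\<close> modulo \<open>a\<close> are determined by the lattice, since its inclusion in another
  one already forces the corresponding divisibilities.
\<close>

lemma triple_ideal_inj: "inj_on triple_ideal ideal_triples"
proof -
  have dvds: "m' dvd m \<and> m' * a' dvd m * a \<and> (m = m' \<and> a = a' \<longrightarrow> int a dvd b - b')"
    if T: "(m, a, b) \<in> ideal_triples" "(m', a', b') \<in> ideal_triples"
      and sub: "triple_ideal (m, a, b) \<subseteq> triple_ideal (m', a', b')" for m a m' a' :: nat and b b'
  proof -
    have pos: "m > 0" "m' > 0" "a > 0" "a' > 0" using T by (auto simp: ideal_triples_def)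
    have "of_int (int m * b) + of_int (int m) * om \<in> triple_ideal (m, a, b)"
      unfolding triple_ideal_mem by (rule exI[of _ 0], rule exI[of _ 1]) simp
    then have "of_int (int m * b) + of_int (int m) * om \<in> triple_ideal (m', a', b')" using sub by blast
    then obtain x y where xy: "int m * b = int m' * (int a' * x + b' * y)" "int m = int m' * y"
      unfolding triple_ideal_mem by blast
    have "of_int (int m * int a) + of_int 0 * om \<in> triple_ideal (m, a, b)"
      unfolding triple_ideal_mem by (rule exI[of _ 1], rule exI[of _ 0]) simp
    then have "of_int (int m * int a) + of_int 0 * om \<in> triple_ideal (m', a', b')" using sub by blast
    then obtain p q where pq: "int m * int a = int m' * (int a' * p + b' * q)" "0 = int m' * q"
      unfolding triple_ideal_mem by blast
    have "int m' dvd int m" using xy(2) by simp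
    moreover have "int m' * int a' dvd int m * int a" using pq pos by simp
    moreover have "int a dvd b - b'" if "m = m'" "a = a'"
    proof -
      have "y = 1" using xy(2) pos that by simp
      then have "b - b' = int a * x" using xy(1) pos that by simp
      then show ?thesis by simp
    qed
    ultimately show ?thesis by (metis of_nat_dvd_iff of_nat_mult)
  qed
  show ?thesis
  proof (rule inj_onI)
    fix T T' assume T: "T \<in> ideal_triples" "T' \<in> ideal_triples" "triple_ideal T = triple_ideal T'"
    obtain m a b where 1: "T = (m, a, b)" by (cases T)
    obtain m' a' b' where 2: "T' = (m', a', b')" by (cases T')
    have d: "m' dvd m" "m' * a' dvd m * a" "m = m' \<and> a = a' \<longrightarrow> int a dvd b - b'"
      "m dvd m'" "m * a dvd m' * a'"
      using dvds[of m a b m' a' b'] dvds[of m' a' b' m a b] T unfolding 1 2 by auto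
    have pos: "m > 0" using T by (auto simp: ideal_triples_def 1)
    have "m = m'" using d by (simp add: dvd_antisym)
    moreover have "a = a'"
    proof -
      have "m * a = m * a'" using d(2,5) \<open>m = m'\<close> by (intro dvd_antisym) auto
      then show ?thesis using pos by simp
    qed
    moreover from calculation have "int a dvd b - b'" using d by blast
    then have "b mod int a = b' mod int a" by (simp add: mod_eq_dvd_iff)
    then have "b = b'" using T \<open>a = a'\<close> by (auto simp: 1 2 ideal_triples_def nrm_roots_def)
    ultimately show "T = T'" by (simp add: 1 2)
  qed
qed

section \<open>The class group as homothety classes of lattices\<close>

text \<open>
  By \<open>principal_ideal_prod\<close> below, this is the coset of a fractional ideal \<open>I\<close> modulo the principal
  ideals.
\<close>

definition homothety_class :: "complex set \<Rightarrow> complex set set" where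
  "homothety_class I = {(\<lambda>x. \<alpha> * x) ` I | \<alpha>. \<alpha> \<in> K \<and> \<alpha> \<noteq> 0}"

lemma homothety_class_scale:
  assumes "\<beta> \<in> K" "\<beta> \<noteq> 0"
  shows "homothety_class ((\<lambda>x. \<beta> * x) ` I) = homothety_class I"
proof (intro equalityI subsetI)
  fix J assume "J \<in> homothety_class ((\<lambda>x. \<beta> * x) ` I)"
  then obtain \<alpha> where a: "\<alpha> \<in> K" "\<alpha> \<noteq> 0" "J = (\<lambda>x. \<alpha> * x) ` (\<lambda>x. \<beta> * x) ` I"
    by (auto simp: homothety_class_def)
  then have "J = (\<lambda>x. (\<alpha> * \<beta>) * x) ` I" by (simp add: image_image mult.assoc)
  then show "J \<in> homothety_class I"
    using a assms K_mult[of \<alpha> \<beta>] unfolding homothety_class_def by (auto intro!: exI[of _ "\<alpha> * \<beta>"])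
next
  fix J assume "J \<in> homothety_class I"
  then obtain \<alpha> where a: "\<alpha> \<in> K" "\<alpha> \<noteq> 0" "J = (\<lambda>x. \<alpha> * x) ` I"
    by (auto simp: homothety_class_def)
  then have "J = (\<lambda>x. (\<alpha> / \<beta>) * x) ` (\<lambda>x. \<beta> * x) ` I" using assms by (simp add: image_image)
  then show "J \<in> homothety_class ((\<lambda>x. \<beta> * x) ` I)"
    using a(1,2) assms K_divide[of \<alpha> \<beta>] unfolding homothety_class_def mem_Collect_eq
    by (intro exI[of _ "\<alpha> / \<beta>"] conjI) auto
qed

lemma homothety_class_self: "I \<in> homothety_class I"
  unfolding homothety_class_def using K_of_int[of 1] by (auto intro!: exI[of _ 1])

lemma homothety_class_eq_iff:
  "homothety_class J = homothety_class I \<longleftrightarrow> (\<exists>\<alpha> \<in> K. \<alpha> \<noteq> 0 \<and> J = (\<lambda>x. \<alpha> * x) ` I)"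
proof
  assume "homothety_class J = homothety_class I"
  then have "J \<in> homothety_class I" using homothety_class_self by metis
  then show "\<exists>\<alpha> \<in> K. \<alpha> \<noteq> 0 \<and> J = (\<lambda>x. \<alpha> * x) ` I" by (auto simp: homothety_class_def)
qed (use homothety_class_scale in blast)

lemma ring_OK: "ring (complex_ring OK)"
proof (rule ringI)
  show "abelian_group (complex_ring OK)"
  proof (rule abelian_groupI)
    fix x assume "x \<in> carrier (complex_ring OK)"
    then show "\<exists>y\<in>carrier (complex_ring OK). y \<oplus>\<^bsub>complex_ring OK\<^esub> x = \<zero>\<^bsub>complex_ring OK\<^esub>"
      by (intro bexI[of _ "- x"]) (auto simp: complex_ring_def OK_minus)
  qed (auto simp: complex_ring_def OK_add)
  show "Group.monoid (complex_ring OK)"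
    by unfold_locales (auto simp: complex_ring_def OK_mult)
qed (auto simp: complex_ring_def algebra_simps)

lemma ideal_iff_module:
  "ideal J (complex_ring OK) \<longleftrightarrow> is_OK_module J \<and> J \<subseteq> OK"
proof
  assume "ideal J (complex_ring OK)"
  then interpret ideal J "complex_ring OK" .
  have sub: "J \<subseteq> OK" using a_subset by (simp add: complex_ring_def)
  have z: "0 \<in> J" using additive_subgroup.zero_closed[OF is_additive_subgroup] by (simp add: complex_ring_def)
  have add: "x + y \<in> J" if "x \<in> J" "y \<in> J" for x y
    using additive_subgroup.a_closed[OF is_additive_subgroup that] by (simp add: complex_ring_def)
  have mult: "r * x \<in> J" if "r \<in> OK" "x \<in> J" for r x
    using I_l_closed[of x r] that by (simp add: complex_ring_def)
  have "x - y \<in> J" if "x \<in> J" "y \<in> J" for x y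
    using add[OF that(1) mult[of "-1" y]] that(2) OK_of_int[of "-1"] by simp
  then show "is_OK_module J \<and> J \<subseteq> OK" using sub z mult by (auto simp: is_OK_module_def)
next
  assume J: "is_OK_module J \<and> J \<subseteq> OK"
  then have J0: "0 \<in> J" and Jdiff: "\<And>x y. x \<in> J \<Longrightarrow> y \<in> J \<Longrightarrow> x - y \<in> J"
    and Jmult: "\<And>r x. r \<in> OK \<Longrightarrow> x \<in> J \<Longrightarrow> r * x \<in> J"
    by (auto simp: is_OK_module_def)
  have Jneg: "- x \<in> J" if "x \<in> J" for x using Jdiff[OF J0 that] by simp
  have Jadd: "x + y \<in> J" if "x \<in> J" "y \<in> J" for x y
    using Jdiff[OF that(1) Jneg[OF that(2)]] by simp
  interpret R: ring "complex_ring OK" by (rule ring_OK)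
  have inv: "\<ominus>\<^bsub>complex_ring OK\<^esub> x = - x" if "x \<in> OK" for x
  proof (rule R.minus_equality)
    show "- x \<oplus>\<^bsub>complex_ring OK\<^esub> x = \<zero>\<^bsub>complex_ring OK\<^esub>" by (simp add: complex_ring_def)
  qed (use that OK_minus in \<open>auto simp: complex_ring_def\<close>)
  show "ideal J (complex_ring OK)"
  proof (rule idealI[OF ring_OK])
    show "subgroup J (add_monoid (complex_ring OK))"
    proof (rule group.subgroupI)
      show "Group.group (add_monoid (complex_ring OK))" by (rule R.a_group)
      show "inv\<^bsub>add_monoid (complex_ring OK)\<^esub> x \<in> J" if "x \<in> J" for x
        using inv[of x] Jneg[OF that] that J by (auto simp: a_inv_def)
    qed (use J J0 Jadd in \<open>auto simp: complex_ring_def\<close>)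
    show "x \<otimes>\<^bsub>complex_ring OK\<^esub> a \<in> J" "a \<otimes>\<^bsub>complex_ring OK\<^esub> x \<in> J"
      if "a \<in> J" "x \<in> carrier (complex_ring OK)" for a x
      using Jmult[of x a] that by (simp_all add: complex_ring_def mult.commute)
  qed
qed

lemma fractional_ideal_homothetic:
  assumes "I \<in> fractional_ideals K"
  obtains T d where "T \<in> ideal_triples" "d \<in> OK" "d \<noteq> 0" "(\<lambda>x. d * x) ` I = triple_ideal T"
proof -
  obtain d where d: "d \<in> OK" "d \<noteq> 0" "ideal ((\<lambda>x. d * x) ` I) (complex_ring OK)" and "I \<noteq> {0}"
    using assms by (auto simp: fractional_ideals_def)
  have J: "is_OK_module ((\<lambda>x. d * x) ` I)" "(\<lambda>x. d * x) ` I \<subseteq> OK"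
    using d(3) by (simp_all add: ideal_iff_module)
  have "I \<noteq> {}" using J(1) by (auto simp: is_OK_module_def)
  then obtain x where "x \<in> I" "x \<noteq> 0" using \<open>I \<noteq> {0}\<close> by blast
  then have "\<exists>x \<in> (\<lambda>x. d * x) ` I. x \<noteq> 0" using d(2) by auto
  then show ?thesis using module_is_triple_ideal[OF J] that d by metis
qed

lemma triple_ideal_fractional:
  assumes "T \<in> ideal_triples"
  shows "triple_ideal T \<in> fractional_ideals K"
proof -
  obtain m a b where T: "T = (m, a, b)" by (cases T)
  note M = triple_ideal_module[OF assms[unfolded T], folded T]
  have "ideal ((\<lambda>x. 1 * x) ` triple_ideal T) (complex_ring OK)"
    using M by (simp add: ideal_iff_module)
  then show ?thesis
    unfolding fractional_ideals_def using M OK_subset_K OK_1 by (auto intro!: bexI[of _ 1])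
qed

text \<open>
  A fractional ideal is stable under the ring of integers, so sums of products with elements of
  \<open>\<alpha> O\<close> stay in \<open>\<alpha> I\<close>; conversely \<open>\<alpha> x = (\<alpha> \<cdot> 1) x\<close>.
\<close>

lemma principal_ideal_prod:
  assumes I: "I \<in> fractional_ideals K"
  shows "ideal_prod (complex_ring K) ((\<lambda>x. \<alpha> * x) ` OK) I = (\<lambda>x. \<alpha> * x) ` I"
proof -
  obtain T d where d: "d \<noteq> 0" "(\<lambda>x. d * x) ` I = triple_ideal T" and T: "T \<in> ideal_triples"
    using fractional_ideal_homothetic[OF I] by metis
  have "is_OK_module (triple_ideal T)" using triple_ideal_module T by (cases T) blast
  moreover have "I = (\<lambda>x. (1 / d) * x) ` triple_ideal T"
    unfolding d(2)[symmetric] using d(1) by (simp add: image_image)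
  ultimately have M: "is_OK_module I" using is_OK_module_scale by metis
  have I0: "0 \<in> I" and Idiff: "\<And>x y. x \<in> I \<Longrightarrow> y \<in> I \<Longrightarrow> x - y \<in> I"
    and Imult: "\<And>r x. r \<in> OK \<Longrightarrow> x \<in> I \<Longrightarrow> r * x \<in> I"
    using M by (auto simp: is_OK_module_def)
  have Iadd: "x + y \<in> I" if "x \<in> I" "y \<in> I" for x y
    using Idiff[OF that(1) Idiff[OF I0 that(2)]] by simp
  show ?thesis
  proof (intro equalityI subsetI)
    fix z assume "z \<in> ideal_prod (complex_ring K) ((\<lambda>x. \<alpha> * x) ` OK) I"
    then show "z \<in> (\<lambda>x. \<alpha> * x) ` I"
    proof induction
      case (prod i j)
      then obtain r where "r \<in> OK" "i = \<alpha> * r" by blast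
      then have "i \<otimes>\<^bsub>complex_ring K\<^esub> j = \<alpha> * (r * j)" by (simp add: complex_ring_def mult.assoc)
      then show ?case using Imult \<open>r \<in> OK\<close> prod(2) by blast
    next
      case (sum s1 s2)
      then obtain x y where "x \<in> I" "y \<in> I" "s1 = \<alpha> * x" "s2 = \<alpha> * y" by blast
      then have "s1 \<oplus>\<^bsub>complex_ring K\<^esub> s2 = \<alpha> * (x + y)" by (simp add: complex_ring_def distrib_left)
      then show ?case using Iadd \<open>x \<in> I\<close> \<open>y \<in> I\<close> by blast
    qed
  next
    fix z assume "z \<in> (\<lambda>x. \<alpha> * x) ` I"
    then obtain x where x: "x \<in> I" "z = \<alpha> * x" by blast
    have "\<alpha> * 1 \<in> (\<lambda>x. \<alpha> * x) ` OK" by (rule imageI) simp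
    then have "(\<alpha> * 1) \<otimes>\<^bsub>complex_ring K\<^esub> x \<in> ideal_prod (complex_ring K) ((\<lambda>x. \<alpha> * x) ` OK) I"
      using x(1) by (rule ideal_prod.prod)
    then show "z \<in> ideal_prod (complex_ring K) ((\<lambda>x. \<alpha> * x) ` OK) I"
      by (simp add: complex_ring_def x(2))
  qed
qed

definition ideal_classes :: "complex set set set" where
  "ideal_classes = (\<lambda>T. homothety_class (triple_ideal T)) ` ideal_triples"

text \<open>
  The order of the quotient is its number of cosets, and clearing denominators shows that every
  coset contains an integral ideal.
\<close>

lemma class_number_eq_card: "class_number D = card ideal_classes"
proof -
  have "class_number D = card (\<Union>I\<in>fractional_ideals K.
      {\<Union>h\<in>principal_fractional_ideals K. {ideal_prod (complex_ring K) h I}})"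
    by (simp add: class_number_def ideal_class_group_def order_def FactGroup_def RCOSETS_def r_coset_def
        fractional_ideal_group_def)
  also have "(\<Union>I\<in>fractional_ideals K. {\<Union>h\<in>principal_fractional_ideals K. {ideal_prod (complex_ring K) h I}})
    = homothety_class ` fractional_ideals K"
  proof -
    have "(\<Union>h\<in>principal_fractional_ideals K. {ideal_prod (complex_ring K) h I}) = homothety_class I"
      if I: "I \<in> fractional_ideals K" for I
    proof -
      have "(\<Union>h\<in>principal_fractional_ideals K. {ideal_prod (complex_ring K) h I})
        = {ideal_prod (complex_ring K) ((\<lambda>x. \<alpha> * x) ` OK) I | \<alpha>. \<alpha> \<in> K \<and> \<alpha> \<noteq> 0}"
        unfolding principal_fractional_ideals_def by blast
      then show ?thesis unfolding principal_ideal_prod[OF I] homothety_class_def .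
    qed
    then show ?thesis by auto
  qed
  also have "homothety_class ` fractional_ideals K = ideal_classes"
  proof (intro equalityI subsetI)
    fix C assume "C \<in> homothety_class ` fractional_ideals K"
    then obtain I where I: "I \<in> fractional_ideals K" "C = homothety_class I" by blast
    obtain T d where T: "T \<in> ideal_triples" "d \<in> OK" "d \<noteq> 0" "(\<lambda>x. d * x) ` I = triple_ideal T"
      using fractional_ideal_homothetic[OF I(1)] .
    have "homothety_class (triple_ideal T) = C"
      unfolding T(4)[symmetric] I(2) using T OK_subset_K by (intro homothety_class_scale) auto
    then show "C \<in> ideal_classes" using T(1) by (auto simp: ideal_classes_def)
  qed (auto simp: ideal_classes_def intro: triple_ideal_fractional)
  finally show ?thesis .
qed

lemma primitive_representative:
  assumes "(m, a, b) \<in> ideal_triples"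
  shows "(1, a, b) \<in> ideal_triples"
    "homothety_class (triple_ideal (m, a, b)) = homothety_class (triple_ideal (1, a, b))"
proof -
  show "(1, a, b) \<in> ideal_triples" using assms by (simp add: ideal_triples_def)
  have "triple_ideal (m, a, b) = (\<lambda>x. of_int (int m) * x) ` triple_ideal (1, a, b)"
    by (simp add: zlat_scale)
  then show "homothety_class (triple_ideal (m, a, b)) = homothety_class (triple_ideal (1, a, b))"
    using assms homothety_class_scale[OF K_of_int[of "int m"], of "triple_ideal (1, a, b)"]
    by (simp add: ideal_triples_def del: triple_ideal.simps)
qed

text \<open>
  Reduction of forms: shift \<open>b\<close> so that \<open>\<bar>2 b + 1\<bar> \<le> a + 1\<close> and write the norm
  \<open>((2 b + 1)\<^sup>2 + N) / 4\<close> of \<open>b + \<omega>\<close> as \<open>a c\<close>. If \<open>a > N\<close> then \<open>c < a\<close>, and multiplication by the conjugate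
  of \<open>b + \<omega>\<close> divided by \<open>a\<close> leads to an ideal with \<open>c\<close> in place of \<open>a\<close>.
\<close>

lemma reduced_representative:
  assumes "(1, a, b) \<in> ideal_triples"
  obtains a' b' where "(1, a', b') \<in> ideal_triples" "int a' \<le> N"
    "homothety_class (triple_ideal (1, a', b')) = homothety_class (triple_ideal (1, a, b))"
  using assms
proof (induction a arbitrary: b thesis rule: less_induct)
  case (less a)
  have a: "a > 0" "int a dvd nrm b" using less.prems(2) by (auto simp: ideal_triples_def nrm_roots_def)
  show ?case
  proof (cases "int a \<le> N")
    case True
    then show ?thesis using less.prems by blast
  next
    case False
    \<comment> \<open>\<open>b'\<close> is the representative of \<open>b\<close> modulo \<open>a\<close> in \<open>[- a / 2, a / 2)\<close>.\<close>
    define b' where "b' = (b + int a div 2) mod int a - int a div 2"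
    have range: "- (int a div 2) \<le> b'" "b' < int a - int a div 2" using a(1) by (simp_all add: b'_def)
    have "int a dvd b' - b"
    proof -
      have "(b + int a div 2) mod int a = (b + int a div 2) - (b + int a div 2) div int a * int a"
        by (simp only: minus_div_mult_eq_mod)
      then have "b' - b = - ((b + int a div 2) div int a * int a)"
        unfolding b'_def by (simp only: algebra_simps)
      then show ?thesis by simp
    qed
    then obtain k where k: "b' = b + int a * k" by (metis add.commute diff_add_cancel dvd_def)
    have "int a dvd nrm b'" using a(2) dvd_nrm_cong[OF \<open>int a dvd b' - b\<close>] by blast
    then obtain c where c: "nrm b' = int a * c" by blast
    have four: "4 * (int a * c) = (2 * b' + 1)\<^sup>2 + N" using four_nrm[of b'] c by simp
    have "c > 0"
    proof -
      have "0 < 4 * (int a * c)" unfolding four using N_gt by (simp add: add_nonneg_pos)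
      then show ?thesis using a(1) by (simp add: zero_less_mult_iff)
    qed
    have "c < int a"
    proof (rule ccontr)
      assume "\<not> c < int a"
      then have "int a * int a \<le> int a * c" by (intro mult_left_mono) auto
      moreover have "\<bar>2 * b' + 1\<bar> \<le> int a + 1" using range by linarith
      then have "(2 * b' + 1)\<^sup>2 \<le> (int a + 1)\<^sup>2" by (metis abs_le_square_iff abs_of_nonneg of_nat_0_le_iff add_nonneg_nonneg zero_le_one)
      ultimately have "4 * (int a * int a) \<le> (int a + 1)\<^sup>2 + N" using four by linarith
      moreover have "int a \<ge> 8" using False N_ge by linarith
      then have "8 * int a \<le> int a * int a" by (intro mult_right_mono) auto
      ultimately show False using False \<open>int a \<ge> 8\<close> by (simp add: power2_eq_square algebra_simps)
    qed
    define a' where "a' = nat c"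
    have a': "a' < a" "int a' = c" "a' > 0" using \<open>c < int a\<close> \<open>c > 0\<close> by (auto simp: a'_def)
    define L where "L = zlat (of_nat a) (of_int b' + om)"
    have L: "triple_ideal (1, a, b) = L"
    proof -
      have "of_int b' + om = (of_int b + om) + of_int k * of_nat a" by (simp add: k)
      then show ?thesis unfolding L_def by (simp only: zlat_shift) simp
    qed
    \<comment> \<open>The conjugate generator rotates \<open>L\<close> into an ideal whose smallest positive integer is \<open>c\<close>.\<close>
    define \<gamma> where "\<gamma> = cnj (of_int b' + om) / of_nat a"
    have g0: "of_int b' + om \<noteq> 0"
      using of_int_om_eq_iff[of b' 1 0 0] by simp
    have nb: "of_int b' + om \<noteq> 0 \<and> cnj (of_int b' + om) * (of_int b' + om) = of_nat a * of_int c"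
    proof -
      show ?thesis unfolding shifted_om_norm c using g0 by simp
    qed
    define b2 where "b2 = (- b' - 1) mod int a'"
    have scaled: "(\<lambda>x. \<gamma> * x) ` L = zlat (of_nat a') (of_int (- b' - 1) + om)"
    proof -
      have "(\<lambda>x. \<gamma> * x) ` L = zlat (cnj (of_int b' + om)) (of_int c)"
      proof -
        have "\<gamma> * of_nat a = cnj (of_int b' + om)" using a(1) by (simp add: \<gamma>_def)
        moreover have "\<gamma> * (of_int b' + om) = of_int c"
          unfolding \<gamma>_def times_divide_eq_left conjunct2[OF nb] using a(1) by simp
        ultimately show ?thesis unfolding L_def zlat_scale by (simp only:)
      qed
      also have "\<dots> = zlat (of_int c) (of_int (- b' - 1) + om)"
      proof -
        have "of_int (- b' - 1) + om = - cnj (of_int b' + om)" by (simp add: cnj_om)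
        then show ?thesis by (simp only: zlat_minus zlat_commute)
      qed
      also have "of_int c = (of_nat a' :: complex)" using a'(2) by (metis of_int_of_nat_eq)
      finally show ?thesis .
    qed
    also have "\<dots> = triple_ideal (1, a', b2)"
    proof -
      obtain l where l: "- b' - 1 = b2 + int a' * l"
        unfolding b2_def using mod_mult_div_eq[of "- b' - 1" "int a'"] by (metis add.commute)
      have "of_int (- b' - 1) + om = (of_int b2 + om) + of_int l * of_nat a'" unfolding l by simp
      then show ?thesis by (simp only: zlat_shift) simp
    qed
    finally have eq: "triple_ideal (1, a', b2) = (\<lambda>x. \<gamma> * x) ` triple_ideal (1, a, b)" unfolding L ..
    have "int a' dvd nrm (- b' - 1)"
    proof -
      have "nrm (- b' - 1) = nrm b'" by (simp add: nrm_def power2_eq_square algebra_simps)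
      then show ?thesis using c a'(2) by simp
    qed
    then have T': "(1, a', b2) \<in> ideal_triples"
      using a' by (simp add: ideal_triples_def nrm_roots_def b2_def dvd_nrm_mod)
    have "\<gamma> \<in> K"
    proof -
      have "cnj (of_int b' + om) \<in> K" using cnj_OK[OF OK_I[of b' 1]] OK_subset_K by auto
      then show ?thesis unfolding \<gamma>_def using K_divide[of _ "of_int (int a)"] K_of_int[of "int a"] by simp
    qed
    moreover have "\<gamma> \<noteq> 0"
      using g0 a(1) \<gamma>_def by (metis complex_cnj_zero_iff divide_eq_0_iff of_nat_eq_0_iff less_irrefl)
    ultimately have "homothety_class (triple_ideal (1, a', b2)) = homothety_class (triple_ideal (1, a, b))"
      unfolding eq by (rule homothety_class_scale)
    then show ?thesis using less.IH[OF a'(1) _ T'] less.prems(1) by metis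
  qed
qed

lemma finite_ideal_classes: "finite ideal_classes"
proof (rule finite_subset)
  define F where "F = (SIGMA a:{..nat N}. nrm_roots a)"
  show "ideal_classes \<subseteq> (\<lambda>(a, b). homothety_class (triple_ideal (1, a, b))) ` F"
  proof
    fix C assume "C \<in> ideal_classes"
    then obtain m a b where T: "(m, a, b) \<in> ideal_triples" "C = homothety_class (triple_ideal (m, a, b))"
      unfolding ideal_classes_def by auto
    obtain a' b' where "(1, a', b') \<in> ideal_triples" "int a' \<le> N"
      "homothety_class (triple_ideal (1, a', b')) = homothety_class (triple_ideal (1, a, b))"
      using reduced_representative[OF primitive_representative(1)[OF T(1)]] .
    then show "C \<in> (\<lambda>(a, b). homothety_class (triple_ideal (1, a, b))) ` F"
      using primitive_representative(2)[OF T(1)] T(2)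
      by (intro image_eqI[of _ _ "(a', b')"]) (auto simp: F_def ideal_triples_def simp del: triple_ideal.simps)
  qed
  show "finite ((\<lambda>(a, b). homothety_class (triple_ideal (1, a, b))) ` F)"
    unfolding F_def using finite_nrm_roots by blast
qed

end


section \<open>The class number formula\<close>

lemma Im_of_real_mult: "Im (of_real r * z) = r * Im z"
  by simp

context odd_imaginary_discriminant
begin

lemma primitive_generator_sum: "(of_int b + om) + cnj (of_int b + om) = of_int (2 * b + 1)"
  by (simp add: cnj_om)

context
  fixes a :: nat and b c :: int
  assumes prim: "(1, a, b) \<in> ideal_triples" and c: "nrm b = int a * c"
begin

text \<open>
  The multipliers \<open>\<alpha>\<close> for which \<open>\<alpha> L\<close> is contained in the ring of integers, where \<open>L\<close> is the
  primitive ideal with basis \<open>a, b + \<omega>\<close>, form the inverse ideal of \<open>L\<close>. Its basis is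
  \<open>1\<close> and the conjugate of \<open>b + \<omega>\<close> divided by \<open>a\<close>.
\<close>

definition inv_gen :: complex where
  "inv_gen = cnj (of_int b + om) / of_nat a"

definition multiplier :: "int \<times> int \<Rightarrow> complex" where
  "multiplier v = of_int (fst v) + of_int (snd v) * inv_gen"

abbreviation L :: "complex set" where "L \<equiv> triple_ideal (1, a, b)"

abbreviation class_form :: "real \<Rightarrow> real \<Rightarrow> real" where
  "class_form \<equiv> qform (real a) (of_int (2 * b + 1)) (of_int c)"

lemma a_pos: "a > 0" using prim by (simp add: ideal_triples_def)

lemma multiplier_a: "multiplier (x, y) * of_nat a = of_int (int a * x) + of_int y * cnj (of_int b + om)"
  using a_pos by (simp add: multiplier_def inv_gen_def field_simps)

lemma multiplier_gen: "multiplier (x, y) * (of_int b + om) = of_int x * (of_int b + om) + of_int (c * y)"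
proof -
  have "multiplier (x, y) * (of_int b + om) = of_int x * (of_int b + om)
      + of_int y * (cnj (of_int b + om) * (of_int b + om)) / of_nat a"
    by (simp only: multiplier_def inv_gen_def fst_conv snd_conv distrib_right times_divide_eq_left
        times_divide_eq_right mult.assoc)
  also have "\<dots> = of_int x * (of_int b + om) + of_int (c * y)"
    unfolding shifted_om_norm c using a_pos by simp
  finally show ?thesis .
qed

lemma multiplier_norm:
  "of_nat a * (multiplier (x, y) * cnj (multiplier (x, y))) =
    of_int (int a * x\<^sup>2 + (2 * b + 1) * x * y + c * y\<^sup>2)"
proof -
  define \<beta> where "\<beta> = of_int b + om"
  have s: "\<beta> + cnj \<beta> = of_int (2 * b + 1)" unfolding \<beta>_def by (rule primitive_generator_sum)
  have p: "cnj \<beta> * \<beta> = of_nat a * of_int c" unfolding \<beta>_def shifted_om_norm c by simp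
  have a: "of_nat a \<noteq> (0 :: complex)" using a_pos by simp
  have m: "multiplier (x, y) = of_int x + of_int y * (cnj \<beta> / of_nat a)"
    by (simp only: multiplier_def inv_gen_def \<beta>_def fst_conv snd_conv)
  have "of_nat a * (multiplier (x, y) * cnj (multiplier (x, y))) =
    of_nat a * of_int x * of_int x + of_int x * of_int y * (\<beta> + cnj \<beta>) + of_int y * of_int y * (cnj \<beta> * \<beta>) / of_nat a"
    unfolding m using a by (simp add: field_simps)
  also have "\<dots> = of_int (int a * x\<^sup>2 + (2 * b + 1) * x * y + c * y\<^sup>2)"
    unfolding s p using a by (simp add: power2_eq_square algebra_simps)
  finally show ?thesis .
qed

lemma multiplier_K: "multiplier v \<in> K"
proof -
  have "multiplier v * of_nat a \<in> OK"
    using OK_add[OF OK_of_int OK_mult[OF OK_of_int cnj_OK[OF OK_I[of b 1]]], of "int a * fst v" "snd v"]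
      multiplier_a[of "fst v" "snd v"] by (simp del: complex_cnj_add)
  then have "multiplier v * of_nat a / of_int (int a) \<in> K"
    using OK_subset_K by (intro K_divide K_of_int) auto
  then show ?thesis using a_pos by simp
qed

lemma inv_gen_Im: "Im inv_gen \<noteq> 0"
  using om_Im a_pos by (simp add: inv_gen_def)

lemma multiplier_inj: "inj multiplier"
proof (rule injI)
  fix v w assume eq: "multiplier v = multiplier w"
  have "of_int (snd v) * Im inv_gen = of_int (snd w) * Im inv_gen"
    using arg_cong[OF eq, of Im] by (simp add: multiplier_def)
  then have "snd v = snd w" using inv_gen_Im by simp
  then show "v = w" using eq by (simp add: multiplier_def prod_eq_iff)
qed

lemma multiplier_eq_0_iff: "multiplier v = 0 \<longleftrightarrow> v = (0, 0)"
proof -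
  have "multiplier (0, 0) = 0" by (simp add: multiplier_def)
  then show ?thesis using multiplier_inj by (metis injD)
qed

lemma multiplier_minus: "multiplier (- fst v, - snd v) = - multiplier v"
  by (simp add: multiplier_def)

lemma L_zlat: "L = zlat (of_nat a) (of_int b + om)"
  by simp

lemma multiplier_integral: "(\<lambda>x. multiplier v * x) ` L \<subseteq> OK"
proof -
  obtain x y where v: "v = (x, y)" by (cases v)
  have b: "of_int b + om \<in> OK" using OK_I[of b 1] by simp
  have 1: "multiplier v * of_nat a \<in> OK"
    unfolding v multiplier_a by (intro OK_add OK_mult OK_of_int cnj_OK b)
  have 2: "multiplier v * (of_int b + om) \<in> OK"
    unfolding v multiplier_gen by (intro OK_add OK_mult OK_of_int b)
  show ?thesis
  proof
    fix z assume "z \<in> (\<lambda>x. multiplier v * x) ` L"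
    then obtain p q where "z = of_int p * (multiplier v * of_nat a) + of_int q * (multiplier v * (of_int b + om))"
      unfolding L_zlat zlat_scale by (auto simp only: zlat_def)
    then show "z \<in> OK" using OK_add[OF OK_mult[OF OK_of_int 1] OK_mult[OF OK_of_int 2]] by (simp only:)
  qed
qed

lemma multiplier_surj:
  assumes \<alpha>: "(\<lambda>x. \<alpha> * x) ` L \<subseteq> OK"
  obtains v where "\<alpha> = multiplier v"
proof -
  have "\<alpha> * of_nat a \<in> OK" "\<alpha> * (of_int b + om) \<in> OK"
    using \<alpha> zlat_fst[of "of_nat a" "of_int b + om"] zlat_snd[of "of_int b + om" "of_nat a"]
    unfolding L_zlat by blast+
  then obtain p q r s where pq: "\<alpha> * of_nat a = of_int p + of_int q * om"
    and rs: "\<alpha> * (of_int b + om) = of_int r + of_int s * om"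
    unfolding OK_iff by blast
  define u where "u = p + q * (b + 1)"
  have g: "\<alpha> * of_nat a = of_int u - of_int q * cnj (of_int b + om)"
    unfolding pq u_def by (simp add: cnj_om algebra_simps)
  have "of_int u * (of_int b + om) - of_int q * (cnj (of_int b + om) * (of_int b + om))
    = \<alpha> * of_nat a * (of_int b + om)"
    unfolding g by (simp only: left_diff_distrib mult.assoc)
  also have "\<dots> = of_nat a * (of_int r + of_int s * om)"
    unfolding rs[symmetric] by (simp only: mult_ac)
  finally have "of_int (u * b - q * (int a * c)) + of_int u * om = of_int (int a * r) + of_int (int a * s) * om"
    unfolding shifted_om_norm c by (simp add: algebra_simps)
  then have "u = int a * s" unfolding of_int_om_eq_iff by blast
  then have "\<alpha> * of_nat a = multiplier (s, - q) * of_nat a"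
    unfolding g multiplier_a by simp
  then have "\<alpha> = multiplier (s, - q)" using a_pos by simp
  then show ?thesis using that by blast
qed

text \<open>
  Multiplication by \<open>\<epsilon>\<close> acts on a basis of \<open>L\<close> by an integer matrix, and \<open>\<epsilon>\<close> is a root of its
  characteristic polynomial.
\<close>

lemma stabilizer_integral:
  assumes "\<epsilon> \<in> K" "(\<lambda>x. \<epsilon> * x) ` L \<subseteq> L"
  shows "\<epsilon> \<in> OK"
proof -
  define u v where "u = (of_nat a :: complex)" and "v = of_int b + om"
  have nz: "u \<noteq> 0" "v \<noteq> 0"
    using a_pos of_int_om_eq_iff[of b 1 0 0] by (simp_all add: u_def v_def)
  have "\<epsilon> * u \<in> zlat u v" "\<epsilon> * v \<in> zlat u v"
    using assms(2) zlat_fst[of u v] zlat_snd[of v u] unfolding L_zlat u_def v_def by blast+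
  then obtain p q r s where e: "\<epsilon> * u = of_int p * u + of_int q * v" "\<epsilon> * v = of_int r * u + of_int s * v"
    by (auto simp: zlat_def)
  have "(\<epsilon> - of_int p) * u = of_int q * v" "(\<epsilon> - of_int s) * v = of_int r * u"
    using e by (simp_all add: algebra_simps)
  then have "((\<epsilon> - of_int p) * u) * ((\<epsilon> - of_int s) * v) = (of_int q * v) * (of_int r * u)" by simp
  then have "(u * v) * ((\<epsilon> - of_int p) * (\<epsilon> - of_int s)) = (u * v) * (of_int q * of_int r)" by (simp only: mult_ac)
  then have "(\<epsilon> - of_int p) * (\<epsilon> - of_int s) = of_int q * of_int r" using nz by simp
  then have "\<epsilon> * \<epsilon> - of_int (p + s) * \<epsilon> + of_int (p * s - q * r) = 0" by (simp add: algebra_simps)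
  then have "algebraic_int \<epsilon>" by (rule algebraic_int_quadratic)
  then show ?thesis using assms(1) by (simp add: integers_of_def)
qed

text \<open>
  If two multipliers give the same ideal, their quotient and its inverse map \<open>L\<close> to itself, so the
  quotient is a unit of the ring of integers.
\<close>

lemma multiplier_ideal_eq_iff:
  assumes "v \<noteq> (0, 0)" "w \<noteq> (0, 0)"
  shows "(\<lambda>x. multiplier v * x) ` L = (\<lambda>x. multiplier w * x) ` L \<longleftrightarrow> w = v \<or> w = (- fst v, - snd v)"
proof
  assume eq: "(\<lambda>x. multiplier v * x) ` L = (\<lambda>x. multiplier w * x) ` L"
  have nz: "multiplier v \<noteq> 0" "multiplier w \<noteq> 0" using assms multiplier_eq_0_iff by auto
  define \<epsilon> where "\<epsilon> = multiplier w / multiplier v"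
  have sub: "(\<lambda>x. (\<beta> / \<alpha>) * x) ` L \<subseteq> L"
    if "(\<lambda>x. \<alpha> * x) ` L = (\<lambda>x. \<beta> * x) ` L" "\<alpha> \<noteq> 0" for \<alpha> \<beta> :: complex
  proof
    fix z assume "z \<in> (\<lambda>x. (\<beta> / \<alpha>) * x) ` L"
    then obtain x where x: "x \<in> L" "z = (\<beta> / \<alpha>) * x" by blast
    then have "\<beta> * x \<in> (\<lambda>x. \<alpha> * x) ` L" unfolding that(1) by blast
    then obtain y where "y \<in> L" "\<beta> * x = \<alpha> * y" by blast
    then show "z \<in> L" using x that(2) by (simp add: field_simps del: triple_ideal.simps)
  qed
  have "\<epsilon> \<in> OK" unfolding \<epsilon>_def
    by (rule stabilizer_integral[OF K_divide[OF multiplier_K multiplier_K] sub[OF eq nz(1)]])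
  moreover have "inverse \<epsilon> \<in> OK" unfolding \<epsilon>_def inverse_divide
    by (rule stabilizer_integral[OF K_divide[OF multiplier_K multiplier_K] sub[OF eq[symmetric] nz(2)]])
  moreover have "\<epsilon> \<noteq> 0" using nz by (simp add: \<epsilon>_def)
  ultimately have "\<epsilon> = 1 \<or> \<epsilon> = -1" by (rule units_OK)
  moreover have "multiplier w = \<epsilon> * multiplier v" using nz by (simp add: \<epsilon>_def)
  ultimately have "multiplier w = multiplier v \<or> multiplier w = multiplier (- fst v, - snd v)"
    unfolding multiplier_minus by auto
  then show "w = v \<or> w = (- fst v, - snd v)" using multiplier_inj by (auto dest: injD)
next
  assume "w = v \<or> w = (- fst v, - snd v)"
  then show "(\<lambda>x. multiplier v * x) ` L = (\<lambda>x. multiplier w * x) ` L"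
  proof
    assume w: "w = (- fst v, - snd v)"
    have "zlat u v = zlat (- u) (- v)" for u v
      using zlat_minus[of u v] zlat_minus[of v u] by (simp only: zlat_minus zlat_commute[of "- u"])
        (metis zlat_commute zlat_minus)
    then show ?thesis unfolding L_zlat zlat_scale w multiplier_minus by (simp only: mult_minus_left)
  qed simp
qed

definition class_triples :: "(nat \<times> nat \<times> int) set" where
  "class_triples = {T \<in> ideal_triples. homothety_class (triple_ideal T) = homothety_class L}"

lemma triple_of_multiplier:
  assumes "v \<noteq> (0, 0)"
  obtains T where "T \<in> class_triples" "triple_ideal T = (\<lambda>x. multiplier v * x) ` L"
proof -
  have nz: "multiplier v \<noteq> 0" using assms multiplier_eq_0_iff by simp
  have M: "is_OK_module L" "\<exists>x \<in> L. x \<noteq> 0" using triple_ideal_module[OF prim] by blast+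
  have "is_OK_module ((\<lambda>x. multiplier v * x) ` L)" by (rule is_OK_module_scale[OF M(1)])
  moreover have "\<exists>x \<in> (\<lambda>x. multiplier v * x) ` L. x \<noteq> 0" using M(2) nz by auto
  ultimately obtain T where T: "T \<in> ideal_triples" "(\<lambda>x. multiplier v * x) ` L = triple_ideal T"
    using module_is_triple_ideal multiplier_integral by metis
  have "homothety_class (triple_ideal T) = homothety_class L"
    unfolding T(2)[symmetric] by (rule homothety_class_scale[OF multiplier_K nz])
  then show ?thesis using that T by (simp add: class_triples_def)
qed

lemma class_positive_form: "positive_form (real a) (of_int (2 * b + 1)) (of_int c)"
proof
  have "4 * (int a * c) - (2 * b + 1)\<^sup>2 = N" using four_nrm[of b] c by simp
  then have "real_of_int (4 * (int a * c) - (2 * b + 1)\<^sup>2) = real_of_int N" by simp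
  then show "4 * real a * of_int c - (of_int (2 * b + 1))\<^sup>2 > 0" using N_gt by simp
qed (use a_pos in simp)

text \<open>
  The area of a fundamental parallelogram of \<open>\<alpha> L\<close> is \<open>a \<bar>\<alpha>\<bar>\<^sup>2\<close> times that of the ring of integers, and
  the area does not depend on the basis.
\<close>

lemma triple_norm_multiplier:
  fixes x y :: int
  assumes T: "T \<in> ideal_triples" "triple_ideal T = (\<lambda>z. multiplier (x, y) * z) ` L"
  shows "real (triple_norm T) = class_form (of_int x) (of_int y)"
proof -
  obtain m a' b' where Tm: "T = (m, a', b')" by (cases T)
  define \<alpha> where "\<alpha> = multiplier (x, y)"
  have "zlat (of_nat m * of_nat a') (of_nat m * (of_int b' + om)) = zlat (\<alpha> * of_nat a) (\<alpha> * (of_int b + om))"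
    using T(2) unfolding Tm L_zlat zlat_scale \<alpha>_def by simp
  from zlat_area_unique[OF this]
  have area: "\<bar>Im (cnj (of_nat m * of_nat a') * (of_nat m * (of_int b' + om)))\<bar> =
    \<bar>Im (cnj (\<alpha> * of_nat a) * (\<alpha> * (of_int b + om)))\<bar>" .
  have "\<bar>Im (cnj (of_nat m * of_nat a') * (of_nat m * (of_int b' + om)))\<bar> = real (m\<^sup>2 * a') * Im om"
    using om_Im by (simp add: power2_eq_square abs_mult)
  moreover have "Im (cnj (\<alpha> * of_nat a) * (\<alpha> * (of_int b + om))) =
    class_form (of_int x) (of_int y) * Im om"
  proof -
    have "cnj (\<alpha> * of_nat a) * (\<alpha> * (of_int b + om)) = (of_nat a * (\<alpha> * cnj \<alpha>)) * (of_int b + om)"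
      by (simp add: mult_ac)
    also have "\<dots> = of_real (of_int (int a * x\<^sup>2 + (2 * b + 1) * x * y + c * y\<^sup>2)) * (of_int b + om)"
      unfolding \<alpha>_def multiplier_norm by simp
    finally have "cnj (\<alpha> * of_nat a) * (\<alpha> * (of_int b + om)) =
      of_real (of_int (int a * x\<^sup>2 + (2 * b + 1) * x * y + c * y\<^sup>2)) * (of_int b + om)" .
    then have "Im (cnj (\<alpha> * of_nat a) * (\<alpha> * (of_int b + om))) =
      of_int (int a * x\<^sup>2 + (2 * b + 1) * x * y + c * y\<^sup>2) * Im om"
      by (simp only: Im_of_real_mult) simp
    then show ?thesis by (simp add: qform_def)
  qed
  moreover have "class_form (of_int x) (of_int y) \<ge> 0"
    by (rule positive_form.qform_nonneg[OF class_positive_form])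
  then have "\<bar>class_form (of_int x) (of_int y) * Im om\<bar> =
      class_form (of_int x) (of_int y) * Im om"
    using om_Im by simp
  ultimately have "real (m\<^sup>2 * a') * Im om = class_form (of_int x) (of_int y) * Im om"
    using area by (simp only:)
  then have "real (m\<^sup>2 * a') = class_form (of_int x) (of_int y)"
    using om_Im by (simp only: mult_cancel_right) simp
  then show ?thesis by (simp only: Tm triple_norm.simps)
qed

text \<open>
  Every integral ideal in the class of \<open>L\<close> is \<open>\<alpha> L\<close> for exactly two multipliers \<open>\<alpha>\<close>, and the origin of
  the lattice of multipliers contributes \<open>1\<close>.
\<close>

lemma class_theta:
  assumes t: "t > 0"
  shows "lattice_theta (real a) (of_int (2 * b + 1)) (of_int c) t =
    1 + 2 * infsum (ideal_weight t) class_triples"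
proof -
  interpret positive_form "real a" "of_int (2 * b + 1)" "of_int c" by (rule class_positive_form)
  define q where "q = (\<lambda>v :: int \<times> int. class_form (of_int (fst v)) (of_int (snd v)))"
  define fib where "fib = (\<lambda>T. {v. v \<noteq> (0, 0) \<and> triple_ideal T = (\<lambda>x. multiplier v * x) ` L})"
  have "(\<lambda>v. exp (- t * q v)) summable_on UNIV"
    using lattice_theta_summable[OF t] by (simp add: q_def case_prod_beta')
  then have sum: "(\<lambda>v. exp (- t * q v)) summable_on (- {(0, 0)})" by (rule summable_on_subset) auto
  have "lattice_theta (real a) (of_int (2 * b + 1)) (of_int c) t = infsum (\<lambda>v. exp (- t * q v)) (insert (0, 0) (- {(0, 0)}))"
    unfolding lattice_theta_def q_def by (rule infsum_cong_neutral) auto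
  also have "\<dots> = exp (- t * q (0, 0)) + infsum (\<lambda>v. exp (- t * q v)) (- {(0, 0)})"
    using sum by (intro infsum_insert) auto
  also have "exp (- t * q (0, 0)) = 1" by (simp add: q_def qform_def)
  finally have theta: "lattice_theta (real a) (of_int (2 * b + 1)) (of_int c) t =
    1 + infsum (\<lambda>v. exp (- t * q v)) (- {(0, 0)})" .
  define S where "S = infsum (\<lambda>v. exp (- t * q v)) (- {(0, 0)})"
  have "((\<lambda>v. exp (- t * q v)) has_sum S) (- {(0, 0)})" using sum by (simp add: S_def)
  moreover have "bij_betw snd (Sigma class_triples fib) (- {(0, 0)})"
    unfolding bij_betw_def
  proof (intro conjI)
    show "inj_on snd (Sigma class_triples fib)"
      using triple_ideal_inj by (auto simp: inj_on_def fib_def class_triples_def simp del: triple_ideal.simps)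
    show "snd ` Sigma class_triples fib = - {(0, 0)}"
    proof (intro equalityI subsetI)
      fix v :: "int \<times> int" assume "v \<in> - {(0, 0)}"
      then have v: "v \<noteq> (0, 0)" by simp
      obtain T where "T \<in> class_triples" "triple_ideal T = (\<lambda>x. multiplier v * x) ` L"
        using triple_of_multiplier[OF v] .
      then show "v \<in> snd ` Sigma class_triples fib"
        using v by (intro image_eqI[of _ _ "(T, v)"]) (auto simp: fib_def simp del: triple_ideal.simps)
    qed (auto simp: fib_def)
  qed
  ultimately have "((\<lambda>w. exp (- t * q (snd w))) has_sum S) (Sigma class_triples fib)"
    using has_sum_reindex_bij_betw[of snd "Sigma class_triples fib" "- {(0, 0)}" "\<lambda>v. exp (- t * q v)" S] by simp
  moreover have "((\<lambda>v. exp (- t * q (snd (T, v)))) has_sum (2 * ideal_weight t T)) (fib T)"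
    if T: "T \<in> class_triples" for T
  proof -
    have Ti: "T \<in> ideal_triples" "homothety_class (triple_ideal T) = homothety_class L"
      using T by (simp_all add: class_triples_def del: triple_ideal.simps)
    then obtain \<alpha> where \<alpha>: "\<alpha> \<noteq> 0" "triple_ideal T = (\<lambda>x. \<alpha> * x) ` L"
      unfolding homothety_class_eq_iff by blast
    have "triple_ideal T \<subseteq> OK" using triple_ideal_module(2) Ti(1) by (cases T) blast
    then obtain v where v: "\<alpha> = multiplier v" using multiplier_surj \<alpha>(2) by metis
    have v0: "v \<noteq> (0, 0)" using \<alpha>(1) v multiplier_eq_0_iff by blast
    define v' where "v' = (- fst v, - snd v)"
    have fibT: "fib T = {v, v'}"
    proof (intro equalityI subsetI)
      fix w assume "w \<in> fib T"
      then have "w \<noteq> (0, 0)" "(\<lambda>x. multiplier v * x) ` L = (\<lambda>x. multiplier w * x) ` L"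
        using \<alpha>(2) v by (simp_all add: fib_def del: triple_ideal.simps)
      then show "w \<in> {v, v'}" using multiplier_ideal_eq_iff[OF v0, of w] by (simp add: v'_def del: triple_ideal.simps)
    next
      fix w assume w: "w \<in> {v, v'}"
      then have "w \<noteq> (0, 0)" using v0 by (auto simp: v'_def prod_eq_iff)
      moreover have "(\<lambda>x. multiplier v * x) ` L = (\<lambda>x. multiplier w * x) ` L"
        using multiplier_ideal_eq_iff[OF v0 \<open>w \<noteq> (0, 0)\<close>] w by (auto simp: v'_def simp del: triple_ideal.simps)
      ultimately show "w \<in> fib T" using \<alpha>(2) v by (simp add: fib_def del: triple_ideal.simps)
    qed
    have "v \<noteq> v'"
    proof
      assume "v = v'"
      then have "fst v = - fst v" "snd v = - snd v" by (metis v'_def fst_conv, metis v'_def snd_conv)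
      then show False using v0 by (simp add: prod_eq_iff)
    qed
    have qw: "q w = real (triple_norm T)" if "w \<in> fib T" for w
      using triple_norm_multiplier[OF Ti(1), of "fst w" "snd w"] that by (simp add: fib_def q_def del: triple_ideal.simps)
    have "(\<Sum>w\<in>fib T. exp (- t * q w)) = (\<Sum>w\<in>fib T. ideal_weight t T)"
      using qw by (intro sum.cong) auto
    also have "\<dots> = 2 * ideal_weight t T"
      using \<open>v \<noteq> v'\<close> by (simp add: fibT)
    finally show ?thesis by (intro has_sum_finiteI) (auto simp: fibT)
  qed
  ultimately have "((\<lambda>T. 2 * ideal_weight t T) has_sum S) class_triples"
    by (rule has_sum_SigmaD)
  then have "S = 2 * infsum (ideal_weight t) class_triples"
    using infsumI infsum_cmult_right'[of 2 "\<lambda>T. ideal_weight t T" class_triples] by metis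
  then show ?thesis using theta by (simp add: S_def)
qed

end

text \<open>
  The sum over all ideals splits into the classes, and each class contributes half of its theta
  series without the term of the origin. The theta series have no constant term at \<open>0\<close>, so the
  missing origins, one for each class, determine the constant term of the sum over ideals.
\<close>

theorem class_number_formula: "real (class_number D) = chi_mean"
proof -
  define TC where "TC = (\<lambda>C. {T \<in> ideal_triples. homothety_class (triple_ideal T) = C})"
  have "\<forall>C\<in>ideal_classes. \<exists>\<theta>. (\<forall>t>0. \<theta> t = 1 + 2 * infsum (ideal_weight t) (TC C)) \<and>
      ((\<lambda>t. \<theta> t - 4 * \<theta> (4 * t)) \<longlongrightarrow> (0::real)) (at_right 0)"
  proof
    fix C assume C: "C \<in> ideal_classes"
    obtain m a b where T: "(m, a, b) \<in> ideal_triples" "C = homothety_class (triple_ideal (m, a, b))"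
      using C unfolding ideal_classes_def by auto
    have p: "(1, a, b) \<in> ideal_triples" "C = homothety_class (triple_ideal (1, a, b))"
      using primitive_representative[OF T(1)] T(2) by simp_all
    then obtain c where c: "nrm b = int a * c" by (auto simp: ideal_triples_def nrm_roots_def)
    interpret positive_form "real a" "of_int (2 * b + 1)" "of_int c"
      by (rule class_positive_form[OF p(1) c])
    have "class_triples a b = TC C"
      by (simp only: class_triples_def[OF p(1) c] TC_def p(2))
    then have "\<forall>t>0. lattice_theta (real a) (of_int (2 * b + 1)) (of_int c) t =
        1 + 2 * infsum (ideal_weight t) (TC C)"
      using class_theta[OF p(1) c] by simp
    then show "\<exists>\<theta>. (\<forall>t>0. \<theta> t = 1 + 2 * infsum (ideal_weight t) (TC C)) \<and>
      ((\<lambda>t. \<theta> t - 4 * \<theta> (4 * t)) \<longlongrightarrow> (0::real)) (at_right 0)"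
      using lattice_theta_constant_term by blast
  qed
  from bchoice[OF this] obtain \<theta> where "\<forall>C\<in>ideal_classes. (\<forall>t>0. \<theta> C t = 1 + 2 * infsum (ideal_weight t) (TC C)) \<and>
      ((\<lambda>t. \<theta> C t - 4 * \<theta> C (4 * t)) \<longlongrightarrow> (0::real)) (at_right 0)" by blast
  then have \<theta>: "\<And>C t. C \<in> ideal_classes \<Longrightarrow> t > 0 \<Longrightarrow>
      \<theta> C t = 1 + 2 * infsum (ideal_weight t) (TC C)"
    and \<theta>_lim: "\<And>C. C \<in> ideal_classes \<Longrightarrow> ((\<lambda>t. \<theta> C t - 4 * \<theta> C (4 * t)) \<longlongrightarrow> (0::real)) (at_right 0)"
    by simp_all
  define h where "h = real (class_number D)"
  have sum: "(\<Sum>C\<in>ideal_classes. \<theta> C t) = h + 2 * ideal_series t" if t: "t > 0" for t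
  proof -
    have "(\<Union>C\<in>ideal_classes. TC C) = ideal_triples" by (auto simp: TC_def ideal_classes_def)
    moreover have "ideal_weight t summable_on TC C" for C
      by (rule summable_on_subset[OF ideal_series_lambert(1)[OF t]]) (auto simp: TC_def)
    then have "(\<Sum>C\<in>ideal_classes. infsum (ideal_weight t) (TC C)) =
        infsum (ideal_weight t) (\<Union>C\<in>ideal_classes. TC C)"
      by (intro sum_infsum finite_ideal_classes) (auto simp: TC_def)
    ultimately have "ideal_series t = (\<Sum>C\<in>ideal_classes. infsum (ideal_weight t) (TC C))"
      by (simp add: ideal_series_def)
    then show ?thesis
      using \<theta> t by (simp add: sum.distrib sum_distrib_left[symmetric] h_def class_number_eq_card)
  qed
  have "((\<lambda>t. \<Sum>C\<in>ideal_classes. \<theta> C t - 4 * \<theta> C (4 * t)) \<longlongrightarrow> (\<Sum>C\<in>ideal_classes. 0)) (at_right 0)"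
    by (intro tendsto_sum \<theta>_lim)
  moreover have "\<forall>\<^sub>F t in at_right 0. (\<Sum>C\<in>ideal_classes. \<theta> C t - 4 * \<theta> C (4 * t)) =
      - 3 * h + 2 * (ideal_series t - 4 * ideal_series (4 * t))"
    using eventually_at_right_less[of "0::real"]
  proof eventually_elim
    case (elim t)
    then show ?case using sum[of t] sum[of "4 * t"]
      by (simp add: sum_subtractf sum_distrib_left[symmetric])
  qed
  ultimately have "((\<lambda>t. - 3 * h + 2 * (ideal_series t - 4 * ideal_series (4 * t))) \<longlongrightarrow> 0) (at_right 0)"
    by (simp add: tendsto_cong)
  moreover have "((\<lambda>t. - 3 * h + 2 * (ideal_series t - 4 * ideal_series (4 * t))) \<longlongrightarrow>
      - 3 * h + 2 * (3 / 2 * chi_mean)) (at_right 0)"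
    by (intro tendsto_intros ideal_series_constant_term)
  ultimately have "- 3 * h + 2 * (3 / 2 * chi_mean) = 0"
    using tendsto_unique[OF trivial_limit_at_right_real] by blast
  then show ?thesis by (simp add: h_def)
qed

end


section \<open>Character sums over twelfths of the period\<close>

lemma int_div_eq_iff:
  fixes a b k :: int
  assumes "0 < b"
  shows "a div b = k \<longleftrightarrow> k * b \<le> a \<and> a < (k + 1) * b"
proof
  assume "a div b = k"
  then show "k * b \<le> a \<and> a < (k + 1) * b"
    using div_mult_mod_eq[of a b] pos_mod_bound[OF assms, of a] pos_mod_sign[OF assms, of a]
    by (auto simp: algebra_simps)
next
  assume "k * b \<le> a \<and> a < (k + 1) * b"
  then show "a div b = k"
    by (intro int_div_pos_eq[of a b k "a - k * b"]) (auto simp: algebra_simps)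
qed

context odd_imaginary_discriminant
begin

definition moment :: int where
  "moment = (\<Sum>x\<in>{1..<N}. x * chi x)"

lemma moment_eq: "moment = - N * int (class_number D)"
proof -
  have "(\<Sum>j<nat N. real j * of_int (chi (int j))) = of_int moment"
  proof -
    have "moment = (\<Sum>x\<in>{0..<N}. x * chi x)"
      unfolding moment_def by (rule sum.mono_neutral_left) auto
    also have "\<dots> = (\<Sum>j\<in>{..<nat N}. int j * chi (int j))"
      by (rule sum.reindex_bij_witness[of _ int nat]) auto
    finally show ?thesis by simp
  qed
  then have "of_int N * chi_mean = - of_int moment"
    using N_gt by (simp add: chi_mean_def)
  then have "of_int N * real (class_number D) = - of_int moment"
    by (simp add: class_number_formula)
  then have "real_of_int (N * int (class_number D)) = real_of_int (- moment)" by simp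
  then have "N * int (class_number D) = - moment" by (simp only: of_int_eq_iff)
  then show ?thesis by simp
qed

text \<open>
  For \<open>m\<close> coprime to \<open>N\<close> and \<open>0 < x < N\<close> the product \<open>m x\<close> is not divisible by \<open>N\<close>, so \<open>\<lfloor>m x / N\<rfloor> = k\<close> says that \<open>x\<close> lies in the
  open interval from \<open>k N / m\<close> to \<open>(k + 1) N / m\<close>. In terms of the floor, the intervals partition the
  residues and refine well.
\<close>

definition part_sum :: "int \<Rightarrow> int \<Rightarrow> int" where
  "part_sum m k = (\<Sum>x | 1 \<le> x \<and> x < N \<and> m * x div N = k. chi x)"

lemma finite_range: "finite {x. 1 \<le> x \<and> x < N \<and> P x}"
  by (rule finite_subset[of _ "{1..<N}"]) auto

text \<open>
  Multiplication by \<open>m\<close> permutes the residues, so the moment of \<open>\<chi>\<close> can be computed from the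
  residues \<open>m x - N \<lfloor>m x / N\<rfloor>\<close>.
\<close>

lemma floor_moment:
  assumes m: "m > 0" "coprime m N"
  shows "(\<Sum>x\<in>{1..<N}. chi x * (m * x div N)) = - (m - chi m) * int (class_number D)"
proof -
  have N: "N > 0" using N_gt by simp
  have "bij_betw (\<lambda>x. m * x mod N) {1..<N} {1..<N}"
  proof (rule bij_betwI')
    fix x y assume xy: "x \<in> {1..<N}" "y \<in> {1..<N}"
    show "(m * x mod N = m * y mod N) = (x = y)"
    proof
      assume "m * x mod N = m * y mod N"
      then have "N dvd m * (x - y)" by (simp add: mod_eq_dvd_iff right_diff_distrib)
      then have "N dvd x - y" using m(2) by (simp add: coprime_commute coprime_dvd_mult_right_iff)
      then have "x mod N = y mod N" by (simp add: mod_eq_dvd_iff)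
      then show "x = y" using xy by simp
    qed simp
  next
    fix x assume x: "x \<in> {1..<N}"
    have "\<not> N dvd m * x"
      using x m(2) zdvd_not_zless[of x N] by (simp add: coprime_commute coprime_dvd_mult_right_iff)
    then have "m * x mod N \<noteq> 0" by (simp add: dvd_eq_mod_eq_0)
    moreover have "0 \<le> m * x mod N" "m * x mod N < N" using N by simp_all
    ultimately show "m * x mod N \<in> {1..<N}" by simp
  next
    fix y assume y: "y \<in> {1..<N}"
    obtain u where u: "[m * u = 1] (mod N)" using cong_solve_coprime_int m(2) by blast
    define x where "x = u * y mod N"
    have "m * x mod N = (m * u) * y mod N" by (simp add: x_def mod_mult_right_eq mult.assoc)
    also have "\<dots> = 1 * y mod N" using u cong_mult[OF u cong_refl[of y]] by (simp add: Cong.cong_def)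
    also have "\<dots> = y" using y by simp
    finally have "m * x mod N = y" .
    moreover have "x \<in> {1..<N}"
    proof -
      have "x \<noteq> 0" using \<open>m * x mod N = y\<close> y by auto
      moreover have "0 \<le> x" "x < N" using N by (simp_all add: x_def)
      ultimately show ?thesis by simp
    qed
    ultimately show "\<exists>x\<in>{1..<N}. y = m * x mod N" by blast
  qed
  then have "moment = (\<Sum>x\<in>{1..<N}. (m * x mod N) * chi (m * x mod N))"
    unfolding moment_def by (rule sum.reindex_bij_betw[symmetric])
  also have "\<dots> = (\<Sum>x\<in>{1..<N}. chi m * (m * (x * chi x) - N * (chi x * (m * x div N))))"
  proof (rule sum.cong)
    fix x
    have "chi (m * x mod N) = chi (m * x)" by (rule chi_cong) (simp add: Cong.cong_def)
    then have "(m * x mod N) * chi (m * x mod N) = (m * x mod N) * (chi m * chi x)" by (simp only: chi_mult)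
    also have "\<dots> = (m * x - N * (m * x div N)) * (chi m * chi x)" by (simp only: minus_mult_div_eq_mod)
    finally show "(m * x mod N) * chi (m * x mod N) = chi m * (m * (x * chi x) - N * (chi x * (m * x div N)))"
      by (simp add: algebra_simps)
  qed simp
  also have "\<dots> = chi m * (m * moment - N * (\<Sum>x\<in>{1..<N}. chi x * (m * x div N)))"
    by (simp add: sum_distrib_left[symmetric] sum_subtractf moment_def)
  finally have eq: "moment = chi m * (m * moment - N * (\<Sum>x\<in>{1..<N}. chi x * (m * x div N)))" .
  have "chi m \<noteq> 0" using m(2) by (simp add: chi_eq_0_iff)
  then have sq: "chi m * chi m = 1" using chi_values[of m] by auto
  have "chi m * moment = (chi m * chi m) * (m * moment - N * (\<Sum>x\<in>{1..<N}. chi x * (m * x div N)))"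
    using arg_cong[OF eq, of "\<lambda>z. chi m * z"] by (simp only: mult.assoc)
  then have "N * (\<Sum>x\<in>{1..<N}. chi x * (m * x div N)) = (m - chi m) * moment"
    unfolding sq by (simp add: algebra_simps)
  then have "N * (\<Sum>x\<in>{1..<N}. chi x * (m * x div N)) = N * (- (m - chi m) * int (class_number D))"
    unfolding moment_eq by (simp add: algebra_simps)
  then show ?thesis using N by (simp only: mult_cancel_left) simp
qed

lemma weighted_part_sums:
  assumes m: "m > 0" "coprime (int m) N"
  shows "(\<Sum>k<m. int k * part_sum (int m) (int k)) = - (int m - chi (int m)) * int (class_number D)"
proof -
  have "(\<Sum>x\<in>{1..<N}. chi x * (int m * x div N)) = (\<Sum>x\<in>{1..<N}. \<Sum>k<m. int k * (if int m * x div N = int k then chi x else 0))"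
  proof (rule sum.cong)
    fix x assume x: "x \<in> {1..<N}"
    define q where "q = nat (int m * x div N)"
    have "0 \<le> int m * x div N" using x by (simp add: pos_imp_zdiv_nonneg_iff)
    then have q: "int m * x div N = int q" by (simp add: q_def)
    have "int q * N \<le> int m * x" using int_div_eq_iff[of N "int m * x" "int q"] q N_gt by simp
    also have "int m * x < int m * N" using x m by simp
    finally have "q < m" using N_gt by simp
    have "(\<Sum>k<m. int k * (if int m * x div N = int k then chi x else 0)) = (\<Sum>k<m. if k = q then int k * chi x else 0)"
      unfolding q by (intro sum.cong) auto
    also have "\<dots> = chi x * (int m * x div N)" using \<open>q < m\<close> by (simp add: q)
    finally show "chi x * (int m * x div N) = (\<Sum>k<m. int k * (if int m * x div N = int k then chi x else 0))" ..
  qed simp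
  also have "\<dots> = (\<Sum>k<m. \<Sum>x\<in>{1..<N}. int k * (if int m * x div N = int k then chi x else 0))"
    by (rule sum.swap)
  also have "\<dots> = (\<Sum>k<m. int k * part_sum (int m) (int k))"
  proof (rule sum.cong)
    fix k
    have "{x. 1 \<le> x \<and> x < N \<and> int m * x div N = int k} = {1..<N} \<inter> {x. int m * x div N = int k}" by auto
    then show "(\<Sum>x\<in>{1..<N}. int k * (if int m * x div N = int k then chi x else 0)) = int k * part_sum (int m) (int k)"
      by (simp add: part_sum_def sum_distrib_left[symmetric] sum.inter_restrict)
  qed simp
  finally show ?thesis using floor_moment[of "int m"] m by simp
qed

text \<open>The reflection \<open>x \<mapsto> N - x\<close> exchanges opposite intervals and changes the sign of \<open>\<chi>\<close>.\<close>

lemma part_sum_reflect: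
  assumes m: "m > 0" "coprime m N"
  shows "part_sum m (m - 1 - k) = - part_sum m k"
proof -
  have refl: "m * (N - x) div N = m - 1 - m * x div N" if x: "1 \<le> x" "x < N" for x
  proof -
    have "\<not> N dvd m * x"
      using x m(2) zdvd_not_zless[of x N] by (simp add: coprime_commute coprime_dvd_mult_right_iff)
    then have nd: "m * x mod N \<noteq> 0" by (simp add: dvd_eq_mod_eq_0)
    have "m * (N - x) = N * (m - 1 - m * x div N) + (N - m * x mod N)"
      using mult_div_mod_eq[of N "m * x"] by (simp add: algebra_simps)
    moreover have "0 \<le> N - m * x mod N" "N - m * x mod N < N"
      using x nd pos_mod_bound[of N "m * x"] pos_mod_sign[of N "m * x"] by linarith+
    ultimately show ?thesis by (simp add: div_pos_pos_trivial)
  qed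
  have "part_sum m (m - 1 - k) = (\<Sum>x | 1 \<le> x \<and> x < N \<and> m * x div N = k. - chi x)"
    unfolding part_sum_def
  proof (rule sum.reindex_bij_witness[of _ "\<lambda>x. N - x" "\<lambda>x. N - x"])
    fix x assume "x \<in> {x. 1 \<le> x \<and> x < N \<and> m * x div N = m - 1 - k}"
    then show "N - x \<in> {x. 1 \<le> x \<and> x < N \<and> m * x div N = k}" "- chi (N - x) = chi x"
      using refl[of x] by (auto simp: chi_reflect)
  next
    fix x assume "x \<in> {x. 1 \<le> x \<and> x < N \<and> m * x div N = k}"
    then show "N - x \<in> {x. 1 \<le> x \<and> x < N \<and> m * x div N = m - 1 - k}"
      using refl[of x] by auto
  qed auto
  then show ?thesis by (simp add: sum_negf part_sum_def)
qed

text \<open>An interval of length \<open>N / m\<close> is the union of \<open>d\<close> intervals of length \<open>N / (d m)\<close>.\<close>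

lemma part_sum_refine:
  assumes "d > 0"
  shows "part_sum m k = (\<Sum>i\<in>{0..<d}. part_sum (d * m) (d * k + i))"
proof -
  have "{x. 1 \<le> x \<and> x < N \<and> m * x div N = k} = (\<Union>i\<in>{0..<d}. {x. 1 \<le> x \<and> x < N \<and> (d * m) * x div N = d * k + i})"
  proof -
    have "m * x div N = k \<longleftrightarrow> (\<exists>i\<in>{0..<d}. (d * m) * x div N = d * k + i)" for x
    proof -
      define q where "q = (d * m) * x div N"
      have "m * x div N = (d * (m * x)) div (d * N)" using assms by simp
      also have "\<dots> = q div d" unfolding q_def by (subst mult.commute[of d N]) (simp add: zdiv_zmult2_eq assms mult.assoc less_imp_le)
      finally have "m * x div N = q div d" .
      moreover have "q div d = k \<longleftrightarrow> (\<exists>i\<in>{0..<d}. q = d * k + i)"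
      proof
        assume "q div d = k"
        then show "\<exists>i\<in>{0..<d}. q = d * k + i"
          using assms mult_div_mod_eq[of d q] by (intro bexI[of _ "q mod d"]) auto
      qed (use assms in auto)
      ultimately show ?thesis by (simp add: q_def)
    qed
    then show ?thesis by blast
  qed
  then have "part_sum m k = (\<Sum>x\<in>(\<Union>i\<in>{0..<d}. {x. 1 \<le> x \<and> x < N \<and> (d * m) * x div N = d * k + i}). chi x)"
    unfolding part_sum_def by (simp only:)
  also have "\<dots> = (\<Sum>i\<in>{0..<d}. part_sum (d * m) (d * k + i))"
    unfolding part_sum_def by (subst sum.UNION_disjoint) (auto simp: finite_range)
  finally show ?thesis .
qed

lemma interval_char_sum_eq_part_sum:
  assumes m: "m > 0" "coprime (int m) N" and k: "k < m"
  shows "interval_char_sum D m k = part_sum (int m) (int k)"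
  unfolding interval_char_sum_def part_sum_def
proof (rule sum.mono_neutral_cong_left)
  let ?I = "{x. 1 \<le> x \<and> x \<le> \<bar>D\<bar> \<and> coprime x \<bar>D\<bar> \<and> real k * real_of_int \<bar>D\<bar> / real m < real_of_int x \<and>
      real_of_int x < real (k + 1) * real_of_int \<bar>D\<bar> / real m}"
  have N: "N > 0" using N_gt by simp
  have *: "(real k * real_of_int N / real m < real_of_int x \<and> real_of_int x < real (k + 1) * real_of_int N / real m)
      \<longleftrightarrow> int m * x div N = int k" if x: "1 \<le> x" "x < N" for x
  proof -
    have "real k * real_of_int N / real m < real_of_int x \<longleftrightarrow> real_of_int (int k * N) < real_of_int (int m * x)"
      using m by (simp add: divide_less_eq mult.commute)
    moreover have "real_of_int x < real (k + 1) * real_of_int N / real m \<longleftrightarrow> real_of_int (int m * x) < real_of_int ((int k + 1) * N)"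
      using m by (simp add: less_divide_eq algebra_simps)
    moreover have "int k * N \<noteq> int m * x"
    proof
      assume "int k * N = int m * x"
      then have "N dvd int m * x" by (metis dvd_triv_right)
      then show False using x m(2) zdvd_not_zless[of x N] by (simp add: coprime_commute coprime_dvd_mult_right_iff)
    qed
    moreover have "int m * x div N = int k \<longleftrightarrow> int k * N \<le> int m * x \<and> int m * x < (int k + 1) * N"
      by (rule int_div_eq_iff[OF N])
    ultimately show ?thesis unfolding of_int_less_iff by linarith
  qed
  show "finite {x. 1 \<le> x \<and> x < N \<and> int m * x div N = int k}" by (rule finite_range)
  show "?I \<subseteq> {x. 1 \<le> x \<and> x < N \<and> int m * x div N = int k}"
  proof
    fix x assume x: "x \<in> ?I"
    have "x \<noteq> N"
    proof
      assume "x = N"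
      then have "coprime N N" using x by (simp add: abs_D)
      then show False using N_gt by simp
    qed
    then have "1 \<le> x" "x < N" using x by (auto simp: abs_D)
    then show "x \<in> {x. 1 \<le> x \<and> x < N \<and> int m * x div N = int k}" using * x by (simp add: abs_D)
  qed
  show "\<forall>x\<in>{x. 1 \<le> x \<and> x < N \<and> int m * x div N = int k} - ?I. chi x = 0"
    using * by (auto simp: abs_D chi_eq_0_iff)
qed simp

text \<open>
  With \<open>m = 2, 3, 4, 6, 12\<close> the weighted sums of \<open>\<chi>\<close> over the \<open>m\<close> intervals give five linear
  equations for the six sums over twelfths.
\<close>

lemma twelfth_relations:
  assumes "\<not> 3 dvd D"
  defines "h \<equiv> int (class_number D)" and "e \<equiv> (\<lambda>k. interval_char_sum D 12 k)"
  shows "e 0 + e 1 + e 2 + e 3 + e 4 + e 5 = (2 - chi 2) * h"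
    and "2 * (e 0 + e 1 + e 2 + e 3) = (3 - chi 3) * h"
    and "3 * (e 0 + e 1 + e 2) + (e 3 + e 4 + e 5) = (4 - chi 2 * chi 2) * h"
    and "5 * (e 0 + e 1) + 3 * (e 2 + e 3) + (e 4 + e 5) = (6 - chi 2 * chi 3) * h"
    and "11 * e 0 + 9 * e 1 + 7 * e 2 + 5 * e 3 + 3 * e 4 + e 5 = (12 - chi 2 * chi 2 * chi 3) * h"
proof -
  have c2: "coprime 2 N" using N_odd by simp
  have "\<not> 3 dvd N" using assms by (simp add: N_def)
  then have c3: "coprime 3 N" by (intro prime_imp_coprime) auto
  have c: "coprime 4 N" "coprime 6 N" "coprime 12 N"
    using c2 c3 coprime_mult_left_iff[of 2 2 N] coprime_mult_left_iff[of 2 3 N] coprime_mult_left_iff[of 4 3 N] by auto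
  define s where "s = (\<lambda>k. part_sum 12 k)"
  have es: "e 0 = s 0" "e 1 = s 1" "e 2 = s 2" "e 3 = s 3" "e 4 = s 4" "e 5 = s 5"
    using interval_char_sum_eq_part_sum[of 12] c by (simp_all add: e_def s_def)
  have r: "s 6 = - s 5" "s 7 = - s 4" "s 8 = - s 3" "s 9 = - s 2" "s 10 = - s 1" "s 11 = - s 0"
    using part_sum_reflect[of 12 5] part_sum_reflect[of 12 4] part_sum_reflect[of 12 3] part_sum_reflect[of 12 2]
      part_sum_reflect[of 12 1] part_sum_reflect[of 12 0] c by (simp_all add: s_def)
  have iv: "{0..<2::int} = {0, 1}" "{0..<3::int} = {0, 1, 2}" "{0..<4::int} = {0, 1, 2, 3}"
    "{0..<6::int} = {0, 1, 2, 3, 4, 5}" by auto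
  have m2: "part_sum 2 1 = s 6 + s 7 + s 8 + s 9 + s 10 + s 11"
    using part_sum_refine[of 6 2 1] by (simp add: iv s_def)
  have m3: "part_sum 3 1 = s 4 + s 5 + s 6 + s 7" "part_sum 3 2 = s 8 + s 9 + s 10 + s 11"
    using part_sum_refine[of 4 3 1] part_sum_refine[of 4 3 2] by (simp_all add: iv s_def)
  have m4: "part_sum 4 1 = s 3 + s 4 + s 5" "part_sum 4 2 = s 6 + s 7 + s 8" "part_sum 4 3 = s 9 + s 10 + s 11"
    using part_sum_refine[of 3 4 1] part_sum_refine[of 3 4 2] part_sum_refine[of 3 4 3] by (simp_all add: iv s_def)
  have m6: "part_sum 6 1 = s 2 + s 3" "part_sum 6 2 = s 4 + s 5" "part_sum 6 3 = s 6 + s 7" "part_sum 6 4 = s 8 + s 9" "part_sum 6 5 = s 10 + s 11"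
    using part_sum_refine[of 2 6 1] part_sum_refine[of 2 6 2] part_sum_refine[of 2 6 3] part_sum_refine[of 2 6 4] part_sum_refine[of 2 6 5]
    by (simp_all add: iv s_def)
  have ch: "chi 4 = chi 2 * chi 2" "chi 6 = chi 2 * chi 3" "chi 12 = chi 2 * chi 2 * chi 3"
    using chi_mult[of 2 2] chi_mult[of 2 3] chi_mult[of 4 3] by simp_all
  have ls: "{..<2::nat} = {0, 1}" "{..<3::nat} = {0, 1, 2}" "{..<4::nat} = {0, 1, 2, 3}"
    "{..<6::nat} = {0, 1, 2, 3, 4, 5}" "{..<12::nat} = {0, 1, 2, 3, 4, 5, 6, 7, 8, 9, 10, 11}"
    by (auto simp: lessThan_nat_numeral)
  have w2: "part_sum 2 1 = - (2 - chi 2) * h"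
    using weighted_part_sums[of 2] c2 by (simp add: ls h_def)
  have w3: "part_sum 3 1 + 2 * part_sum 3 2 = - (3 - chi 3) * h"
    using weighted_part_sums[of 3] c3 by (simp add: ls h_def)
  have w4: "part_sum 4 1 + 2 * part_sum 4 2 + 3 * part_sum 4 3 = - (4 - chi 2 * chi 2) * h"
    using weighted_part_sums[of 4] c by (simp add: ls h_def ch)
  have w6: "part_sum 6 1 + 2 * part_sum 6 2 + 3 * part_sum 6 3 + 4 * part_sum 6 4 + 5 * part_sum 6 5 = - (6 - chi 2 * chi 3) * h"
    using weighted_part_sums[of 6] c by (simp add: ls h_def ch)
  have w12: "s 1 + 2 * s 2 + 3 * s 3 + 4 * s 4 + 5 * s 5 + 6 * s 6 + 7 * s 7 + 8 * s 8 + 9 * s 9 + 10 * s 10 + 11 * s 11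
      = - (12 - chi 2 * chi 2 * chi 3) * h"
    using weighted_part_sums[of 12] c by (simp add: ls h_def ch s_def)
  show "e 0 + e 1 + e 2 + e 3 + e 4 + e 5 = (2 - chi 2) * h" using w2 unfolding m2 r es by (simp add: algebra_simps)
  show "2 * (e 0 + e 1 + e 2 + e 3) = (3 - chi 3) * h" using w3 unfolding m3 r es by (simp add: algebra_simps)
  show "3 * (e 0 + e 1 + e 2) + (e 3 + e 4 + e 5) = (4 - chi 2 * chi 2) * h" using w4 unfolding m4 r es by (simp add: algebra_simps)
  show "5 * (e 0 + e 1) + 3 * (e 2 + e 3) + (e 4 + e 5) = (6 - chi 2 * chi 3) * h" using w6 unfolding m6 r es by (simp add: algebra_simps)
  show "11 * e 0 + 9 * e 1 + 7 * e 2 + 5 * e 3 + 3 * e 4 + e 5 = (12 - chi 2 * chi 2 * chi 3) * h"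
    using w12 unfolding r es by (simp add: algebra_simps)
qed

lemma chi_three: "chi 3 = (if N mod 3 = 2 then 1 else if N mod 3 = 1 then -1 else 0)"
proof -
  have "chi 3 = Legendre D 3" by (rule chi_odd_prime) auto
  moreover have "QuadRes 3 D" if "D mod 3 = 1" unfolding QuadRes_def
    using that by (intro exI[of _ 1]) (simp add: Cong.cong_def)
  moreover have "\<not> QuadRes 3 D" if D2: "D mod 3 = 2"
  proof
    assume "QuadRes 3 D"
    then obtain y :: int where "y\<^sup>2 mod 3 = 2" using D2 by (auto simp: QuadRes_def Cong.cong_def)
    moreover have "y\<^sup>2 mod 3 = (y mod 3)\<^sup>2 mod 3" by (simp add: power_mod)
    moreover have "y mod 3 = 0 \<or> y mod 3 = 1 \<or> y mod 3 = 2" by presburger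
    ultimately show False by auto
  qed
  moreover have "D mod 3 = 0 \<and> N mod 3 = 0 \<or> D mod 3 = 1 \<and> N mod 3 = 2 \<or> D mod 3 = 2 \<and> N mod 3 = 1"
    unfolding N_def by presburger
  ultimately show ?thesis unfolding Legendre_def by (auto simp: Cong.cong_def)
qed

end

theorem theorem4p4:
  fixes D N h :: int and E :: "nat \<Rightarrow> int"
  assumes "D < -4" and "squarefree D" and "[D = 1] (mod 4)" and "\<not> 3 dvd D"
    and "N = \<bar>D\<bar>"
    and "h = int (class_number D)"
    and "\<And>k. k \<le> 5 \<Longrightarrow> E k = interval_char_sum D 12 k"
  shows
    "([N = 23] (mod 24) \<longrightarrow>
        E 1 = h - E 0 \<and> E 2 = 0 \<and> E 3 = 0 \<and> E 4 = h - E 0 \<and> E 5 = - h + E 0) \<and>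
     ([N = 11] (mod 24) \<longrightarrow>
        E 1 = h - E 0 \<and> E 2 = - h \<and> E 3 = h \<and> E 4 = h - E 0 \<and> E 5 = h + E 0) \<and>
     ([N = 7] (mod 24) \<longrightarrow>
        E 1 = h - E 0 \<and> E 2 = 0 \<and> E 3 = h \<and> E 4 = - E 0 \<and> E 5 = - h + E 0) \<and>
     ([N = 19] (mod 24) \<longrightarrow>
        E 1 = - h - E 0 \<and> E 2 = h \<and> E 3 = 2 * h \<and> E 4 = 2 * h - E 0 \<and> E 5 = - h + E 0)"
proof -
  interpret Q: odd_imaginary_discriminant D using assms by unfold_locales
  have NQ: "Q.N = N" using assms by (simp add: Q.abs_D)
  have E: "interval_char_sum D 12 0 = E 0" "interval_char_sum D 12 1 = E 1" "interval_char_sum D 12 2 = E 2"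
    "interval_char_sum D 12 3 = E 3" "interval_char_sum D 12 4 = E 4" "interval_char_sum D 12 5 = E 5"
    using assms(7) by simp_all
  note rel = Q.twelfth_relations[OF assms(4), folded assms(6), unfolded E]
  (* In each residue class chi(2) and chi(3) are known, and solving the five linear equations for
     E 1, ..., E 5 in terms of h and E 0 is linear arithmetic. *)
  note two = Q.chi_two[unfolded NQ] and three = Q.chi_three[unfolded NQ]
  show ?thesis
  proof (intro conjI impI)
    assume "[N = 23] (mod 24)"
    then have "N mod 24 = 23" by (simp add: Cong.cong_def)
    then have "N mod 8 = 7" "N mod 3 = 2" by presburger+
    then have "quadratic_char D 2 = 1" "quadratic_char D 3 = 1" using two three by simp_all
    then show "E 1 = h - E 0" "E 2 = 0" "E 3 = 0" "E 4 = h - E 0" "E 5 = - h + E 0"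
      using rel by simp_all
  next
    assume "[N = 11] (mod 24)"
    then have "N mod 24 = 11" by (simp add: Cong.cong_def)
    then have "N mod 8 = 3" "N mod 3 = 2" by presburger+
    then have "quadratic_char D 2 = -1" "quadratic_char D 3 = 1" using two three by simp_all
    then show "E 1 = h - E 0" "E 2 = - h" "E 3 = h" "E 4 = h - E 0" "E 5 = h + E 0"
      using rel by simp_all
  next
    assume "[N = 7] (mod 24)"
    then have "N mod 24 = 7" by (simp add: Cong.cong_def)
    then have "N mod 8 = 7" "N mod 3 = 1" by presburger+
    then have "quadratic_char D 2 = 1" "quadratic_char D 3 = -1" using two three by simp_all
    then show "E 1 = h - E 0" "E 2 = 0" "E 3 = h" "E 4 = - E 0" "E 5 = - h + E 0"
      using rel by simp_all
  next
    assume "[N = 19] (mod 24)"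
    then have "N mod 24 = 19" by (simp add: Cong.cong_def)
    then have "N mod 8 = 3" "N mod 3 = 1" by presburger+
    then have "quadratic_char D 2 = -1" "quadratic_char D 3 = -1" using two three by simp_all
    then show "E 1 = - h - E 0" "E 2 = h" "E 3 = 2 * h" "E 4 = 2 * h - E 0" "E 5 = - h + E 0"
      using rel by simp_all
  qed
qed

end
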